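(* Let $G$ be a discrete group and let $\mathcal K=(K,m,1,\alpha,\beta,\theta)$ be a pseudomonoid with strict unit in the 2-category of $G$-sets with twists. Then the triple $(Bun_G(\mathcal K),\otimes,\underline{\mathbb C})$, endowed with the tensor product $\otimes$ (with associativity constraint $\Theta$) and the unit element $\underline{\mathbb C}$, is a monoidal category.
   Context: $\mathbb T=S^1$, written multiplicatively. A pseudomonoid with strict unit $\mathcal K=(K,m,1,\alpha,\beta,\theta)$ in the 2-category of $G$-sets with twists amounts to: a monoid $(K,m,1)$ with a left $G$-action by monoid automorphisms (written $\sigma\cdot k$), and maps $\alpha:G^2\times K\to\mathbb T$, $\beta:G\times K^2\to\mathbb T$, $\theta:K^3\to\mathbb T$, each equal to $1$ whenever some argument is an identity element, such that for all $\sigma,\tau,\rho\in G$, $x,y,z,t\in K$: $\alpha[\tau|\rho||x]\,\alpha[\sigma|\tau\rho||x]=\alpha[\sigma\tau|\rho||x]\,\alpha[\sigma|\tau||\rho\cdot x]$; $\beta[\tau||x|y]\,\beta[\sigma\tau||x|y]^{-1}\beta[\sigma||\tau\cdot x|\tau\cdot y]=\alpha[\sigma|\tau||xy]\,\alpha[\sigma|\tau||x]^{-1}\alpha[\sigma|\tau||y]^{-1}$; $\theta[x|y|z]\,\theta[\sigma\cdot x|\sigma\cdot y|\sigma\cdot z]^{-1}=\beta[\sigma||y|z]\,\beta[\sigma||xy|z]^{-1}\beta[\sigma||x|yz]\,\beta[\sigma||x|y]^{-1}$; $\theta[xy|z|t]\,\theta[x|y|zt]=\theta[x|y|z]\,\theta[x|yz|t]\,\theta[y|z|t]$.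 $Bun_G(\mathcal K)$: an object is a $K$-graded finite dimensional Hilbert space $\mathcal H=\bigoplus_{k\in K}\mathcal H_k$ with a twisted $G$-action $\rhd:G\to U(\mathcal H)$ such that $\sigma\rhd\mathcal H_k=\mathcal H_{\sigma\cdot k}$, $\sigma\rhd(\tau\rhd h_k)=\alpha[\sigma|\tau||k](\sigma\tau)\rhd h_k$ and $e\rhd h=h$, for $\sigma,\tau\in G$, $h_k\in\mathcal H_k$. Morphisms are linear maps $f:\mathcal H\to\mathcal H'$ with $f(\mathcal H_k)\subset\mathcal H'_k$ and $f(\sigma\rhd h)=\sigma\rhd f(h)$. Tensor product: $\mathcal H\otimes\mathcal H'$ is the tensor product of Hilbert spaces with $(\mathcal H\otimes\mathcal H')_k=\bigoplus_{xy=k}\mathcal H_x\otimes\mathcal H'_y$ and $\sigma\rhd(h_x\otimes h'_y)=\beta[\sigma||x|y](\sigma\rhd h_x\otimes\sigma\rhd h'_y)$. Associativity constraint $\Theta:(\mathcal H\otimes\mathcal H')\otimes\mathcal H''\to\mathcal H\otimes(\mathcal H'\otimes\mathcal H'')$: $\Theta((h_x\otimes h'_y)\otimes h''_z)=\theta[x|y|z]^{-1}h_x\otimes(h'_y\otimes h''_z)$. Unit object $\underline{\mathbb C}$: the one-dimensional Hilbert space $\mathbb C$ concentrated in degree the unit of $K$, with trivial $G$-action. *)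

theory Defs
  imports "HOL-Algebra.Algebra" "HOL-Algebra.Algebraic_Closure_Type" Complex_Main
begin

section \<open>Categories and monoidal categories\<close>

text \<open>
  A category is given by a set of objects and a family of hom-sets, which are pairwise disjoint,
  so that composition needs no object arguments.
\<close>

locale category =
  fixes Ob :: "'o set"
    and Hom :: "'o \<Rightarrow> 'o \<Rightarrow> 'm set"
    and Id :: "'o \<Rightarrow> 'm"
    and Comp :: "'m \<Rightarrow> 'm \<Rightarrow> 'm"  (infixr \<open>\<bullet>\<close> 55)
  assumes hom_disjoint:
      "\<lbrakk>A \<in> Ob; B \<in> Ob; A' \<in> Ob; B' \<in> Ob; f \<in> Hom A B; f \<in> Hom A' B'\<rbrakk> \<Longrightarrow> A = A' \<and> B = B'"
    and id_closed: "A \<in> Ob \<Longrightarrow> Id A \<in> Hom A A"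
    and comp_closed:
      "\<lbrakk>A \<in> Ob; B \<in> Ob; C \<in> Ob; f \<in> Hom A B; g \<in> Hom B C\<rbrakk> \<Longrightarrow> g \<bullet> f \<in> Hom A C"
    and comp_id_right: "\<lbrakk>A \<in> Ob; B \<in> Ob; f \<in> Hom A B\<rbrakk> \<Longrightarrow> f \<bullet> Id A = f"
    and comp_id_left: "\<lbrakk>A \<in> Ob; B \<in> Ob; f \<in> Hom A B\<rbrakk> \<Longrightarrow> Id B \<bullet> f = f"
    and comp_assoc:
      "\<lbrakk>A \<in> Ob; B \<in> Ob; C \<in> Ob; D \<in> Ob; f \<in> Hom A B; g \<in> Hom B C; h \<in> Hom C D\<rbrakk>
        \<Longrightarrow> (h \<bullet> g) \<bullet> f = h \<bullet> (g \<bullet> f)"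
begin

definition Iso :: "'o \<Rightarrow> 'o \<Rightarrow> 'm set" where
  "Iso A B = {f \<in> Hom A B. \<exists>g \<in> Hom B A. g \<bullet> f = Id A \<and> f \<bullet> g = Id B}"

end

locale monoidal_category = category Ob Hom Id Comp
  for Ob :: "'o set"
    and Hom :: "'o \<Rightarrow> 'o \<Rightarrow> 'm set"
    and Id :: "'o \<Rightarrow> 'm"
    and Comp :: "'m \<Rightarrow> 'm \<Rightarrow> 'm"  (infixr \<open>\<bullet>\<close> 55) +
  fixes tensor :: "'o \<Rightarrow> 'o \<Rightarrow> 'o"  (infixr \<open>\<boxtimes>\<close> 70)
    and tensor_arr :: "'m \<Rightarrow> 'm \<Rightarrow> 'm"  (infixr \<open>\<boxtimes>\<^sub>a\<close> 70)
    and unit :: 'o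
    and assoc :: "'o \<Rightarrow> 'o \<Rightarrow> 'o \<Rightarrow> 'm"
    and lunit :: "'o \<Rightarrow> 'm"
    and runit :: "'o \<Rightarrow> 'm"
  assumes tensor_closed: "\<lbrakk>A \<in> Ob; B \<in> Ob\<rbrakk> \<Longrightarrow> A \<boxtimes> B \<in> Ob"
    and tensor_arr_closed:
      "\<lbrakk>A \<in> Ob; A' \<in> Ob; B \<in> Ob; B' \<in> Ob; f \<in> Hom A A'; g \<in> Hom B B'\<rbrakk>
        \<Longrightarrow> f \<boxtimes>\<^sub>a g \<in> Hom (A \<boxtimes> B) (A' \<boxtimes> B')"
    and tensor_id: "\<lbrakk>A \<in> Ob; B \<in> Ob\<rbrakk> \<Longrightarrow> Id A \<boxtimes>\<^sub>a Id B = Id (A \<boxtimes> B)"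
    and tensor_comp:
      "\<lbrakk>A \<in> Ob; A' \<in> Ob; A'' \<in> Ob; B \<in> Ob; B' \<in> Ob; B'' \<in> Ob;
        f \<in> Hom A A'; f' \<in> Hom A' A''; g \<in> Hom B B'; g' \<in> Hom B' B''\<rbrakk>
        \<Longrightarrow> (f' \<bullet> f) \<boxtimes>\<^sub>a (g' \<bullet> g) = (f' \<boxtimes>\<^sub>a g') \<bullet> (f \<boxtimes>\<^sub>a g)"
    and unit_closed: "unit \<in> Ob"
    and assoc_iso:
      "\<lbrakk>A \<in> Ob; B \<in> Ob; C \<in> Ob\<rbrakk> \<Longrightarrow> assoc A B C \<in> Iso ((A \<boxtimes> B) \<boxtimes> C) (A \<boxtimes> (B \<boxtimes> C))"
    and assoc_natural:
      "\<lbrakk>A \<in> Ob; A' \<in> Ob; B \<in> Ob; B' \<in> Ob; C \<in> Ob; C' \<in> Ob;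
        f \<in> Hom A A'; g \<in> Hom B B'; h \<in> Hom C C'\<rbrakk>
        \<Longrightarrow> assoc A' B' C' \<bullet> ((f \<boxtimes>\<^sub>a g) \<boxtimes>\<^sub>a h) = (f \<boxtimes>\<^sub>a (g \<boxtimes>\<^sub>a h)) \<bullet> assoc A B C"
    and lunit_iso: "A \<in> Ob \<Longrightarrow> lunit A \<in> Iso (unit \<boxtimes> A) A"
    and lunit_natural:
      "\<lbrakk>A \<in> Ob; A' \<in> Ob; f \<in> Hom A A'\<rbrakk> \<Longrightarrow> lunit A' \<bullet> (Id unit \<boxtimes>\<^sub>a f) = f \<bullet> lunit A"
    and runit_iso: "A \<in> Ob \<Longrightarrow> runit A \<in> Iso (A \<boxtimes> unit) A"
    and runit_natural:
      "\<lbrakk>A \<in> Ob; A' \<in> Ob; f \<in> Hom A A'\<rbrakk> \<Longrightarrow> runit A' \<bullet> (f \<boxtimes>\<^sub>a Id unit) = f \<bullet> runit A"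
    and pentagon:
      "\<lbrakk>A \<in> Ob; B \<in> Ob; C \<in> Ob; D \<in> Ob\<rbrakk>
        \<Longrightarrow> assoc A B (C \<boxtimes> D) \<bullet> assoc (A \<boxtimes> B) C D
          = (Id A \<boxtimes>\<^sub>a assoc B C D) \<bullet> assoc A (B \<boxtimes> C) D \<bullet> (assoc A B C \<boxtimes>\<^sub>a Id D)"
    and triangle:
      "\<lbrakk>A \<in> Ob; B \<in> Ob\<rbrakk>
        \<Longrightarrow> (Id A \<boxtimes>\<^sub>a lunit B) \<bullet> assoc A unit B = runit A \<boxtimes>\<^sub>a Id B"


section \<open>Pseudomonoids with strict unit in G-sets with twists\<close>

text \<open>The circle group is the set of complex numbers of norm 1.\<close>

record ('g, 'k) twisted_monoid = "'k monoid" +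
  gact :: "'g \<Rightarrow> 'k \<Rightarrow> 'k"
  alpha :: "'g \<Rightarrow> 'g \<Rightarrow> 'k \<Rightarrow> complex"
  beta :: "'g \<Rightarrow> 'k \<Rightarrow> 'k \<Rightarrow> complex"
  theta :: "'k \<Rightarrow> 'k \<Rightarrow> 'k \<Rightarrow> complex"

text \<open>
  In \<open>gact_aut\<close>, elements of \<^const>\<open>iso\<close> are only required to be multiplicative and bijective;
  being surjective, they preserve the unit.
\<close>

locale pseudomonoid =
  G: group G + K: monoid K + gact: group_action G "carrier K" "gact K"
  for G :: "('g, 'b) monoid_scheme" (structure)
    and K :: "('g, 'k, 'c) twisted_monoid_scheme" +
  assumes gact_aut: "\<sigma> \<in> carrier G \<Longrightarrow> gact K \<sigma> \<in> iso K K"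
    and alpha_circle:
      "\<lbrakk>\<sigma> \<in> carrier G; \<tau> \<in> carrier G; x \<in> carrier K\<rbrakk> \<Longrightarrow> norm (alpha K \<sigma> \<tau> x) = 1"
    and beta_circle:
      "\<lbrakk>\<sigma> \<in> carrier G; x \<in> carrier K; y \<in> carrier K\<rbrakk> \<Longrightarrow> norm (beta K \<sigma> x y) = 1"
    and theta_circle:
      "\<lbrakk>x \<in> carrier K; y \<in> carrier K; z \<in> carrier K\<rbrakk> \<Longrightarrow> norm (theta K x y z) = 1"
    and alpha_normalized:
      "\<lbrakk>\<sigma> \<in> carrier G; \<tau> \<in> carrier G; x \<in> carrier K; \<sigma> = \<one> \<or> \<tau> = \<one> \<or> x = \<one>\<^bsub>K\<^esub>\<rbrakk>
        \<Longrightarrow> alpha K \<sigma> \<tau> x = 1"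
    and beta_normalized:
      "\<lbrakk>\<sigma> \<in> carrier G; x \<in> carrier K; y \<in> carrier K; \<sigma> = \<one> \<or> x = \<one>\<^bsub>K\<^esub> \<or> y = \<one>\<^bsub>K\<^esub>\<rbrakk>
        \<Longrightarrow> beta K \<sigma> x y = 1"
    and theta_normalized:
      "\<lbrakk>x \<in> carrier K; y \<in> carrier K; z \<in> carrier K; x = \<one>\<^bsub>K\<^esub> \<or> y = \<one>\<^bsub>K\<^esub> \<or> z = \<one>\<^bsub>K\<^esub>\<rbrakk>
        \<Longrightarrow> theta K x y z = 1"
    and alpha_cocycle:
      "\<lbrakk>\<sigma> \<in> carrier G; \<tau> \<in> carrier G; \<rho> \<in> carrier G; x \<in> carrier K\<rbrakk>
        \<Longrightarrow> alpha K \<tau> \<rho> x * alpha K \<sigma> (\<tau> \<otimes> \<rho>) x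
          = alpha K (\<sigma> \<otimes> \<tau>) \<rho> x * alpha K \<sigma> \<tau> (gact K \<rho> x)"
    and beta_alpha:
      "\<lbrakk>\<sigma> \<in> carrier G; \<tau> \<in> carrier G; x \<in> carrier K; y \<in> carrier K\<rbrakk>
        \<Longrightarrow> beta K \<tau> x y * inverse (beta K (\<sigma> \<otimes> \<tau>) x y) * beta K \<sigma> (gact K \<tau> x) (gact K \<tau> y)
          = alpha K \<sigma> \<tau> (x \<otimes>\<^bsub>K\<^esub> y) * inverse (alpha K \<sigma> \<tau> x) * inverse (alpha K \<sigma> \<tau> y)"
    and theta_beta:
      "\<lbrakk>\<sigma> \<in> carrier G; x \<in> carrier K; y \<in> carrier K; z \<in> carrier K\<rbrakk>
        \<Longrightarrow> theta K x y z * inverse (theta K (gact K \<sigma> x) (gact K \<sigma> y) (gact K \<sigma> z))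
          = beta K \<sigma> y z * inverse (beta K \<sigma> (x \<otimes>\<^bsub>K\<^esub> y) z)
            * beta K \<sigma> x (y \<otimes>\<^bsub>K\<^esub> z) * inverse (beta K \<sigma> x y)"
    and theta_cocycle:
      "\<lbrakk>x \<in> carrier K; y \<in> carrier K; z \<in> carrier K; t \<in> carrier K\<rbrakk>
        \<Longrightarrow> theta K (x \<otimes>\<^bsub>K\<^esub> y) z t * theta K x y (z \<otimes>\<^bsub>K\<^esub> t)
          = theta K x y z * theta K x (y \<otimes>\<^bsub>K\<^esub> z) t * theta K y z t"


section \<open>Finite-dimensional Hilbert spaces\<close>

abbreviation complex_ring :: "complex ring" where
  "complex_ring \<equiv> ring_of_type_algebra"

text \<open>
  The record \<open>module\<close> extends \<open>ring\<close>, but the locale \<^locale>\<open>module\<close> ignores the ring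
  multiplication and unit of the second structure. The inner product is linear in the first
  argument. Completeness is automatic in finite dimension.
\<close>

record 'v hilbert = "(complex, 'v) module" +
  iprod :: "'v \<Rightarrow> 'v \<Rightarrow> complex"

locale fd_hilbert = module complex_ring H
  for H :: "('v, 'm) hilbert_scheme" (structure) +
  assumes inner_add_left:
      "\<lbrakk>x \<in> carrier H; y \<in> carrier H; z \<in> carrier H\<rbrakk>
        \<Longrightarrow> iprod H (x \<oplus> y) z = iprod H x z + iprod H y z"
    and inner_smult_left:
      "\<lbrakk>x \<in> carrier H; y \<in> carrier H\<rbrakk> \<Longrightarrow> iprod H (c \<odot> x) y = c * iprod H x y"
    and inner_cnj: "\<lbrakk>x \<in> carrier H; y \<in> carrier H\<rbrakk> \<Longrightarrow> iprod H y x = cnj (iprod H x y)"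
    and inner_pos: "\<lbrakk>x \<in> carrier H; x \<noteq> \<zero>\<rbrakk> \<Longrightarrow> 0 < Re (iprod H x x)"
    and finite_dim:
      "\<exists>B. finite B \<and> B \<subseteq> carrier H \<and> (\<forall>x \<in> carrier H. \<exists>c. x = (\<Oplus>b \<in> B. c b \<odot> b))"

definition linear_map ::
    "('v, 'm) hilbert_scheme \<Rightarrow> ('w, 'n) hilbert_scheme \<Rightarrow> ('v \<Rightarrow> 'w) \<Rightarrow> bool" where
  "linear_map V W f \<longleftrightarrow>
     f \<in> carrier V \<rightarrow> carrier W \<and>
     (\<forall>x \<in> carrier V. \<forall>y \<in> carrier V. f (x \<oplus>\<^bsub>V\<^esub> y) = f x \<oplus>\<^bsub>W\<^esub> f y) \<and>
     (\<forall>c. \<forall>x \<in> carrier V. f (c \<odot>\<^bsub>V\<^esub> x) = c \<odot>\<^bsub>W\<^esub> f x)"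

text \<open>Extensionality makes linear maps that agree on the carrier equal.\<close>

definition linear_maps ::
    "('v, 'm) hilbert_scheme \<Rightarrow> ('w, 'n) hilbert_scheme \<Rightarrow> ('v \<Rightarrow> 'w) set" where
  "linear_maps V W = {f \<in> extensional (carrier V). linear_map V W f}"

definition unitary_op :: "('v, 'm) hilbert_scheme \<Rightarrow> ('v \<Rightarrow> 'v) \<Rightarrow> bool" where
  "unitary_op H u \<longleftrightarrow>
     linear_map H H u \<and> bij_betw u (carrier H) (carrier H) \<and>
     (\<forall>x \<in> carrier H. \<forall>y \<in> carrier H. iprod H (u x) (u y) = iprod H x y)"


section \<open>Tensor products of Hilbert spaces\<close>

text \<open>
  All vectors live in one universe, closed under formal sums of pairs, so that tensor products
  can be formed without changing the type. \<open>Atom\<close> injects an arbitrary type: every Hilbert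
  space with underlying set in \<^typ>\<open>'a\<close> can be transported to one with vectors \<open>Atom a\<close>.
\<close>

datatype 'a tvec = Atom 'a | Scalar complex | Formal "('a tvec \<times> 'a tvec) list"

text \<open>
  A list \<open>[(x\<^sub>1, y\<^sub>1), \<dots>, (x\<^sub>n, y\<^sub>n)]\<close> stands for the formal sum of the \<open>x\<^sub>i \<otimes> y\<^sub>i\<close>. The relation
  below is the congruence generated by commutativity and bilinearity; its quotient is the
  algebraic tensor product. Scalar coefficients are absorbed in the first component.
\<close>

inductive tensor_eq ::
    "('v, 'm) hilbert_scheme \<Rightarrow> ('w, 'n) hilbert_scheme \<Rightarrow> ('v \<times> 'w) list \<Rightarrow> ('v \<times> 'w) list \<Rightarrow> bool"
  for V :: "('v, 'm) hilbert_scheme" (structure) and W :: "('w, 'n) hilbert_scheme" where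
  refl: "set s \<subseteq> carrier V \<times> carrier W \<Longrightarrow> tensor_eq V W s s"
| sym: "tensor_eq V W s t \<Longrightarrow> tensor_eq V W t s"
| trans: "\<lbrakk>tensor_eq V W s t; tensor_eq V W t u\<rbrakk> \<Longrightarrow> tensor_eq V W s u"
| append: "\<lbrakk>tensor_eq V W s s'; tensor_eq V W t t'\<rbrakk> \<Longrightarrow> tensor_eq V W (s @ t) (s' @ t')"
| commute:
    "\<lbrakk>set s \<subseteq> carrier V \<times> carrier W; set t \<subseteq> carrier V \<times> carrier W\<rbrakk>
      \<Longrightarrow> tensor_eq V W (s @ t) (t @ s)"
| zero: "y \<in> carrier W \<Longrightarrow> tensor_eq V W [(\<zero>\<^bsub>V\<^esub>, y)] []"
| add_left:
    "\<lbrakk>x \<in> carrier V; x' \<in> carrier V; y \<in> carrier W\<rbrakk>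
      \<Longrightarrow> tensor_eq V W [(x \<oplus>\<^bsub>V\<^esub> x', y)] [(x, y), (x', y)]"
| add_right:
    "\<lbrakk>x \<in> carrier V; y \<in> carrier W; y' \<in> carrier W\<rbrakk>
      \<Longrightarrow> tensor_eq V W [(x, y \<oplus>\<^bsub>W\<^esub> y')] [(x, y), (x, y')]"
| smult:
    "\<lbrakk>x \<in> carrier V; y \<in> carrier W\<rbrakk> \<Longrightarrow> tensor_eq V W [(c \<odot>\<^bsub>V\<^esub> x, y)] [(x, c \<odot>\<^bsub>W\<^esub> y)]"

text \<open>
  An equivalence class is encoded by a chosen representative, since the universe contains
  lists but not sets of lists.
\<close>

definition tensor_class ::
    "('a tvec, 'm) hilbert_scheme \<Rightarrow> ('a tvec, 'n) hilbert_scheme \<Rightarrow> ('a tvec \<times> 'a tvec) list \<Rightarrow> 'a tvec"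
  where "tensor_class V W s = Formal (SOME t. tensor_eq V W s t)"

definition pure_tensor ::
    "('a tvec, 'm) hilbert_scheme \<Rightarrow> ('a tvec, 'n) hilbert_scheme \<Rightarrow> 'a tvec \<Rightarrow> 'a tvec \<Rightarrow> 'a tvec"
  where "pure_tensor V W x y = tensor_class V W [(x, y)]"

fun summands :: "'a tvec \<Rightarrow> ('a tvec \<times> 'a tvec) list" where
  "summands (Formal s) = s"
| "summands _ = []"

definition tensor_space ::
    "('a tvec, 'm) hilbert_scheme \<Rightarrow> ('a tvec, 'n) hilbert_scheme \<Rightarrow> 'a tvec hilbert" where
  "tensor_space V W =
     \<lparr>carrier = {tensor_class V W s |s. set s \<subseteq> carrier V \<times> carrier W},
      monoid.mult = (\<lambda>_ _. undefined), one = undefined,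
      ring.zero = tensor_class V W [],
      add = (\<lambda>p q. tensor_class V W (summands p @ summands q)),
      module.smult = (\<lambda>c p. tensor_class V W (map (\<lambda>(x, y). (c \<odot>\<^bsub>V\<^esub> x, y)) (summands p))),
      iprod = (\<lambda>p q. \<Sum>(x, y) \<leftarrow> summands p. \<Sum>(x', y') \<leftarrow> summands q.
                       iprod V x x' * iprod W y y')\<rparr>"


section \<open>The category of twisted equivariant graded Hilbert spaces\<close>

record ('g, 'k, 'v) bun = "'v hilbert" +
  homog :: "'k \<Rightarrow> 'v set"
  act :: "'g \<Rightarrow> 'v \<Rightarrow> 'v"

text \<open>
  By \<open>homog_orthogonal\<close> and \<open>homog_sum\<close> the space is the Hilbert direct sum of the \<open>homog H k\<close>;
  in finite dimension no infinite sums are needed. Values of \<^const>\<open>homog\<close> and \<^const>\<open>act\<close>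
  outside \<open>K\<close> and \<open>G\<close> are irrelevant.
\<close>

locale equivariant_bundle = fd_hilbert H
  for G :: "('g, 'b) monoid_scheme"
    and K :: "('g, 'k, 'c) twisted_monoid_scheme"
    and H :: "('g, 'k, 'v) bun" (structure) +
  assumes homog_submodule: "k \<in> carrier K \<Longrightarrow> submodule (homog H k) complex_ring H"
    and homog_orthogonal:
      "\<lbrakk>k \<in> carrier K; l \<in> carrier K; k \<noteq> l; x \<in> homog H k; y \<in> homog H l\<rbrakk> \<Longrightarrow> iprod H x y = 0"
    and homog_sum:
      "x \<in> carrier H \<Longrightarrow>
        \<exists>F h. finite F \<and> F \<subseteq> carrier K \<and> (\<forall>k \<in> F. h k \<in> homog H k) \<and> x = (\<Oplus>k \<in> F. h k)"
    and act_unitary: "\<And>\<sigma>. \<sigma> \<in> carrier G \<Longrightarrow> unitary_op H (act H \<sigma>)"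
    and act_homog:
      "\<And>\<sigma> k. \<lbrakk>\<sigma> \<in> carrier G; k \<in> carrier K\<rbrakk> \<Longrightarrow> act H \<sigma> ` homog H k = homog H (gact K \<sigma> k)"
    and act_twisted:
      "\<And>\<sigma> \<tau> k h. \<lbrakk>\<sigma> \<in> carrier G; \<tau> \<in> carrier G; k \<in> carrier K; h \<in> homog H k\<rbrakk>
        \<Longrightarrow> act H \<sigma> (act H \<tau> h) = alpha K \<sigma> \<tau> k \<odot> act H (\<sigma> \<otimes>\<^bsub>G\<^esub> \<tau>) h"
    and act_one: "h \<in> carrier H \<Longrightarrow> act H \<one>\<^bsub>G\<^esub> h = h"

definition bun_ob ::
    "('g, 'b) monoid_scheme \<Rightarrow> ('g, 'k, 'c) twisted_monoid_scheme \<Rightarrow> ('g, 'k, 'a tvec) bun set" where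
  "bun_ob G K = {H. equivariant_bundle G K H}"

text \<open>An arrow is a map together with its source and target.\<close>

type_synonym ('g, 'k, 'v) arrow =
  "('g, 'k, 'v) bun \<times> ('v \<Rightarrow> 'v) \<times> ('g, 'k, 'v) bun"

definition bun_hom ::
    "('g, 'b) monoid_scheme \<Rightarrow> ('g, 'k, 'c) twisted_monoid_scheme \<Rightarrow>
     ('g, 'k, 'a tvec) bun \<Rightarrow> ('g, 'k, 'a tvec) bun \<Rightarrow> ('g, 'k, 'a tvec) arrow set" where
  "bun_hom G K H H' =
     {(H, f, H') |f. f \<in> linear_maps H H' \<and>
        (\<forall>k \<in> carrier K. f ` homog H k \<subseteq> homog H' k) \<and>
        (\<forall>\<sigma> \<in> carrier G. \<forall>h \<in> carrier H. f (act H \<sigma> h) = act H' \<sigma> (f h))}"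

definition bun_id :: "('g, 'k, 'a tvec) bun \<Rightarrow> ('g, 'k, 'a tvec) arrow" where
  "bun_id H = (H, \<lambda>h \<in> carrier H. h, H)"

fun bun_comp ::
    "('g, 'k, 'a tvec) arrow \<Rightarrow> ('g, 'k, 'a tvec) arrow \<Rightarrow> ('g, 'k, 'a tvec) arrow" where
  "bun_comp (_, g, C) (A, f, _) = (A, compose (carrier A) g f, C)"

text \<open>
  Linear maps on tensor products are specified, as usual, by their values on (homogeneous)
  pure tensors; these values determine them, hence the definite descriptions below.
\<close>

definition tensor_homog ::
    "('g, 'k, 'c) twisted_monoid_scheme \<Rightarrow>
     ('g, 'k, 'a tvec) bun \<Rightarrow> ('g, 'k, 'a tvec) bun \<Rightarrow> 'k \<Rightarrow> 'a tvec set" where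
  "tensor_homog K H H' k =
     {tensor_class H H' s |s. \<forall>(h, h') \<in> set s. \<exists>x \<in> carrier K. \<exists>y \<in> carrier K.
        x \<otimes>\<^bsub>K\<^esub> y = k \<and> h \<in> homog H x \<and> h' \<in> homog H' y}"

definition tensor_act ::
    "('g, 'k, 'c) twisted_monoid_scheme \<Rightarrow>
     ('g, 'k, 'a tvec) bun \<Rightarrow> ('g, 'k, 'a tvec) bun \<Rightarrow> 'g \<Rightarrow> 'a tvec \<Rightarrow> 'a tvec" where
  "tensor_act K H H' \<sigma> =
     (THE f. f \<in> linear_maps (tensor_space H H') (tensor_space H H') \<and>
        (\<forall>x \<in> carrier K. \<forall>y \<in> carrier K. \<forall>h \<in> homog H x. \<forall>h' \<in> homog H' y.
           f (pure_tensor H H' h h')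
             = beta K \<sigma> x y \<odot>\<^bsub>tensor_space H H'\<^esub> pure_tensor H H' (act H \<sigma> h) (act H' \<sigma> h')))"

definition bun_tensor ::
    "('g, 'k, 'c) twisted_monoid_scheme \<Rightarrow>
     ('g, 'k, 'a tvec) bun \<Rightarrow> ('g, 'k, 'a tvec) bun \<Rightarrow> ('g, 'k, 'a tvec) bun" where
  "bun_tensor K H H' =
     hilbert.extend (tensor_space H H')
       (bun.fields (tensor_homog K H H') (tensor_act K H H'))"

fun bun_tensor_arr ::
    "('g, 'k, 'c) twisted_monoid_scheme \<Rightarrow>
     ('g, 'k, 'a tvec) arrow \<Rightarrow> ('g, 'k, 'a tvec) arrow \<Rightarrow> ('g, 'k, 'a tvec) arrow" where
  "bun_tensor_arr K (A, f, B) (A', f', B') =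
     (bun_tensor K A A',
      THE g. g \<in> linear_maps (bun_tensor K A A') (bun_tensor K B B') \<and>
        (\<forall>h \<in> carrier A. \<forall>h' \<in> carrier A'.
           g (pure_tensor A A' h h') = pure_tensor B B' (f h) (f' h')),
      bun_tensor K B B')"

definition bun_unit :: "('g, 'k, 'c) twisted_monoid_scheme \<Rightarrow> ('g, 'k, 'a tvec) bun" where
  "bun_unit K =
     \<lparr>carrier = range Scalar,
      monoid.mult = (\<lambda>_ _. undefined), one = undefined,
      ring.zero = Scalar 0,
      add = (\<lambda>v w. case (v, w) of (Scalar a, Scalar b) \<Rightarrow> Scalar (a + b)),
      module.smult = (\<lambda>c v. case v of Scalar a \<Rightarrow> Scalar (c * a)),
      iprod = (\<lambda>v w. case (v, w) of (Scalar a, Scalar b) \<Rightarrow> a * cnj b),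
      homog = (\<lambda>k. if k = \<one>\<^bsub>K\<^esub> then range Scalar else {Scalar 0}),
      act = (\<lambda>\<sigma> v. v)\<rparr>"

definition bun_assoc ::
    "('g, 'k, 'c) twisted_monoid_scheme \<Rightarrow>
     ('g, 'k, 'a tvec) bun \<Rightarrow> ('g, 'k, 'a tvec) bun \<Rightarrow> ('g, 'k, 'a tvec) bun \<Rightarrow>
     ('g, 'k, 'a tvec) arrow" where
  "bun_assoc K H H' H'' =
     (let L = bun_tensor K (bun_tensor K H H') H'';
          R = bun_tensor K H (bun_tensor K H' H'')
      in (L,
          THE f. f \<in> linear_maps L R \<and>
            (\<forall>x \<in> carrier K. \<forall>y \<in> carrier K. \<forall>z \<in> carrier K.
             \<forall>h \<in> homog H x. \<forall>h' \<in> homog H' y. \<forall>h'' \<in> homog H'' z.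
               f (pure_tensor (bun_tensor K H H') H'' (pure_tensor H H' h h') h'')
                 = inverse (theta K x y z)
                   \<odot>\<^bsub>R\<^esub> pure_tensor H (bun_tensor K H' H'') h (pure_tensor H' H'' h' h'')),
          R))"

text \<open>The unit constraints are the canonical ones, scalar multiplication.\<close>

definition bun_lunit ::
    "('g, 'k, 'c) twisted_monoid_scheme \<Rightarrow> ('g, 'k, 'a tvec) bun \<Rightarrow> ('g, 'k, 'a tvec) arrow" where
  "bun_lunit K H =
     (bun_tensor K (bun_unit K) H,
      THE f. f \<in> linear_maps (bun_tensor K (bun_unit K) H) H \<and>
        (\<forall>c. \<forall>h \<in> carrier H. f (pure_tensor (bun_unit K) H (Scalar c) h) = c \<odot>\<^bsub>H\<^esub> h),
      H)"

definition bun_runit ::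
    "('g, 'k, 'c) twisted_monoid_scheme \<Rightarrow> ('g, 'k, 'a tvec) bun \<Rightarrow> ('g, 'k, 'a tvec) arrow" where
  "bun_runit K H =
     (bun_tensor K H (bun_unit K),
      THE f. f \<in> linear_maps (bun_tensor K H (bun_unit K)) H \<and>
        (\<forall>c. \<forall>h \<in> carrier H. f (pure_tensor H (bun_unit K) h (Scalar c)) = c \<odot>\<^bsub>H\<^esub> h),
      H)"

end

(* The inner product on the algebraic tensor product is definite because the products of two
   orthonormal bases form an orthonormal basis. Gram-Schmidt applied degree by degree provides
   homogeneous orthonormal bases, so the twisted action on a tensor product and the associator in
   both directions can be defined on basis vectors, where the scalars beta and theta depend only on
   the degrees; multilinearity extends the defining formulas to all homogeneous pure tensors. These
   span, hence every axiom is checked on them, where it reduces to one of the conditions on alpha,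
   beta and theta: beta_alpha gives the twisted action law, theta_beta the equivariance of the
   associator, theta_cocycle the pentagon, and the normalizations the unit constraints. *)

theory Submission
  imports Defs
begin

section \<open>Inner product modules\<close>

text \<open>The structure maps are definite descriptions, so each needs existence and uniqueness
  before anything can be said about it. Uniqueness is the easy half, by spanning. Existence is the
  obstacle: multiplying homogeneous pure tensors by a scalar that depends on their degrees is not
  the restriction of an evident bilinear formula, so it does not come straight from a universal
  property. Orthonormal bases are preferred to bare linear bases for two reasons. Coordinates are
  inner products, hence linear from the outset. And in a quotient by a generated congruence it is
  hard to see directly that two vectors differ, whereas the form separates products of basis vectors
  at once, so that a function may be prescribed on them. The bases leave no trace in the results: a
  map is known afterwards only through its formula on homogeneous pure tensors. Later arguments work
  with arbitrary generating families of the components, which lets nested tensor products be treated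
  like simple ones.\<close>

lemma complex_ring_simps [simp]:
  "carrier complex_ring = UNIV" "\<zero>\<^bsub>complex_ring\<^esub> = 0" "\<one>\<^bsub>complex_ring\<^esub> = 1"
  "a \<oplus>\<^bsub>complex_ring\<^esub> b = a + b" "a \<otimes>\<^bsub>complex_ring\<^esub> b = a * b"
  by (simp_all add: ring_of_type_algebra_def)

text \<open>Adding one scalar multiple at a time gives an induction whose step uses only additivity
  and homogeneity. Extending a fact from generators to a span is then a two-case argument, with no
  finite sums to reindex.\<close>

inductive_set lspan :: "('v, 'm) hilbert_scheme \<Rightarrow> 'v set \<Rightarrow> 'v set"
  for V :: "('v, 'm) hilbert_scheme" (structure) and S :: "'v set" where
  zero: "\<zero> \<in> lspan V S"
| add_smult: "\<lbrakk>x \<in> lspan V S; s \<in> S\<rbrakk> \<Longrightarrow> x \<oplus> c \<odot> s \<in> lspan V S"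

lemma lspan_mono: "S \<subseteq> T \<Longrightarrow> lspan V S \<subseteq> lspan V T"
proof
  fix x assume "S \<subseteq> T" "x \<in> lspan V S"
  from this(2,1) show "x \<in> lspan V T"
    by (induction rule: lspan.induct) (auto intro: lspan.intros)
qed

lemma lspan_empty: "lspan V {} = {\<zero>\<^bsub>V\<^esub>}"
  by (auto intro: lspan.zero elim: lspan.cases)

text \<open>Finiteness is built in, so that an \<open>onb\<close> by itself certifies finite
  dimension.\<close>

definition orthonormal :: "('v, 'm) hilbert_scheme \<Rightarrow> 'v set \<Rightarrow> bool" where
  "orthonormal H B \<longleftrightarrow> finite B \<and> B \<subseteq> carrier H \<and>
     (\<forall>b\<in>B. \<forall>b'\<in>B. iprod H b b' = (if b = b' then 1 else 0))"

definition onb :: "('v, 'm) hilbert_scheme \<Rightarrow> 'v set \<Rightarrow> bool" where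
  "onb H B \<longleftrightarrow> orthonormal H B \<and> lspan H B = carrier H"

text \<open>The linear algebra available before definiteness and finite dimension are known. A
  tensor product enters this locale from its formulas alone; the two remaining axioms of
  \<open>fd_hilbert\<close> come from a basis.\<close>

locale pre_hilbert = module complex_ring H
  for H :: "('v, 'm) hilbert_scheme" (structure) +
  assumes inner_add_left:
      "\<lbrakk>x \<in> carrier H; y \<in> carrier H; z \<in> carrier H\<rbrakk>
        \<Longrightarrow> iprod H (x \<oplus> y) z = iprod H x z + iprod H y z"
    and inner_smult_left:
      "\<lbrakk>x \<in> carrier H; y \<in> carrier H\<rbrakk> \<Longrightarrow> iprod H (c \<odot> x) y = c * iprod H x y"
    and inner_cnj: "\<lbrakk>x \<in> carrier H; y \<in> carrier H\<rbrakk> \<Longrightarrow> iprod H y x = cnj (iprod H x y)"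
begin

lemma smult_in_carrier [simp, intro]: "x \<in> carrier H \<Longrightarrow> c \<odot> x \<in> carrier H"
  by simp

lemma smult_add_left: "x \<in> carrier H \<Longrightarrow> (a + b) \<odot> x = a \<odot> x \<oplus> b \<odot> x"
  using smult_l_distr[of a b x] by simp

lemma smult_add_right:
  "\<lbrakk>x \<in> carrier H; y \<in> carrier H\<rbrakk> \<Longrightarrow> a \<odot> (x \<oplus> y) = a \<odot> x \<oplus> a \<odot> y"
  using smult_r_distr[of a x y] by simp

lemma smult_smult: "x \<in> carrier H \<Longrightarrow> a \<odot> (b \<odot> x) = (a * b) \<odot> x"
  using smult_assoc1[of a b x] by simp

lemma smult_1 [simp]: "x \<in> carrier H \<Longrightarrow> 1 \<odot> x = x"
  using smult_one[of x] by simp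

lemma smult_0 [simp]: "x \<in> carrier H \<Longrightarrow> 0 \<odot> x = \<zero>"
  using smult_l_null[of x] by simp

lemma smult_zero [simp]: "c \<odot> \<zero> = \<zero>"
  using smult_r_null[of c] by simp

lemma add_neg_smult [simp]: "x \<in> carrier H \<Longrightarrow> x \<oplus> (-1) \<odot> x = \<zero>"
  using smult_add_left[of x 1 "-1"] by simp

lemma a_inv_eq: "x \<in> carrier H \<Longrightarrow> \<ominus> x = (-1) \<odot> x"
  by (rule M.minus_equality) (simp_all add: M.a_comm)

lemma inner_add_right:
  "\<lbrakk>x \<in> carrier H; y \<in> carrier H; z \<in> carrier H\<rbrakk>
    \<Longrightarrow> iprod H z (x \<oplus> y) = iprod H z x + iprod H z y"
  using inner_add_left[of x y z] inner_cnj[of "x \<oplus> y" z] inner_cnj[of x z] inner_cnj[of y z]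
  by simp

lemma inner_smult_right:
  "\<lbrakk>x \<in> carrier H; y \<in> carrier H\<rbrakk> \<Longrightarrow> iprod H y (c \<odot> x) = cnj c * iprod H y x"
  using inner_smult_left[of x y c] inner_cnj[of "c \<odot> x" y] inner_cnj[of x y] by simp

lemma inner_zero_left [simp]: "x \<in> carrier H \<Longrightarrow> iprod H \<zero> x = 0"
  using inner_smult_left[of \<zero> x 0] by simp

lemma inner_zero_right [simp]: "x \<in> carrier H \<Longrightarrow> iprod H x \<zero> = 0"
  using inner_smult_right[of \<zero> x 0] by simp

lemma inner_finsum_left:
  assumes "finite A" "f \<in> A \<rightarrow> carrier H" "z \<in> carrier H"
  shows "iprod H (\<Oplus>a\<in>A. f a) z = (\<Sum>a\<in>A. iprod H (f a) z)"
  using assms by (induction A) (auto simp: Pi_iff inner_add_left)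

lemma smult_finsum:
  assumes "finite A" "f \<in> A \<rightarrow> carrier H"
  shows "c \<odot> (\<Oplus>a\<in>A. f a) = (\<Oplus>a\<in>A. c \<odot> f a)"
  using finsum_smult_ldistr[of A c f] assms by simp

section \<open>Spans, orthogonality and orthonormal expansions\<close>

lemma lspan_carrier: "S \<subseteq> carrier H \<Longrightarrow> lspan H S \<subseteq> carrier H"
proof
  fix x assume "S \<subseteq> carrier H" "x \<in> lspan H S"
  from this(2,1) show "x \<in> carrier H"
    by (induction rule: lspan.induct) auto
qed

lemma lspan_smult: 
  assumes "S \<subseteq> carrier H" "x \<in> lspan H S"
  shows "c \<odot> x \<in> lspan H S"
  using assms(2)
proof (induction rule: lspan.induct)
  case zero
  then show ?case by (simp add: lspan.zero)
next
  case (add_smult x s d)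
  then show ?case
    using lspan.add_smult[of "c \<odot> x" H S s "c * d"] assms lspan_carrier[of S]
    by (simp add: smult_add_right smult_smult subset_iff)
qed

lemma lspan_add:
  assumes "S \<subseteq> carrier H" "x \<in> lspan H S" "y \<in> lspan H S"
  shows "x \<oplus> y \<in> lspan H S"
  using assms(3)
proof (induction rule: lspan.induct)
  case zero
  then show ?case using assms lspan_carrier[of S] by auto
next
  case (add_smult y s c)
  then show ?case
    using lspan.add_smult[of "x \<oplus> y" H S s c] assms lspan_carrier[of S]
    by (simp add: subset_iff M.a_assoc)
qed

lemma lspan_base:
  assumes "S \<subseteq> carrier H" "s \<in> S"
  shows "s \<in> lspan H S"
  using lspan.add_smult[OF lspan.zero assms(2), of H 1] assms by auto

lemma lspan_subset:
  assumes "T \<subseteq> carrier H" "S \<subseteq> lspan H T"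
  shows "lspan H S \<subseteq> lspan H T"
proof
  fix x assume "x \<in> lspan H S"
  then show "x \<in> lspan H T"
    by (induction rule: lspan.induct)
       (use assms in \<open>auto intro: lspan.zero lspan_add lspan_smult\<close>)
qed

lemma lspan_finsum:
  assumes "S \<subseteq> carrier H" "finite A" "f \<in> A \<rightarrow> lspan H S"
  shows "(\<Oplus>a\<in>A. f a) \<in> lspan H S"
  using assms(2,3)
proof (induction A)
  case empty
  then show ?case by (simp add: lspan.zero)
next
  case (insert a A)
  then have "f a \<in> carrier H" "f \<in> A \<rightarrow> carrier H"
    using lspan_carrier[OF assms(1)] by (auto simp: Pi_iff)
  with insert show ?case by (auto intro!: lspan_add assms(1))
qed

lemma submodule_lspan:
  assumes "S \<subseteq> carrier H"
  shows "submodule (lspan H S) complex_ring H"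
proof (rule submoduleI)
  show "\<ominus> x \<in> lspan H S" if "x \<in> lspan H S" for x
    using that assms lspan_carrier[of S] lspan_smult[of S x "-1"] by (simp add: a_inv_eq subset_iff)
qed (use assms lspan_carrier in \<open>auto intro: lspan.zero lspan_add lspan_smult\<close>)

text \<open>Makes the span lemmas applicable to homogeneous components, which are given as
  submodules and not as spans.\<close>

lemma lspan_submodule:
  assumes "submodule P complex_ring H"
  shows "lspan H P = P"
proof
  show "lspan H P \<subseteq> P"
  proof
    fix x assume "x \<in> lspan H P"
    then show "x \<in> P"
    proof (induction rule: lspan.induct)
      case zero
      show ?case
        using subgroup.one_closed[OF submodule.axioms(1)[OF assms]] by simp
    qed (use submoduleE[OF assms] in auto)
  qed
  show "P \<subseteq> lspan H P"
    using submoduleE(1)[OF assms] by (auto intro: lspan_base)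
qed

text \<open>Two nested inductions, one per argument. Orthogonality of different degrees in a tensor
  product is obtained from this by testing generators.\<close>

lemma inner_lspan_zero:
  assumes "S \<subseteq> carrier H" "S' \<subseteq> carrier H"
    and "\<And>s s'. \<lbrakk>s \<in> S; s' \<in> S'\<rbrakk> \<Longrightarrow> iprod H s s' = 0"
    and "x \<in> lspan H S" "y \<in> lspan H S'"
  shows "iprod H x y = 0"
  using assms(4)
proof (induction rule: lspan.induct)
  case zero
  then show ?case using assms(5) lspan_carrier[OF assms(2)] by auto
next
  case (add_smult x s c)
  have s: "s \<in> carrier H" using add_smult assms by auto
  have "iprod H s y = 0" using assms(5)
  proof (induction rule: lspan.induct)
    case (add_smult y s' d)
    then show ?case
      using s assms(2) assms(3)[of s s'] \<open>s \<in> S\<close> lspan_carrier[OF assms(2)]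
      by (auto simp: inner_add_right inner_smult_right subset_iff)
  qed (use s in simp)
  then show ?case
    using add_smult s assms(5) lspan_carrier[OF assms(1)] lspan_carrier[OF assms(2)]
    by (auto simp: inner_add_left inner_smult_left subset_iff)
qed

text \<open>Each new multiple is merged into the term of its index, so that one term per index
  remains: the shape demanded by \<open>homog_sum\<close>.\<close>

lemma lspan_UN_submodules:
  assumes "\<And>k. k \<in> I \<Longrightarrow> submodule (N k) complex_ring H" "x \<in> lspan H (\<Union>k\<in>I. N k)"
  shows "\<exists>F h. finite F \<and> F \<subseteq> I \<and> (\<forall>k\<in>F. h k \<in> N k) \<and> x = (\<Oplus>k\<in>F. h k)"
  using assms(2)
proof (induction rule: lspan.induct)
  case zero
  show ?case by (intro exI[of _ "{}"]) simp
next
  case (add_smult x s c)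
  then obtain F h k where F: "finite F" "F \<subseteq> I" "\<forall>k\<in>F. h k \<in> N k" "x = (\<Oplus>k\<in>F. h k)"
    and k: "k \<in> I" "s \<in> N k" by blast
  note N = submoduleE[OF assms(1)]
  have zero_N: "\<zero> \<in> N j" if "j \<in> I" for j
    using subgroup.one_closed[OF submodule.axioms(1)[OF assms(1)[OF that]]] by simp
  have cs: "c \<odot> s \<in> N k" using N(4)[OF k(1)] k(2) by simp
  \<comment> \<open>Extension by zero makes the family total, so that an index \<open>k\<close>
    already in \<open>F\<close> and a new one are treated alike.\<close>
  define h0 where "h0 j = (if j \<in> F then h j else \<zero>)" for j
  have h0: "h0 j \<in> N j" if "j \<in> I" for j
    using that F zero_N by (auto simp: h0_def)
  have h0c: "h0 \<in> A \<rightarrow> carrier H" for A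
    using F(2,3) N(1) by (fastforce simp: h0_def)
  have "(\<Oplus>j\<in>insert k F. h0 j) = (\<Oplus>j\<in>F. h0 j)"
  proof (cases "k \<in> F")
    case False
    have "(\<Oplus>j\<in>insert k F. h0 j) = h0 k \<oplus> (\<Oplus>j\<in>F. h0 j)"
      using F False h0c[of F] h0c[of "{k}"] by (intro finsum_insert) auto
    then show ?thesis using False h0c[of F] by (simp add: h0_def[of k])
  qed (simp add: insert_absorb)
  also have "\<dots> = x"
    unfolding F(4) by (rule finsum_cong') (use h0c[of F] in \<open>auto simp: h0_def Pi_iff\<close>)
  finally have x: "(\<Oplus>j\<in>insert k F. h0 j) = x" .
  \<comment> \<open>Only the term at \<open>k\<close> changes, and it stays in \<open>N k\<close>
    because submodules are closed under addition.\<close>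
  define g where "g j = h0 j \<oplus> (if k = j then c \<odot> s else \<zero>)" for j
  have csc: "c \<odot> s \<in> carrier H" using cs N(1) k by blast
  have "(\<Oplus>j\<in>insert k F. g j) = (\<Oplus>j\<in>insert k F. h0 j) \<oplus> (\<Oplus>j\<in>insert k F. if k = j then c \<odot> s else \<zero>)"
    unfolding g_def using h0c csc by (intro finsum_addf) auto
  also have "(\<Oplus>j\<in>insert k F. if k = j then c \<odot> s else \<zero>) = c \<odot> s"
    using F csc by (intro finsum_singleton) auto
  finally have "x \<oplus> c \<odot> s = (\<Oplus>j\<in>insert k F. g j)" by (simp add: x)
  moreover have "\<forall>j\<in>insert k F. g j \<in> N j"
    using F(2) k(1) cs h0 zero_N N(5) by (auto simp: g_def)
  ultimately show ?case
    using F k by (intro exI[of _ "insert k F"] exI[of _ g]) auto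
qed

text \<open>Induction on the span: adding \<open>c \<odot> s\<close> changes the coefficient at
  \<open>s\<close> alone, since the other basis vectors are orthogonal to \<open>s\<close>.\<close>

lemma orthonormal_expansion:
  assumes "orthonormal H B" "x \<in> lspan H B"
  shows "x = (\<Oplus>b\<in>B. iprod H x b \<odot> b)"
proof -
  have B: "finite B" "B \<subseteq> carrier H"
    and ip: "\<And>b b'. \<lbrakk>b \<in> B; b' \<in> B\<rbrakk> \<Longrightarrow> iprod H b b' = (if b = b' then 1 else 0)"
    using assms(1) by (auto simp: orthonormal_def)
  from assms(2) show ?thesis
  proof (induction rule: lspan.induct)
    case zero
    have "(\<Oplus>b\<in>B. iprod H \<zero> b \<odot> b) = (\<Oplus>b\<in>B. \<zero>)"
      by (rule finsum_cong) (use B in \<open>auto simp: simp_implies_def\<close>)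
    then show ?case by simp
  next
    case (add_smult x s c)
    have x: "x \<in> carrier H" and s: "s \<in> carrier H"
      using add_smult B lspan_carrier by auto
    have "(\<Oplus>b\<in>B. iprod H (x \<oplus> c \<odot> s) b \<odot> b)
        = (\<Oplus>b\<in>B. iprod H x b \<odot> b \<oplus> (if s = b then c \<odot> b else \<zero>))"
      using B x s add_smult(2)
      by (intro finsum_cong)
         (auto simp: simp_implies_def inner_add_left inner_smult_left smult_add_left ip subset_iff)
    also have "\<dots> = (\<Oplus>b\<in>B. iprod H x b \<odot> b) \<oplus> (\<Oplus>b\<in>B. if s = b then c \<odot> b else \<zero>)"
      using B by (intro finsum_addf) auto
    also have "(\<Oplus>b\<in>B. if s = b then c \<odot> b else \<zero>) = c \<odot> s"
      using B add_smult(2) by (intro finsum_singleton) auto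
    finally show ?case using add_smult.IH by simp
  qed
qed

lemma onb_expansion:
  "\<lbrakk>onb H B; x \<in> carrier H\<rbrakk> \<Longrightarrow> x = (\<Oplus>b\<in>B. iprod H x b \<odot> b)"
  by (rule orthonormal_expansion) (auto simp: onb_def)

text \<open>Parseval: the real part of \<open>iprod H x x\<close> is the sum of the squared norms of
  the coefficients of \<open>x\<close>, and a vector whose coefficients all vanish is zero by its
  expansion.\<close>

lemma onb_fd_hilbert:
  assumes "onb H B"
  shows "fd_hilbert H"
proof
  fix x assume x: "x \<in> carrier H" "x \<noteq> \<zero>"
  have B: "finite B" "B \<subseteq> carrier H"
    using assms by (auto simp: onb_def orthonormal_def)
  have "iprod H x x = iprod H (\<Oplus>b\<in>B. iprod H x b \<odot> b) x"
    using onb_expansion[OF assms x(1)] by simp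
  also have "\<dots> = (\<Sum>b\<in>B. iprod H x b * iprod H b x)"
    using B x by (subst inner_finsum_left) (auto simp: inner_smult_left subset_iff intro!: sum.cong)
  also have "\<dots> = (\<Sum>b\<in>B. complex_of_real ((norm (iprod H x b))\<^sup>2))"
    using B x by (intro sum.cong) (auto simp: complex_norm_square inner_cnj[of x] subset_iff simp del: of_real_power)
  finally have Re: "Re (iprod H x x) = (\<Sum>b\<in>B. (norm (iprod H x b))\<^sup>2)"
    by simp
  have "\<exists>b\<in>B. iprod H x b \<noteq> 0"
  proof (rule ccontr)
    assume "\<not> ?thesis"
    then have "(\<Oplus>b\<in>B. iprod H x b \<odot> b) = (\<Oplus>b\<in>B. \<zero>)"
      by (intro finsum_cong) (use B in \<open>auto simp: simp_implies_def\<close>)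
    then show False using onb_expansion[OF assms x(1)] x(2) by simp
  qed
  then show "0 < Re (iprod H x x)"
    unfolding Re using B by (auto intro!: sum_pos2)
next
  show "\<exists>B. finite B \<and> B \<subseteq> carrier H \<and> (\<forall>x \<in> carrier H. \<exists>c. x = (\<Oplus>b \<in> B. c b \<odot> b))"
    using assms onb_expansion[OF assms]
    by (intro exI[of _ B]) (auto simp: onb_def orthonormal_def)
qed (rule inner_add_left inner_smult_left inner_cnj; assumption)+

end

lemma (in fd_hilbert) pre_hilbert: "pre_hilbert H"
  by unfold_locales (rule inner_add_left inner_smult_left inner_cnj; assumption)+

section \<open>Linear maps\<close>

lemma linear_mapD:
  assumes "linear_map V W f"
  shows "x \<in> carrier V \<Longrightarrow> f x \<in> carrier W"
    and "\<lbrakk>x \<in> carrier V; y \<in> carrier V\<rbrakk> \<Longrightarrow> f (x \<oplus>\<^bsub>V\<^esub> y) = f x \<oplus>\<^bsub>W\<^esub> f y"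
    and "x \<in> carrier V \<Longrightarrow> f (c \<odot>\<^bsub>V\<^esub> x) = c \<odot>\<^bsub>W\<^esub> f x"
  using assms by (auto simp: linear_map_def)

lemma linear_map_zero:
  assumes "pre_hilbert V" "pre_hilbert W" "linear_map V W f"
  shows "f \<zero>\<^bsub>V\<^esub> = \<zero>\<^bsub>W\<^esub>"
proof -
  interpret V: pre_hilbert V by fact
  interpret W: pre_hilbert W by fact
  show ?thesis
    using linear_mapD(3)[OF assms(3), of "\<zero>\<^bsub>V\<^esub>" 0] linear_mapD(1)[OF assms(3), of "\<zero>\<^bsub>V\<^esub>"]
    by simp
qed

lemma linear_map_comp:
  "\<lbrakk>linear_map V W f; linear_map W U g\<rbrakk> \<Longrightarrow> linear_map V U (\<lambda>x. g (f x))"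
  by (auto simp: linear_map_def Pi_iff)

lemma linear_map_smult:
  assumes "pre_hilbert W" "linear_map V W f"
  shows "linear_map V W (\<lambda>x. c \<odot>\<^bsub>W\<^esub> f x)"
proof -
  interpret W: pre_hilbert W by fact
  show ?thesis
    using assms(2) by (auto simp: linear_map_def Pi_iff W.smult_add_right W.smult_smult mult_ac)
qed

lemma linear_map_lspan:
  assumes "pre_hilbert V" "pre_hilbert W" "linear_map V W f" "S \<subseteq> carrier V" "T \<subseteq> carrier W"
    and "\<And>s. s \<in> S \<Longrightarrow> f s \<in> lspan W T" "x \<in> lspan V S"
  shows "f x \<in> lspan W T"
proof -
  interpret V: pre_hilbert V by fact
  interpret W: pre_hilbert W by fact
  note f = linear_mapD[OF assms(3)]
  from assms(7) show ?thesis
  proof (induction rule: lspan.induct)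
    case zero
    then show ?case using linear_map_zero[OF assms(1-3)] by (simp add: lspan.zero)
  next
    case (add_smult x s c)
    then show ?case
      using V.lspan_carrier[OF assms(4)] assms(4,5,6)
      by (auto simp: f subset_iff intro!: W.lspan_add W.lspan_smult)
  qed
qed

text \<open>Serves the surjectivity of the action on a tensor product, where the image of a
  component is computed from the images of its generators.\<close>

lemma linear_map_image_lspan:
  assumes "pre_hilbert V" "pre_hilbert W" "linear_map V W f" "S \<subseteq> carrier V"
  shows "f ` lspan V S = lspan W (f ` S)"
proof
  interpret V: pre_hilbert V by fact
  interpret W: pre_hilbert W by fact
  note f = linear_mapD[OF assms(3)]
  have fS: "f ` S \<subseteq> carrier W" using f(1) assms(4) by auto
  show "f ` lspan V S \<subseteq> lspan W (f ` S)"
    using linear_map_lspan[OF assms fS] W.lspan_base[OF fS] by blast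
  show "lspan W (f ` S) \<subseteq> f ` lspan V S"
  proof
    fix y assume "y \<in> lspan W (f ` S)"
    then show "y \<in> f ` lspan V S"
    proof (induction rule: lspan.induct)
      case zero
      show ?case using linear_map_zero[OF assms(1-3)] lspan.zero by (metis imageI)
    next
      case (add_smult y t c)
      then obtain x s where xs: "x \<in> lspan V S" "y = f x" "s \<in> S" "t = f s" by blast
      then have "x \<in> carrier V" "s \<in> carrier V"
        using V.lspan_carrier[OF assms(4)] assms(4) by auto
      then have "y \<oplus>\<^bsub>W\<^esub> c \<odot>\<^bsub>W\<^esub> t = f (x \<oplus>\<^bsub>V\<^esub> c \<odot>\<^bsub>V\<^esub> s)"
        using xs f by simp
      moreover have "x \<oplus>\<^bsub>V\<^esub> c \<odot>\<^bsub>V\<^esub> s \<in> lspan V S" using xs by (intro lspan.add_smult)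
      ultimately show ?case by (rule image_eqI)
    qed
  qed
qed

text \<open>The first argument is extended from generators by induction, and conjugate symmetry lets
  the same induction handle the second.\<close>

lemma isometry_on_lspan:
  assumes "pre_hilbert V" "pre_hilbert W" "linear_map V W f" "S \<subseteq> carrier V"
    and "\<And>s s'. \<lbrakk>s \<in> S; s' \<in> S\<rbrakk> \<Longrightarrow> iprod W (f s) (f s') = iprod V s s'"
    and "x \<in> lspan V S" "y \<in> lspan V S"
  shows "iprod W (f x) (f y) = iprod V x y"
proof -
  interpret V: pre_hilbert V by fact
  interpret W: pre_hilbert W by fact
  note f = linear_mapD[OF assms(3)] and f0 = linear_map_zero[OF assms(1-3)]
  have ext: "iprod W (f x) (f s') = iprod V x s'"
    if "x \<in> lspan V S" "s' \<in> carrier V" "\<And>s. s \<in> S \<Longrightarrow> iprod W (f s) (f s') = iprod V s s'" for x s'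
    using that(1)
  proof (induction rule: lspan.induct)
    case zero
    then show ?case using that(2) f by (simp add: f0)
  next
    case (add_smult x s c)
    then have "x \<in> carrier V" "s \<in> carrier V"
      using V.lspan_carrier[OF assms(4)] assms(4) by auto
    then show ?case
      using add_smult that f
      by (simp add: V.inner_add_left W.inner_add_left V.inner_smult_left W.inner_smult_left)
  qed
  have y: "y \<in> carrier V" using V.lspan_carrier[OF assms(4)] assms(7) by auto
  show ?thesis
  proof (rule ext[OF assms(6) y])
    fix s assume s: "s \<in> S"
    then have sc: "s \<in> carrier V" using assms(4) by auto
    have "iprod W (f y) (f s) = iprod V y s"
      using s assms(5) by (intro ext[OF assms(7) sc])
    then show "iprod W (f s) (f y) = iprod V s y"
      using V.inner_cnj[OF y sc] W.inner_cnj[OF f(1)[OF y] f(1)[OF sc]] by simp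
  qed
qed

text \<open>If \<open>f x = f y\<close>, then \<open>f\<close> kills the difference \<open>z\<close>
  of \<open>x\<close> and \<open>y\<close>, whose norm therefore vanishes; definiteness of the
  source concludes.\<close>

lemma isometry_inj:
  assumes "fd_hilbert V" "pre_hilbert W" "linear_map V W f"
    and "\<And>x. x \<in> carrier V \<Longrightarrow> iprod W (f x) (f x) = iprod V x x"
  shows "inj_on f (carrier V)"
proof (rule inj_onI)
  interpret V: fd_hilbert V by fact
  interpret V: pre_hilbert V by (rule V.pre_hilbert)
  interpret W: pre_hilbert W by fact
  note f = linear_mapD[OF assms(3)]
  fix x y assume xy: "x \<in> carrier V" "y \<in> carrier V" "f x = f y"
  define z where "z = x \<oplus>\<^bsub>V\<^esub> (-1) \<odot>\<^bsub>V\<^esub> y"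
  have z: "z \<in> carrier V" using xy by (simp add: z_def)
  have "f z = f y \<oplus>\<^bsub>W\<^esub> (-1) \<odot>\<^bsub>W\<^esub> f y" using xy by (simp add: z_def f)
  then have "f z = \<zero>\<^bsub>W\<^esub>" using xy f(1) by simp
  then have "iprod V z z = 0" using assms(4)[OF z] by simp
  then have "z = \<zero>\<^bsub>V\<^esub>" using V.inner_pos[OF z] by force
  moreover have "x = z \<oplus>\<^bsub>V\<^esub> y"
    using xy V.add_neg_smult[of y] by (simp add: z_def V.M.a_assoc V.M.a_comm[of "(-1) \<odot>\<^bsub>V\<^esub> y" y])
  ultimately show "x = y" using xy by simp
qed

lemma linear_map_eq_on_lspan:
  assumes "pre_hilbert V" "pre_hilbert W" "linear_map V W f" "linear_map V W g" "S \<subseteq> carrier V"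
    and "\<And>s. s \<in> S \<Longrightarrow> f s = g s" "x \<in> lspan V S"
  shows "f x = g x"
proof -
  interpret V: pre_hilbert V by fact
  from assms(7) show ?thesis
  proof (induction rule: lspan.induct)
    case zero
    show ?case
      using linear_map_zero[OF assms(1,2,3)] linear_map_zero[OF assms(1,2,4)] by simp
  next
    case (add_smult x s c)
    then have "x \<in> carrier V" "s \<in> carrier V"
      using V.lspan_carrier[OF assms(5)] assms(5) by auto
    then show ?case
      using add_smult assms(6) linear_mapD[OF assms(3)] linear_mapD[OF assms(4)] by simp
  qed
qed

lemma linear_mapsD: "f \<in> linear_maps V W \<Longrightarrow> linear_map V W f"
  by (simp add: linear_maps_def)

text \<open>Extensionality upgrades agreement on a generating set to equality of functions, as
  required for uniqueness in definite descriptions and for equations between arrows.\<close>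

lemma linear_maps_eqI:
  assumes "pre_hilbert V" "pre_hilbert W" "f \<in> linear_maps V W" "g \<in> linear_maps V W"
    and "S \<subseteq> carrier V" "carrier V \<subseteq> lspan V S" "\<And>s. s \<in> S \<Longrightarrow> f s = g s"
  shows "f = g"
proof (rule extensionalityI)
  show "f \<in> extensional (carrier V)" "g \<in> extensional (carrier V)"
    using assms by (auto simp: linear_maps_def)
  show "f x = g x" if "x \<in> carrier V" for x
    using linear_map_eq_on_lspan[OF assms(1,2) linear_mapsD[OF assms(3)] linear_mapsD[OF assms(4)]]
      assms that by auto
qed

lemma restrict_linear_maps:
  assumes "pre_hilbert V" "linear_map V W f"
  shows "restrict f (carrier V) \<in> linear_maps V W"
proof -
  interpret V: pre_hilbert V by fact
  show ?thesis using assms(2) by (auto simp: linear_maps_def linear_map_def)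
qed

text \<open>The coefficients are inner products, hence linear in the vector; well-definedness of
  coordinates never has to be argued. All existence statements for maps out of tensor products rest
  on this extension.\<close>

lemma onb_extend_linear:
  assumes "pre_hilbert V" "pre_hilbert W" "onb V B" "g \<in> B \<rightarrow> carrier W"
  shows "\<exists>f\<in>linear_maps V W. \<forall>b\<in>B. f b = g b"
proof -
  interpret V: pre_hilbert V by fact
  interpret W: pre_hilbert W by fact
  have B: "finite B" "B \<subseteq> carrier V"
    and ip: "\<And>b b'. \<lbrakk>b \<in> B; b' \<in> B\<rbrakk> \<Longrightarrow> iprod V b b' = (if b = b' then 1 else 0)"
    using assms(3) by (auto simp: onb_def orthonormal_def)
  have g: "g b \<in> carrier W" if "b \<in> B" for b using assms(4) that by auto
  define f where "f x = (\<Oplus>\<^bsub>W\<^esub>b\<in>B. iprod V x b \<odot>\<^bsub>W\<^esub> g b)" for x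
  have "linear_map V W f"
    unfolding linear_map_def
  proof (intro conjI ballI allI)
    show "f \<in> carrier V \<rightarrow> carrier W" using g by (auto simp: f_def intro!: W.finsum_closed)
    fix x assume x: "x \<in> carrier V"
    show "f (c \<odot>\<^bsub>V\<^esub> x) = c \<odot>\<^bsub>W\<^esub> f x" for c
    proof -
      have "f (c \<odot>\<^bsub>V\<^esub> x) = (\<Oplus>\<^bsub>W\<^esub>b\<in>B. c \<odot>\<^bsub>W\<^esub> (iprod V x b \<odot>\<^bsub>W\<^esub> g b))"
        unfolding f_def using B g x
        by (intro W.finsum_cong) (auto simp: simp_implies_def V.inner_smult_left W.smult_smult)
      also have "\<dots> = c \<odot>\<^bsub>W\<^esub> f x"
        unfolding f_def using B g by (subst W.smult_finsum) auto
      finally show ?thesis .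
    qed
    fix y assume y: "y \<in> carrier V"
    have "f (x \<oplus>\<^bsub>V\<^esub> y) = (\<Oplus>\<^bsub>W\<^esub>b\<in>B. iprod V x b \<odot>\<^bsub>W\<^esub> g b \<oplus>\<^bsub>W\<^esub> iprod V y b \<odot>\<^bsub>W\<^esub> g b)"
      unfolding f_def using B g x y
      by (intro W.finsum_cong) (auto simp: simp_implies_def V.inner_add_left W.smult_add_left)
    also have "\<dots> = f x \<oplus>\<^bsub>W\<^esub> f y"
      unfolding f_def using B g by (intro W.finsum_addf) auto
    finally show "f (x \<oplus>\<^bsub>V\<^esub> y) = f x \<oplus>\<^bsub>W\<^esub> f y" .
  qed
  moreover have "f b = g b" if "b \<in> B" for b
  proof -
    have "f b = (\<Oplus>\<^bsub>W\<^esub>b'\<in>B. if b = b' then g b' else \<zero>\<^bsub>W\<^esub>)"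
      unfolding f_def using that g by (intro W.finsum_cong) (auto simp: simp_implies_def ip)
    also have "\<dots> = g b"
      using B g that by (intro W.finsum_singleton) auto
    finally show ?thesis .
  qed
  ultimately show ?thesis
    using restrict_linear_maps[OF assms(1), of W f] B
    by (intro bexI[of _ "restrict f (carrier V)"]) (simp_all add: subset_iff)
qed

section \<open>Tensor products\<close>

text \<open>Symmetry and transitivity give equivalent lists literally the same predicate of
  equivalents, so the choice operator returns the same representative for both.\<close>

lemma tensor_eq_cong: "tensor_eq V W s t \<Longrightarrow> tensor_class V W s = tensor_class V W t"
proof -
  assume "tensor_eq V W s t"
  then have "tensor_eq V W s = tensor_eq V W t"
    by (intro ext iffI) (blast intro: tensor_eq.sym tensor_eq.trans)+
  then show ?thesis by (simp add: tensor_class_def)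
qed

lemma tensor_eq_summands:
  assumes "set s \<subseteq> carrier V \<times> carrier W"
  shows "tensor_eq V W s (summands (tensor_class V W s))"
  using someI[of "tensor_eq V W s", OF tensor_eq.refl[OF assms]] by (simp add: tensor_class_def)

section \<open>Multilinear maps and their determination by generators\<close>

definition bilinear_map ::
    "('v, 'm) hilbert_scheme \<Rightarrow> ('w, 'n) hilbert_scheme \<Rightarrow> ('u, 'l) hilbert_scheme
      \<Rightarrow> ('v \<Rightarrow> 'w \<Rightarrow> 'u) \<Rightarrow> bool" where
  "bilinear_map V W U p \<longleftrightarrow>
     (\<forall>y\<in>carrier W. linear_map V U (\<lambda>x. p x y)) \<and> (\<forall>x\<in>carrier V. linear_map W U (p x))"

definition trilinear_map ::
    "('v, 'm) hilbert_scheme \<Rightarrow> ('w, 'n) hilbert_scheme \<Rightarrow> ('x, 'o) hilbert_scheme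
      \<Rightarrow> ('u, 'l) hilbert_scheme \<Rightarrow> ('v \<Rightarrow> 'w \<Rightarrow> 'x \<Rightarrow> 'u) \<Rightarrow> bool" where
  "trilinear_map V W W' U p \<longleftrightarrow>
     (\<forall>y\<in>carrier W. \<forall>z\<in>carrier W'. linear_map V U (\<lambda>x. p x y z)) \<and>
     (\<forall>x\<in>carrier V. bilinear_map W W' U (p x))"

lemma bilinear_mapD:
  assumes "bilinear_map V W U p"
  shows "y \<in> carrier W \<Longrightarrow> linear_map V U (\<lambda>x. p x y)"
    and "x \<in> carrier V \<Longrightarrow> linear_map W U (p x)"
    and "\<lbrakk>x \<in> carrier V; y \<in> carrier W\<rbrakk> \<Longrightarrow> p x y \<in> carrier U"
  using assms by (auto simp: bilinear_map_def intro: linear_mapD)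

lemma trilinear_mapD:
  assumes "trilinear_map V W W' U p"
  shows "\<lbrakk>y \<in> carrier W; z \<in> carrier W'\<rbrakk> \<Longrightarrow> linear_map V U (\<lambda>x. p x y z)"
    and "x \<in> carrier V \<Longrightarrow> bilinear_map W W' U (p x)"
    and "\<lbrakk>x \<in> carrier V; y \<in> carrier W; z \<in> carrier W'\<rbrakk> \<Longrightarrow> p x y z \<in> carrier U"
  using assms by (auto simp: trilinear_map_def dest: bilinear_mapD)

lemma bilinear_map_comp:
  "\<lbrakk>bilinear_map V W U p; linear_map U U' f\<rbrakk> \<Longrightarrow> bilinear_map V W U' (\<lambda>x y. f (p x y))"
  by (simp add: bilinear_map_def linear_map_def Pi_iff)

lemma trilinear_map_comp:
  "\<lbrakk>trilinear_map V W W' U p; linear_map U U' f\<rbrakk>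
    \<Longrightarrow> trilinear_map V W W' U' (\<lambda>x y z. f (p x y z))"
  by (simp add: trilinear_map_def bilinear_map_def linear_map_def Pi_iff)

lemma bilinear_map_smult:
  "\<lbrakk>pre_hilbert U; bilinear_map V W U p\<rbrakk> \<Longrightarrow> bilinear_map V W U (\<lambda>x y. c \<odot>\<^bsub>U\<^esub> p x y)"
  by (auto simp: bilinear_map_def intro: linear_map_smult)

lemma trilinear_map_smult:
  "\<lbrakk>pre_hilbert U; trilinear_map V W W' U p\<rbrakk>
    \<Longrightarrow> trilinear_map V W W' U (\<lambda>x y z. c \<odot>\<^bsub>U\<^esub> p x y z)"
  by (auto simp: trilinear_map_def intro: linear_map_smult bilinear_map_smult)

lemma bilinear_map_precomp:
  "\<lbrakk>bilinear_map V' W' U p; linear_map V V' f; linear_map W W' g\<rbrakk>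
    \<Longrightarrow> bilinear_map V W U (\<lambda>x y. p (f x) (g y))"
  by (auto simp: bilinear_map_def linear_map_def Pi_iff)

text \<open>Generators are exchanged for span elements one variable at a time. This is how formulas
  verified on basis vectors spread to homogeneous vectors, and from those to arbitrary ones.\<close>

lemma bilinear_map_eq_on_lspan:
  assumes "pre_hilbert V" "pre_hilbert W" "pre_hilbert U"
    and "bilinear_map V W U p" "bilinear_map V W U q" "S \<subseteq> carrier V" "S' \<subseteq> carrier W"
    and "\<And>s s'. \<lbrakk>s \<in> S; s' \<in> S'\<rbrakk> \<Longrightarrow> p s s' = q s s'"
    and "x \<in> lspan V S" "y \<in> lspan W S'"
  shows "p x y = q x y"
proof -
  interpret W: pre_hilbert W by fact
  have y: "y \<in> carrier W" using W.lspan_carrier assms by blast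
  note p = bilinear_mapD[OF assms(4)] and q = bilinear_mapD[OF assms(5)]
  show ?thesis
  proof (rule linear_map_eq_on_lspan[OF assms(1,3) p(1) q(1) assms(6) _ assms(9)])
    show "p s y = q s y" if "s \<in> S" for s
      using that assms(6,8)
      by (intro linear_map_eq_on_lspan[OF assms(2,3) p(2) q(2) assms(7) _ assms(10)]) auto
  qed (use y in auto)
qed

lemma trilinear_map_eq_on_lspan:
  assumes "pre_hilbert V" "pre_hilbert W" "pre_hilbert W'" "pre_hilbert U"
    and "trilinear_map V W W' U p" "trilinear_map V W W' U q"
    and "S \<subseteq> carrier V" "S' \<subseteq> carrier W" "S'' \<subseteq> carrier W'"
    and "\<And>s s' s''. \<lbrakk>s \<in> S; s' \<in> S'; s'' \<in> S''\<rbrakk> \<Longrightarrow> p s s' s'' = q s s' s''"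
    and "x \<in> lspan V S" "y \<in> lspan W S'" "z \<in> lspan W' S''"
  shows "p x y z = q x y z"
proof -
  interpret W: pre_hilbert W by fact
  interpret W': pre_hilbert W' by fact
  have y: "y \<in> carrier W" "z \<in> carrier W'"
    using W.lspan_carrier W'.lspan_carrier assms by blast+
  note p = trilinear_mapD[OF assms(5)] and q = trilinear_mapD[OF assms(6)]
  show ?thesis
  proof (rule linear_map_eq_on_lspan[OF assms(1,4) p(1) q(1) assms(7) _ assms(11)])
    show "p s y z = q s y z" if "s \<in> S" for s
      using that assms(7,10)
      by (intro bilinear_map_eq_on_lspan[OF assms(2-4) p(2) q(2) assms(8,9) _ assms(12,13)]) auto
  qed (use y in auto)
qed

text \<open>
  The third structure \<open>T\<close> may carry extra fields beyond those of \<^const>\<open>tensor_space\<close>, so that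
  everything applies verbatim to \<^const>\<open>bun_tensor\<close>.
\<close>

locale tensor_product = V: pre_hilbert V + W: pre_hilbert W
  for V :: "('a tvec, 'm) hilbert_scheme" and W :: "('a tvec, 'n) hilbert_scheme" +
  fixes T :: "('a tvec, 'l) hilbert_scheme"
  assumes truncate_T: "hilbert.truncate T = tensor_space V W"
begin

abbreviation valid :: "('a tvec \<times> 'a tvec) list \<Rightarrow> bool" where
  "valid s \<equiv> set s \<subseteq> carrier V \<times> carrier W"

abbreviation cls :: "('a tvec \<times> 'a tvec) list \<Rightarrow> 'a tvec" where
  "cls \<equiv> tensor_class V W"

abbreviation pure :: "'a tvec \<Rightarrow> 'a tvec \<Rightarrow> 'a tvec" where
  "pure \<equiv> pure_tensor V W"

lemma T_simps:
  "carrier T = cls ` {s. valid s}"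
  "\<zero>\<^bsub>T\<^esub> = cls []"
  "p \<oplus>\<^bsub>T\<^esub> q = cls (summands p @ summands q)"
  "c \<odot>\<^bsub>T\<^esub> p = cls (map (\<lambda>(x, y). (c \<odot>\<^bsub>V\<^esub> x, y)) (summands p))"
  "iprod T p q = (\<Sum>(x, y) \<leftarrow> summands p. \<Sum>(x', y') \<leftarrow> summands q. iprod V x x' * iprod W y y')"
proof -
  have "carrier T = carrier (hilbert.truncate T)" "\<zero>\<^bsub>T\<^esub> = \<zero>\<^bsub>hilbert.truncate T\<^esub>"
    "p \<oplus>\<^bsub>T\<^esub> q = p \<oplus>\<^bsub>hilbert.truncate T\<^esub> q" "c \<odot>\<^bsub>T\<^esub> p = c \<odot>\<^bsub>hilbert.truncate T\<^esub> p"
    "iprod T p q = iprod (hilbert.truncate T) p q"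
    by (simp_all add: hilbert.truncate_def)
  then show "carrier T = cls ` {s. valid s}"
    "\<zero>\<^bsub>T\<^esub> = cls []"
    "p \<oplus>\<^bsub>T\<^esub> q = cls (summands p @ summands q)"
    "c \<odot>\<^bsub>T\<^esub> p = cls (map (\<lambda>(x, y). (c \<odot>\<^bsub>V\<^esub> x, y)) (summands p))"
    "iprod T p q = (\<Sum>(x, y) \<leftarrow> summands p. \<Sum>(x', y') \<leftarrow> summands q. iprod V x x' * iprod W y y')"
    unfolding truncate_T by (auto simp: tensor_space_def)
qed

section \<open>Compatibility of the operations and of the form with the congruence\<close>

lemma tensor_eq_valid: "tensor_eq V W s t \<Longrightarrow> valid s \<and> valid t"
  by (induction rule: tensor_eq.induct) auto

lemma valid_summands: "valid s \<Longrightarrow> valid (summands (cls s))"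
  using tensor_eq_summands tensor_eq_valid by blast

lemma add_cls: "\<lbrakk>valid s; valid t\<rbrakk> \<Longrightarrow> cls s \<oplus>\<^bsub>T\<^esub> cls t = cls (s @ t)"
  unfolding T_simps
  by (intro tensor_eq_cong tensor_eq.append tensor_eq_summands[THEN tensor_eq.sym])

lemma valid_smult: "valid s \<Longrightarrow> valid (map (\<lambda>(x, y). (c \<odot>\<^bsub>V\<^esub> x, y)) s)"
  by (induction s) auto

text \<open>Scaling all first components respects each generating rule. The rule that moves a scalar
  across the tensor sign is the case that uses commutativity of the scalars.\<close>

lemma tensor_eq_map_smult:
  "tensor_eq V W s t \<Longrightarrow>
    tensor_eq V W (map (\<lambda>(x, y). (c \<odot>\<^bsub>V\<^esub> x, y)) s) (map (\<lambda>(x, y). (c \<odot>\<^bsub>V\<^esub> x, y)) t)"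
proof (induction rule: tensor_eq.induct)
  case (refl s)
  then show ?case by (intro tensor_eq.refl valid_smult)
next
  case (commute s t)
  then show ?case unfolding map_append by (intro tensor_eq.commute valid_smult)
next
  case (sym s t)
  from sym.IH show ?case by (rule tensor_eq.sym)
next
  case (trans s t u)
  from trans.IH show ?case by (rule tensor_eq.trans)
next
  case (smult x y d)
  then show ?case
    using tensor_eq.smult[of "c \<odot>\<^bsub>V\<^esub> x" V y W d] by (simp add: V.smult_smult mult.commute)
qed (auto simp: V.smult_add_right intro: tensor_eq.intros)

lemma smult_cls: "valid s \<Longrightarrow> c \<odot>\<^bsub>T\<^esub> cls s = cls (map (\<lambda>(x, y). (c \<odot>\<^bsub>V\<^esub> x, y)) s)"
  unfolding T_simps
  by (intro tensor_eq_cong tensor_eq_map_smult tensor_eq_summands[THEN tensor_eq.sym])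

text \<open>The form on lists, before passing to classes. Independence of the representative can be
  proved here one generating rule at a time.\<close>

definition ip :: "('a tvec \<times> 'a tvec) list \<Rightarrow> ('a tvec \<times> 'a tvec) list \<Rightarrow> complex" where
  "ip s t = (\<Sum>(x, y) \<leftarrow> s. \<Sum>(x', y') \<leftarrow> t. iprod V x x' * iprod W y y')"

lemma ip_simps [simp]:
  "ip [] t = 0" "ip (s @ s') t = ip s t + ip s' t"
  "ip [a, b] t = ip [a] t + ip [b] t"
  by (simp_all add: ip_def)

lemma ip_Cons_left: "ip ((x, y) # s) t = ip [(x, y)] t + ip s t"
  by (simp add: ip_def)

lemma ip_Nil_right [simp]: "ip s [] = 0"
  by (induction s) (auto simp: ip_def)

lemma ip_Cons_right: "ip s ((x, y) # t) = ip s [(x, y)] + ip s t"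
  by (induction s) (auto simp: ip_def)

lemma ip_pure: "ip [(x, y)] [(x', y')] = iprod V x x' * iprod W y y'"
  by (simp add: ip_def)

lemma ip_cnj: "\<lbrakk>valid s; valid t\<rbrakk> \<Longrightarrow> ip t s = cnj (ip s t)"
proof (induction s)
  case Nil
  then show ?case by simp
next
  case (Cons a s)
  obtain x y where a: "a = (x, y)" by fastforce
  have "ip t [(x, y)] = cnj (ip [(x, y)] t)"
    using Cons.prems unfolding a
  proof (induction t)
    case (Cons b t)
    obtain x' y' where b: "b = (x', y')" by fastforce
    show ?case
      using Cons V.inner_cnj[of x x'] W.inner_cnj[of y y'] unfolding b
      by (subst ip_Cons_right[of "[(x, y)]"], subst ip_Cons_left) (simp add: ip_pure)
  qed simp
  with Cons show ?case
    unfolding a by (subst ip_Cons_right, subst ip_Cons_left) simp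
qed

lemma ip_bilinear:
  assumes "valid t"
  shows "\<lbrakk>x \<in> carrier V; x' \<in> carrier V; y \<in> carrier W\<rbrakk>
      \<Longrightarrow> ip [(x \<oplus>\<^bsub>V\<^esub> x', y)] t = ip [(x, y)] t + ip [(x', y)] t"
    and "\<lbrakk>x \<in> carrier V; y \<in> carrier W; y' \<in> carrier W\<rbrakk>
      \<Longrightarrow> ip [(x, y \<oplus>\<^bsub>W\<^esub> y')] t = ip [(x, y)] t + ip [(x, y')] t"
    and "\<lbrakk>x \<in> carrier V; y \<in> carrier W\<rbrakk> \<Longrightarrow> ip [(c \<odot>\<^bsub>V\<^esub> x, y)] t = c * ip [(x, y)] t"
    and "\<lbrakk>x \<in> carrier V; y \<in> carrier W\<rbrakk> \<Longrightarrow> ip [(x, c \<odot>\<^bsub>W\<^esub> y)] t = c * ip [(x, y)] t"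
  using assms
  by (induction t)
     (auto simp: ip_def V.inner_add_left W.inner_add_left V.inner_smult_left W.inner_smult_left
       algebra_simps)

lemma ip_cong_left: "\<lbrakk>tensor_eq V W s s'; valid t\<rbrakk> \<Longrightarrow> ip s t = ip s' t"
proof (induction rule: tensor_eq.induct)
  case (zero y)
  then show ?case using ip_bilinear(3)[of t "\<zero>\<^bsub>V\<^esub>" y 0] by simp
qed (auto simp: ip_bilinear)

text \<open>A class stores an unspecified representative, so both arguments have to be exchanged.
  Invariance is available for the left argument; conjugate symmetry carries it to the right
  one.\<close>

lemma inner_cls:
  assumes "valid s" "valid t"
  shows "iprod T (cls s) (cls t) = ip s t"
proof -
  have "iprod T (cls s) (cls t) = ip (summands (cls s)) (summands (cls t))"
    by (simp add: T_simps ip_def)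
  also have "\<dots> = ip s (summands (cls t))"
    using assms by (intro ip_cong_left tensor_eq_summands[THEN tensor_eq.sym] valid_summands)
  also have "\<dots> = cnj (ip (summands (cls t)) s)"
    using assms by (intro ip_cnj valid_summands)
  also have "ip (summands (cls t)) s = ip t s"
    using assms by (intro ip_cong_left tensor_eq_summands[THEN tensor_eq.sym] valid_summands)
  also have "cnj (ip t s) = ip s t"
    using assms by (intro ip_cnj[symmetric])
  finally show ?thesis .
qed

lemma abelian_group_T: "abelian_group T"
proof (rule abelian_groupI)
  fix p q assume p: "p \<in> carrier T" and q: "q \<in> carrier T"
  then obtain s t where s: "valid s" "p = cls s" and t: "valid t" "q = cls t"
    by (auto simp: T_simps(1))
  show "p \<oplus>\<^bsub>T\<^esub> q \<in> carrier T"
    using s t by (auto simp: add_cls T_simps(1))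
  show "p \<oplus>\<^bsub>T\<^esub> q = q \<oplus>\<^bsub>T\<^esub> p"
    using s t by (auto simp: add_cls intro: tensor_eq_cong tensor_eq.commute)
  show "\<zero>\<^bsub>T\<^esub> \<oplus>\<^bsub>T\<^esub> p = p"
    using s by (simp add: T_simps(2) add_cls)
  show "p \<oplus>\<^bsub>T\<^esub> q \<oplus>\<^bsub>T\<^esub> r = p \<oplus>\<^bsub>T\<^esub> (q \<oplus>\<^bsub>T\<^esub> r)" if "r \<in> carrier T" for r
    using that s t by (auto simp: T_simps(1) add_cls)
  \<comment> \<open>The candidate for the negative of a class: every first component is multiplied
    by -1.\<close>
  define n :: "('a tvec \<times> 'a tvec) list \<Rightarrow> _" where "n = map (\<lambda>(x, y). ((-1) \<odot>\<^bsub>V\<^esub> x, y))"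
  have "valid (n s)" using s valid_smult by (simp add: n_def del: set_map)
  moreover have "tensor_eq V W (n s @ s) []" using s(1)
  proof (induction s)
    case Nil
    then show ?case by (auto simp: n_def intro!: tensor_eq.refl)
  next
    case (Cons a s)
    obtain x y where a: "a = (x, y)" by fastforce
    then have xy: "x \<in> carrier V" "y \<in> carrier W" "valid s" using Cons.prems by auto
    define x' where "x' = (-1) \<odot>\<^bsub>V\<^esub> x"
    have x': "x' \<in> carrier V" "x' \<oplus>\<^bsub>V\<^esub> x = \<zero>\<^bsub>V\<^esub>"
      using xy V.add_neg_smult[of x] by (simp_all add: x'_def V.M.a_comm)
    have "valid (n s)" using xy valid_smult by (simp add: n_def del: set_map)
    \<comment> \<open>A pair cancels its negative: \<open>add_left\<close> read backwards merges
      them into a pair with first component zero, which \<open>zero\<close> removes.\<close>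
    have "tensor_eq V W [(x', y), (x, y)] []"
      using tensor_eq.add_left[of x' V x y W] tensor_eq.zero[of y W V] xy x'
      by (metis tensor_eq.sym tensor_eq.trans)
    then have "tensor_eq V W ([(x', y), (x, y)] @ (n s @ s)) ([] @ [])"
      using Cons.IH[OF xy(3)] by (rule tensor_eq.append)
    \<comment> \<open>In the negated list followed by the list, the head pair is separated from its
      negative by \<open>n s\<close>; \<open>commute\<close> brings the two together.\<close>
    moreover have "tensor_eq V W ([(x', y)] @ ((n s @ [(x, y)]) @ s)) ([(x', y)] @ (([(x, y)] @ n s) @ s))"
      using xy x' \<open>valid (n s)\<close>
      by (intro tensor_eq.append tensor_eq.refl tensor_eq.commute) auto
    ultimately show ?case
      unfolding a using tensor_eq.trans by (fastforce simp: n_def x'_def)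
  qed
  then have "cls (n s @ s) = cls []" by (rule tensor_eq_cong)
  ultimately show "\<exists>q\<in>carrier T. q \<oplus>\<^bsub>T\<^esub> p = \<zero>\<^bsub>T\<^esub>"
    using s by (intro bexI[of _ "cls (n s)"]) (auto simp: add_cls T_simps(1,2))
next
  show "\<zero>\<^bsub>T\<^esub> \<in> carrier T"
    by (auto simp: T_simps(1,2))
qed

lemma pure_closed [simp, intro]: "\<lbrakk>x \<in> carrier V; y \<in> carrier W\<rbrakk> \<Longrightarrow> pure x y \<in> carrier T"
  by (auto simp: pure_tensor_def T_simps(1))

lemma cls_Cons: "\<lbrakk>x \<in> carrier V; y \<in> carrier W; valid s\<rbrakk> \<Longrightarrow> cls ((x, y) # s) = pure x y \<oplus>\<^bsub>T\<^esub> cls s"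
  by (simp add: pure_tensor_def add_cls)

text \<open>An induction over sums of pure tensors, so that module axioms can be checked without
  looking at representatives.\<close>

lemma tensor_induct [consumes 1, case_names zero add]:
  assumes "p \<in> carrier T" "P \<zero>\<^bsub>T\<^esub>"
    and "\<And>x y p. \<lbrakk>x \<in> carrier V; y \<in> carrier W; p \<in> carrier T; P p\<rbrakk> \<Longrightarrow> P (pure x y \<oplus>\<^bsub>T\<^esub> p)"
  shows "P p"
proof -
  obtain s where "valid s" "p = cls s" using assms(1) by (auto simp: T_simps(1))
  then show ?thesis
  proof (induction s arbitrary: p)
    case (Cons a s)
    then show ?case using assms(3)[of "fst a" "snd a" "cls s"]
      by (cases a) (auto simp: cls_Cons T_simps(1))
  qed (use assms(2) in \<open>simp add: T_simps\<close>)
qed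

lemma pure_add_left:
  "\<lbrakk>x \<in> carrier V; x' \<in> carrier V; y \<in> carrier W\<rbrakk>
    \<Longrightarrow> pure (x \<oplus>\<^bsub>V\<^esub> x') y = pure x y \<oplus>\<^bsub>T\<^esub> pure x' y"
  using tensor_eq_cong[OF tensor_eq.add_left, of x V x' y W]
  by (simp add: pure_tensor_def add_cls)

lemma pure_add_right:
  "\<lbrakk>x \<in> carrier V; y \<in> carrier W; y' \<in> carrier W\<rbrakk>
    \<Longrightarrow> pure x (y \<oplus>\<^bsub>W\<^esub> y') = pure x y \<oplus>\<^bsub>T\<^esub> pure x y'"
  using tensor_eq_cong[OF tensor_eq.add_right, of x V y W y']
  by (simp add: pure_tensor_def add_cls)

lemma pure_smult_left:
  "\<lbrakk>x \<in> carrier V; y \<in> carrier W\<rbrakk> \<Longrightarrow> pure (c \<odot>\<^bsub>V\<^esub> x) y = c \<odot>\<^bsub>T\<^esub> pure x y"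
  by (simp add: pure_tensor_def smult_cls)

lemma pure_smult_right:
  "\<lbrakk>x \<in> carrier V; y \<in> carrier W\<rbrakk> \<Longrightarrow> pure x (c \<odot>\<^bsub>W\<^esub> y) = c \<odot>\<^bsub>T\<^esub> pure x y"
  using tensor_eq_cong[OF tensor_eq.smult, of x V y W c]
  by (simp add: pure_tensor_def smult_cls)

lemma smult_T_closed: "p \<in> carrier T \<Longrightarrow> c \<odot>\<^bsub>T\<^esub> p \<in> carrier T"
  using valid_smult by (auto simp: T_simps(1) smult_cls simp del: set_map)

lemma smult_T_add:
  assumes "p \<in> carrier T" "q \<in> carrier T"
  shows "c \<odot>\<^bsub>T\<^esub> (p \<oplus>\<^bsub>T\<^esub> q) = c \<odot>\<^bsub>T\<^esub> p \<oplus>\<^bsub>T\<^esub> c \<odot>\<^bsub>T\<^esub> q"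
proof -
  obtain s t where s: "valid s" "p = cls s" and t: "valid t" "q = cls t"
    using assms by (auto simp: T_simps(1))
  have "valid (map (\<lambda>(x, y). (c \<odot>\<^bsub>V\<^esub> x, y)) s)" "valid (map (\<lambda>(x, y). (c \<odot>\<^bsub>V\<^esub> x, y)) t)"
    using s t by (auto simp del: set_map intro!: valid_smult)
  with s t show ?thesis by (simp add: add_cls smult_cls)
qed

lemma smult_T_zero: "c \<odot>\<^bsub>T\<^esub> \<zero>\<^bsub>T\<^esub> = \<zero>\<^bsub>T\<^esub>"
  by (simp add: T_simps(2) smult_cls)

text \<open>Identities between scalars reduce to pure tensors, where the scalar moves into the first
  factor and the identity becomes one in \<open>V\<close>.\<close>

lemma module_T: "module complex_ring T"
proof (rule moduleI)
  show "cring complex_ring" by (rule V.R.is_cring)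
  show "abelian_group T" by (rule abelian_group_T)
  interpret T: abelian_group T by (rule abelian_group_T)
  fix a b p assume p: "p \<in> carrier T"
  show "a \<odot>\<^bsub>T\<^esub> p \<in> carrier T" using p by (rule smult_T_closed)
  show "(a \<oplus>\<^bsub>complex_ring\<^esub> b) \<odot>\<^bsub>T\<^esub> p = a \<odot>\<^bsub>T\<^esub> p \<oplus>\<^bsub>T\<^esub> b \<odot>\<^bsub>T\<^esub> p"
    using p
  proof (induction rule: tensor_induct)
    case (add x y p)
    then show ?case
      by (simp add: smult_T_add smult_T_closed T.add.m_ac V.smult_add_left pure_add_left
          flip: pure_smult_left)
  qed (simp add: smult_T_zero)
  show "(a \<otimes>\<^bsub>complex_ring\<^esub> b) \<odot>\<^bsub>T\<^esub> p = a \<odot>\<^bsub>T\<^esub> (b \<odot>\<^bsub>T\<^esub> p)"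
    using p
  proof (induction rule: tensor_induct)
    case (add x y p)
    then show ?case
      by (simp add: smult_T_add smult_T_closed V.smult_smult flip: pure_smult_left)
  qed (simp add: smult_T_zero)
  show "\<one>\<^bsub>complex_ring\<^esub> \<odot>\<^bsub>T\<^esub> p = p"
    using p
  proof (induction rule: tensor_induct)
    case (add x y p)
    then show ?case
      by (simp add: smult_T_add smult_T_closed flip: pure_smult_left)
  qed (simp add: smult_T_zero)
next
  fix a p q assume "p \<in> carrier T" "q \<in> carrier T"
  then show "a \<odot>\<^bsub>T\<^esub> (p \<oplus>\<^bsub>T\<^esub> q) = a \<odot>\<^bsub>T\<^esub> p \<oplus>\<^bsub>T\<^esub> a \<odot>\<^bsub>T\<^esub> q"
    by (rule smult_T_add)
qed

sublocale T: pre_hilbert T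
proof -
  interpret T: module complex_ring T by (rule module_T)
  show "pre_hilbert T"
  proof
    fix p q assume "p \<in> carrier T" "q \<in> carrier T"
    then obtain s t where s: "valid s" "p = cls s" and t: "valid t" "q = cls t"
      by (auto simp: T_simps(1))
    show "iprod T q p = cnj (iprod T p q)"
      using s t ip_cnj[OF s(1) t(1)] by (simp add: inner_cls)
    have "iprod T (cls (map (\<lambda>(x, y). (c \<odot>\<^bsub>V\<^esub> x, y)) s)) (cls t) = c * ip s t" for c
    proof -
      have "ip (map (\<lambda>(x, y). (c \<odot>\<^bsub>V\<^esub> x, y)) s) t = c * ip s t"
        using s(1)
      proof (induction s)
        case (Cons a s)
        obtain x y where "a = (x, y)" by fastforce
        with Cons show ?case
          using ip_bilinear(3)[OF t(1), of x y c]
          by (simp add: ip_Cons_left[of _ _ s] ip_Cons_left[of _ _ "map _ s"] distrib_left)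
      qed simp
      moreover have "valid (map (\<lambda>(x, y). (c \<odot>\<^bsub>V\<^esub> x, y)) s)"
        using s valid_smult by blast
      ultimately show ?thesis using t by (simp add: inner_cls)
    qed
    then show "iprod T (c \<odot>\<^bsub>T\<^esub> p) q = c * iprod T p q" for c
      using s t by (simp add: smult_cls inner_cls)
    show "iprod T (p \<oplus>\<^bsub>T\<^esub> r) q = iprod T p q + iprod T r q" if "r \<in> carrier T" for r
      using that s t by (auto simp: T_simps(1) add_cls inner_cls)
  qed
qed

section \<open>Pure tensors: bilinearity, generation and orthonormal bases\<close>

lemma inner_pure:
  "\<lbrakk>x \<in> carrier V; y \<in> carrier W; x' \<in> carrier V; y' \<in> carrier W\<rbrakk>
    \<Longrightarrow> iprod T (pure x y) (pure x' y') = iprod V x x' * iprod W y y'"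
  by (simp add: pure_tensor_def inner_cls ip_pure)

lemma bilinear_pure: "bilinear_map V W T pure"
  by (auto simp: bilinear_map_def linear_map_def pure_add_left pure_add_right
      pure_smult_left pure_smult_right)

lemma carrier_lspan_pure: "carrier T = lspan T {pure x y |x y. x \<in> carrier V \<and> y \<in> carrier W}"
proof
  let ?S = "{pure x y |x y. x \<in> carrier V \<and> y \<in> carrier W}"
  have S: "?S \<subseteq> carrier T" by auto
  then show "lspan T ?S \<subseteq> carrier T" by (rule T.lspan_carrier)
  show "carrier T \<subseteq> lspan T ?S"
  proof
    fix p assume "p \<in> carrier T"
    then show "p \<in> lspan T ?S"
    proof (induction rule: tensor_induct)
      case (add x y p)
      then show ?case by (intro T.lspan_add[OF S] T.lspan_base[OF S, of "pure x y"]) auto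
    qed (rule lspan.zero)
  qed
qed

lemma pure_in_lspan:
  assumes "S \<subseteq> carrier V" "S' \<subseteq> carrier W" "Q \<subseteq> carrier T"
    and "\<And>s s'. \<lbrakk>s \<in> S; s' \<in> S'\<rbrakk> \<Longrightarrow> pure s s' \<in> lspan T Q"
    and "x \<in> lspan V S" "y \<in> lspan W S'"
  shows "pure x y \<in> lspan T Q"
proof -
  have y: "y \<in> carrier W" using assms W.lspan_carrier[of S'] by auto
  show ?thesis
  proof (rule linear_map_lspan[OF V.pre_hilbert_axioms T.pre_hilbert_axioms _ assms(1,3) _ assms(5)])
    show "linear_map V T (\<lambda>x. pure x y)" using bilinear_pure y by (simp add: bilinear_map_def)
    show "pure s y \<in> lspan T Q" if "s \<in> S" for s
    proof (rule linear_map_lspan[OF W.pre_hilbert_axioms T.pre_hilbert_axioms _ assms(2,3) _ assms(6)])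
      show "linear_map W T (pure s)" using bilinear_pure that assms(1) by (auto simp: bilinear_map_def)
    qed (use assms that in auto)
  qed
qed

lemma tensor_gens:
  assumes "S \<subseteq> carrier V" "S' \<subseteq> carrier W" "lspan V S = carrier V" "lspan W S' = carrier W"
  shows "lspan T {pure s s' |s s'. s \<in> S \<and> s' \<in> S'} = carrier T"
proof
  let ?Q = "{pure s s' |s s'. s \<in> S \<and> s' \<in> S'}"
  have Q: "?Q \<subseteq> carrier T" using assms by auto
  then show "lspan T ?Q \<subseteq> carrier T" by (rule T.lspan_carrier)
  have "{pure x y |x y. x \<in> carrier V \<and> y \<in> carrier W} \<subseteq> lspan T ?Q"
  proof clarify
    fix x y assume "x \<in> carrier V" "y \<in> carrier W"
    then show "pure x y \<in> lspan T ?Q"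
      by (intro pure_in_lspan[OF assms(1,2) Q, of x y] T.lspan_base[OF Q]) (use assms in auto)
  qed
  then show "carrier T \<subseteq> lspan T ?Q"
    unfolding carrier_lspan_pure by (intro T.lspan_subset Q)
qed

text \<open>The form is multiplicative on pure tensors, so products of basis vectors are
  orthonormal. Injectivity follows: equal tensors of basis vectors have inner product 1, which
  forces equal factors. It is recorded because functions on this basis are later prescribed in terms
  of the pair of factors.\<close>

lemma onb_pure:
  assumes "onb V E" "onb W F"
  shows "onb T {pure e f |e f. e \<in> E \<and> f \<in> F}" "inj_on (\<lambda>(e, f). pure e f) (E \<times> F)"
proof -
  have E: "finite E" "E \<subseteq> carrier V" and F: "finite F" "F \<subseteq> carrier W"
    using assms by (auto simp: onb_def orthonormal_def)
  have ip: "iprod T (pure e f) (pure e' f') = (if e = e' \<and> f = f' then 1 else 0)"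
    if "e \<in> E" "e' \<in> E" "f \<in> F" "f' \<in> F" for e e' f f'
  proof -
    have "e \<in> carrier V" "e' \<in> carrier V" "f \<in> carrier W" "f' \<in> carrier W"
      using that E F by auto
    then show ?thesis
      using assms that by (simp add: inner_pure onb_def orthonormal_def)
  qed
  show inj: "inj_on (\<lambda>(e, f). pure e f) (E \<times> F)"
  proof (rule inj_onI, clarify)
    fix e f e' f' assume *: "e \<in> E" "e' \<in> E" "f \<in> F" "f' \<in> F" "pure e f = pure e' f'"
    show "e = e' \<and> f = f'"
      using ip[of e e' f f'] ip[of e e f f] * by (auto split: if_splits)
  qed
  have eq: "{pure e f |e f. e \<in> E \<and> f \<in> F} = (\<lambda>(e, f). pure e f) ` (E \<times> F)" by auto
  have "finite {pure e f |e f. e \<in> E \<and> f \<in> F}"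
    unfolding eq using E F by simp
  moreover have "pure e f = pure e' f' \<longleftrightarrow> e = e' \<and> f = f'"
    if "e \<in> E" "e' \<in> E" "f \<in> F" "f' \<in> F" for e e' f f'
    using inj that by (auto simp: inj_on_def)
  ultimately show "onb T {pure e f |e f. e \<in> E \<and> f \<in> F}"
    using tensor_gens[OF E(2) F(2)] assms E F
    by (auto simp: onb_def orthonormal_def ip intro!: pure_closed)
qed

end

section \<open>Homogeneous orthonormal bases\<close>

text \<open>The degree function \<open>d\<close> turns scalars indexed by \<open>K\<close> into
  scalars indexed by basis vectors.\<close>

definition homog_onb ::
    "('g, 'k, 'c) twisted_monoid_scheme \<Rightarrow> ('g, 'k, 'v) bun \<Rightarrow> 'v set \<Rightarrow> ('v \<Rightarrow> 'k) \<Rightarrow> bool" where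
  "homog_onb K H B d \<longleftrightarrow> onb H B \<and> (\<forall>b\<in>B. d b \<in> carrier K \<and> b \<in> homog H (d b))"

section \<open>Homogeneous components and graded Gram-Schmidt\<close>

context equivariant_bundle
begin

sublocale pre: pre_hilbert H
  by (rule pre_hilbert)

lemma homog_carrier: "k \<in> carrier K \<Longrightarrow> homog H k \<subseteq> carrier H"
  using submoduleE(1)[OF homog_submodule] .

lemma lspan_homog: "k \<in> carrier K \<Longrightarrow> lspan H (homog H k) = homog H k"
  by (intro pre.lspan_submodule homog_submodule)

lemma zero_homog: "k \<in> carrier K \<Longrightarrow> \<zero> \<in> homog H k"
  using lspan.zero lspan_homog by metis

lemma smult_homog: "\<lbrakk>k \<in> carrier K; x \<in> homog H k\<rbrakk> \<Longrightarrow> c \<odot> x \<in> homog H k"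
  using pre.lspan_smult[OF homog_carrier, of k x c] by (simp add: lspan_homog)

lemma add_homog: "\<lbrakk>k \<in> carrier K; x \<in> homog H k; y \<in> homog H k\<rbrakk> \<Longrightarrow> x \<oplus> y \<in> homog H k"
  using pre.lspan_add[OF homog_carrier, of k x y] by (simp add: lspan_homog)

lemma finsum_homog:
  "\<lbrakk>k \<in> carrier K; finite A; f \<in> A \<rightarrow> homog H k\<rbrakk> \<Longrightarrow> (\<Oplus>a\<in>A. f a) \<in> homog H k"
  using pre.lspan_finsum[OF homog_carrier, of k A f] by (simp add: lspan_homog)

lemma homog_finite_support:
  assumes "x \<in> carrier H"
  obtains S where "finite S" "S \<subseteq> (\<Union>k\<in>carrier K. homog H k)" "x \<in> lspan H S"
proof -
  obtain F h where F: "finite F" "F \<subseteq> carrier K" "\<forall>k\<in>F. h k \<in> homog H k" "x = (\<Oplus>k\<in>F. h k)"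
    using homog_sum[OF assms] by blast
  have "h ` F \<subseteq> carrier H" using F homog_carrier by blast
  then have "x \<in> lspan H (h ` F)"
    unfolding F(4) by (intro pre.lspan_finsum F(1)) (auto intro: pre.lspan_base)
  with F show thesis by (intro that[of "h ` F"]) auto
qed

lemma carrier_lspan_homog: "lspan H (\<Union>k\<in>carrier K. homog H k) = carrier H"
proof
  show "lspan H (\<Union>k\<in>carrier K. homog H k) \<subseteq> carrier H"
    using homog_carrier by (intro pre.lspan_carrier) blast
  show "carrier H \<subseteq> lspan H (\<Union>k\<in>carrier K. homog H k)"
  proof
    fix x assume "x \<in> carrier H"
    then obtain S where "S \<subseteq> (\<Union>k\<in>carrier K. homog H k)" "x \<in> lspan H S"
      using homog_finite_support by metis
    then show "x \<in> lspan H (\<Union>k\<in>carrier K. homog H k)" using lspan_mono by blast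
  qed
qed

text \<open>Orthogonalisation respects degrees: \<open>h\<close> is orthogonal to all basis vectors
  of other degrees, so its projection \<open>u\<close> and the remainder \<open>r\<close> both lie
  in degree \<open>k\<close>.\<close>

lemma gram_schmidt_step:
  assumes "orthonormal H B" "B \<subseteq> (\<Union>k\<in>carrier K. homog H k)" "k \<in> carrier K" "h \<in> homog H k"
  obtains B' where "orthonormal H B'" "B' \<subseteq> (\<Union>k\<in>carrier K. homog H k)"
    "lspan H B \<subseteq> lspan H B'" "h \<in> lspan H B'"
proof -
  have B: "finite B" "B \<subseteq> carrier H"
    and ip: "\<And>b b'. \<lbrakk>b \<in> B; b' \<in> B\<rbrakk> \<Longrightarrow> iprod H b b' = (if b = b' then 1 else 0)"
    using assms(1) by (auto simp: orthonormal_def)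
  have h: "h \<in> carrier H" using assms homog_carrier by blast
  define u where "u = (\<Oplus>b\<in>B. iprod H h b \<odot> b)"
  have "iprod H h b \<odot> b \<in> homog H k" if b: "b \<in> B" for b
  proof -
    obtain l where l: "l \<in> carrier K" "b \<in> homog H l" using assms(2) b by blast
    show ?thesis
    proof (cases "l = k")
      case False
      then have "iprod H h b = 0" using homog_orthogonal assms l by metis
      then show ?thesis using B b by (auto simp: zero_homog assms)
    qed (use l assms in \<open>auto intro: smult_homog\<close>)
  qed
  then have u: "u \<in> homog H k"
    unfolding u_def using assms B by (intro finsum_homog) auto
  then have uc: "u \<in> carrier H" using homog_carrier assms by blast
  have uB: "u \<in> lspan H B"
    unfolding u_def using B
    by (intro pre.lspan_finsum) (auto intro: pre.lspan_smult pre.lspan_base)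
  define r where "r = h \<oplus> (-1) \<odot> u"
  have r: "r \<in> homog H k"
    unfolding r_def using u assms by (intro add_homog smult_homog)
  then have rc: "r \<in> carrier H" using homog_carrier assms by blast
  have hr: "h = u \<oplus> r"
    using h uc pre.add_neg_smult[OF uc]
    by (metis M.add.m_lcomm M.r_zero pre.smult_in_carrier r_def)
  have rb: "iprod H r b = 0" if b: "b \<in> B" for b
  proof -
    have bc: "b \<in> carrier H" using B b by blast
    have "iprod H u b = (\<Sum>b'\<in>B. iprod H h b' * iprod H b' b)"
      unfolding u_def using B bc
      by (subst pre.inner_finsum_left) (auto simp: inner_smult_left subset_iff intro!: sum.cong)
    also have "\<dots> = (\<Sum>b'\<in>B. if b' = b then iprod H h b else 0)"
      by (intro sum.cong) (auto simp: ip b)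
    also have "\<dots> = iprod H h b" using B b by simp
    finally show ?thesis
      using h uc bc by (simp add: r_def inner_add_left inner_smult_left)
  qed
  show thesis
  proof (cases "r = \<zero>")
    case True
    then have "h \<in> lspan H B" using hr uB uc by simp
    then show ?thesis using that assms by blast
  next
    case False
    define \<rho> where "\<rho> = Re (iprod H r r)"
    have \<rho>: "\<rho> > 0" using inner_pos rc False by (simp add: \<rho>_def)
    \<comment> \<open>Conjugate symmetry makes the squared norm real, hence equal to its real part
      \<open>\<rho>\<close>, which is positive by \<open>inner_pos\<close>.\<close>
    have "Im (iprod H r r) = 0"
      using inner_cnj[OF rc rc] by (simp add: complex_eq_iff)
    then have rr: "iprod H r r = complex_of_real \<rho>"
      by (simp add: complex_eq_iff \<rho>_def)
    \<comment> \<open>The normalising factor is real, so that \<open>c * cnj c * \<rho>\<close> is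
      1.\<close>
    define c where "c = complex_of_real (1 / sqrt \<rho>)"
    have c: "c \<noteq> 0" using \<rho> by (simp add: c_def)
    define e where "e = c \<odot> r"
    have e: "e \<in> homog H k" "e \<in> carrier H"
      using r rc assms by (auto simp: e_def intro: smult_homog)
    have "iprod H e e = c * cnj c * iprod H r r"
      using rc by (simp add: e_def inner_smult_left pre.inner_smult_right)
    also have "\<dots> = complex_of_real (1 / sqrt \<rho> * (1 / sqrt \<rho>) * \<rho>)"
      by (simp only: rr c_def complex_cnj_complex_of_real of_real_mult)
    also have "1 / sqrt \<rho> * (1 / sqrt \<rho>) * \<rho> = 1"
      using \<rho> by simp
    finally have ee: "iprod H e e = 1" by simp
    have eb: "iprod H e b = 0" "iprod H b e = 0" if "b \<in> B" for b
    proof -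
      have "b \<in> carrier H" using B that by blast
      then show "iprod H e b = 0" using rb[OF that] rc by (simp add: e_def inner_smult_left)
      then show "iprod H b e = 0" using inner_cnj[OF e(2) \<open>b \<in> carrier H\<close>] by simp
    qed
    have "e \<notin> B" using eb(1)[of e] ee by auto
    then have on: "orthonormal H (insert e B)"
      using B e ee eb ip by (auto simp: orthonormal_def)
    have sub: "insert e B \<subseteq> carrier H" using B e by simp
    have "r = inverse c \<odot> e" using c rc by (simp add: e_def pre.smult_smult)
    then have "h = u \<oplus> inverse c \<odot> e" using hr by simp
    moreover have "u \<in> lspan H (insert e B)" using uB lspan_mono[of B "insert e B" H] by auto
    ultimately have "h \<in> lspan H (insert e B)"
      using pre.lspan_add[OF sub] pre.lspan_smult[OF sub pre.lspan_base[OF sub, of e]] by simp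
    moreover have "lspan H B \<subseteq> lspan H (insert e B)" by (intro lspan_mono) auto
    ultimately show ?thesis
      using on assms e by (intro that[of "insert e B"]) auto
  qed
qed

lemma gram_schmidt:
  assumes "finite S" "S \<subseteq> (\<Union>k\<in>carrier K. homog H k)"
  shows "\<exists>B. orthonormal H B \<and> B \<subseteq> (\<Union>k\<in>carrier K. homog H k) \<and> S \<subseteq> lspan H B"
  using assms
proof (induction S)
  case empty
  show ?case by (intro exI[of _ "{}"]) (simp add: orthonormal_def)
next
  case (insert h S)
  then obtain B k where B: "orthonormal H B" "B \<subseteq> (\<Union>k\<in>carrier K. homog H k)" "S \<subseteq> lspan H B"
    and k: "k \<in> carrier K" "h \<in> homog H k" by auto
  obtain B' where "orthonormal H B'" "B' \<subseteq> (\<Union>k\<in>carrier K. homog H k)"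
    "lspan H B \<subseteq> lspan H B'" "h \<in> lspan H B'"
    using gram_schmidt_step[OF B(1,2) k] .
  with B show ?case by (intro exI[of _ B']) auto
qed

text \<open>Each member of a finite spanning set is a finite sum of homogeneous vectors. All these
  summands together form a finite homogeneous spanning set, to which Gram-Schmidt applies.\<close>

lemma homog_onb_exists:
  obtains B d where "homog_onb K H B d"
proof -
  obtain Y where Y: "finite Y" "Y \<subseteq> carrier H" "\<forall>x\<in>carrier H. \<exists>c. x = (\<Oplus>b\<in>Y. c b \<odot> b)"
    using finite_dim by blast
  have "\<forall>x\<in>Y. \<exists>S. finite S \<and> S \<subseteq> (\<Union>k\<in>carrier K. homog H k) \<and> x \<in> lspan H S"
    using homog_finite_support Y(2) by (metis subsetD)
  then obtain S where S: "\<And>x. x \<in> Y \<Longrightarrow> finite (S x)"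
    "\<And>x. x \<in> Y \<Longrightarrow> S x \<subseteq> (\<Union>k\<in>carrier K. homog H k)" "\<And>x. x \<in> Y \<Longrightarrow> x \<in> lspan H (S x)"
    by metis
  have "\<exists>B. orthonormal H B \<and> B \<subseteq> (\<Union>k\<in>carrier K. homog H k) \<and> (\<Union>x\<in>Y. S x) \<subseteq> lspan H B"
    using S Y by (intro gram_schmidt) auto
  then obtain B where B: "orthonormal H B" "B \<subseteq> (\<Union>k\<in>carrier K. homog H k)"
    "(\<Union>x\<in>Y. S x) \<subseteq> lspan H B" by blast
  have Bc: "B \<subseteq> carrier H" using B by (simp add: orthonormal_def)
  have YB: "Y \<subseteq> lspan H B"
  proof
    fix x assume x: "x \<in> Y"
    have "S x \<subseteq> lspan H B" using B(3) x by blast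
    then show "x \<in> lspan H B" using pre.lspan_subset[OF Bc] S(3)[OF x] by blast
  qed
  have "carrier H \<subseteq> lspan H B"
  proof
    fix x assume "x \<in> carrier H"
    then obtain c where "x = (\<Oplus>b\<in>Y. c b \<odot> b)" using Y by blast
    then show "x \<in> lspan H B"
      using YB Y(1) by (auto intro!: pre.lspan_finsum[OF Bc] pre.lspan_smult[OF Bc])
  qed
  then have "onb H B" using B pre.lspan_carrier[OF Bc] by (auto simp: onb_def)
  moreover obtain d where "\<forall>b\<in>B. d b \<in> carrier K \<and> b \<in> homog H (d b)"
  proof -
    have "\<forall>b\<in>B. \<exists>k. k \<in> carrier K \<and> b \<in> homog H k" using B(2) by blast
    from bchoice[OF this] show ?thesis using that by blast
  qed
  ultimately show thesis by (intro that[of B d]) (simp add: homog_onb_def)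
qed

text \<open>Coefficients at basis vectors of other degrees vanish, because different components are
  orthogonal. Hence a scalar depending on degrees is constant on the basis vectors that make up
  \<open>h\<close>.\<close>

lemma homog_onb_lspan:
  assumes "homog_onb K H B d" "k \<in> carrier K" "h \<in> homog H k"
  shows "h \<in> lspan H {b \<in> B. d b = k}"
proof -
  have B: "finite B" "B \<subseteq> carrier H" "onb H B" "\<And>b. b \<in> B \<Longrightarrow> d b \<in> carrier K"
    "\<And>b. b \<in> B \<Longrightarrow> b \<in> homog H (d b)"
    using assms(1) by (auto simp: homog_onb_def onb_def orthonormal_def)
  have sub: "{b \<in> B. d b = k} \<subseteq> carrier H" using B by auto
  have "h \<in> carrier H" using homog_carrier assms by blast
  then have "h = (\<Oplus>b\<in>B. iprod H h b \<odot> b)" by (rule pre.onb_expansion[OF B(3)])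
  also have "\<dots> \<in> lspan H {b \<in> B. d b = k}"
  proof (rule pre.lspan_finsum[OF sub B(1)], rule funcsetI)
    fix b assume b: "b \<in> B"
    show "iprod H h b \<odot> b \<in> lspan H {b \<in> B. d b = k}"
    proof (cases "d b = k")
      case True
      then show ?thesis using b by (intro pre.lspan_smult[OF sub] pre.lspan_base[OF sub]) simp
    next
      case False
      then have "iprod H h b = 0" using homog_orthogonal assms B b by metis
      then show ?thesis using b B by (auto simp: lspan.zero)
    qed
  qed
  finally show ?thesis .
qed

end

text \<open>The scalar \<open>c\<close> is an arbitrary function of the degrees; no cocycle
  condition enters at this stage. A basis vector has a recorded degree, so the desired value can be
  prescribed on the product basis and extended linearly.\<close>

lemma graded_bilinear_extension:
  assumes "equivariant_bundle G K V" "equivariant_bundle G K W" "tensor_product V W T"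
    and U: "pre_hilbert U" and u: "bilinear_map V W U u"
  obtains f where "f \<in> linear_maps T U"
    "\<And>x y h h'. \<lbrakk>x \<in> carrier K; y \<in> carrier K; h \<in> homog V x; h' \<in> homog W y\<rbrakk>
      \<Longrightarrow> f (pure_tensor V W h h') = c x y \<odot>\<^bsub>U\<^esub> u h h'"
proof -
  interpret V: equivariant_bundle G K V by fact
  interpret W: equivariant_bundle G K W by fact
  interpret tensor_product V W T by fact
  interpret U: pre_hilbert U by fact
  obtain E d where E: "homog_onb K V E d" by (rule V.homog_onb_exists)
  obtain F d' where F: "homog_onb K W F d'" by (rule W.homog_onb_exists)
  have E': "onb V E" "E \<subseteq> carrier V" and F': "onb W F" "F \<subseteq> carrier W"
    using E F by (auto simp: homog_onb_def onb_def orthonormal_def)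
  \<comment> \<open>The prescribed value depends on the pair of factors, whereas \<open>g\<close>
    receives only their tensor; injectivity on the product basis recovers the pair.\<close>
  define g where "g p = (case inv_into (E \<times> F) (\<lambda>(e, f). pure e f) p of
    (e, f) \<Rightarrow> c (d e) (d' f) \<odot>\<^bsub>U\<^esub> u e f)" for p
  have g: "g (pure e f) = c (d e) (d' f) \<odot>\<^bsub>U\<^esub> u e f" if "e \<in> E" "f \<in> F" for e f
    using inv_into_f_f[OF onb_pure(2)[OF E'(1) F'(1)], of "(e, f)"] that by (simp add: g_def)
  have "g \<in> {pure e f |e f. e \<in> E \<and> f \<in> F} \<rightarrow> carrier U"
  proof
    fix p assume "p \<in> {pure e f |e f. e \<in> E \<and> f \<in> F}"
    then obtain e f where "p = pure e f" "e \<in> E" "f \<in> F" by blast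
    then show "g p \<in> carrier U"
      using bilinear_mapD(3)[OF u, of e f] E' F' by (auto simp: g)
  qed
  from onb_extend_linear[OF T.pre_hilbert_axioms U onb_pure(1)[OF E'(1) F'(1)] this]
  obtain f where f: "f \<in> linear_maps T U" "\<forall>p\<in>{pure e f |e f. e \<in> E \<and> f \<in> F}. f p = g p"
    by blast
  have "f (pure h h') = c x y \<odot>\<^bsub>U\<^esub> u h h'"
    if "x \<in> carrier K" "y \<in> carrier K" "h \<in> homog V x" "h' \<in> homog W y" for x y h h'
  \<comment> \<open>For vectors of fixed degrees \<open>x\<close> and \<open>y\<close> the scalar
    \<open>c x y\<close> is constant, so both sides are bilinear and basis vectors of exactly these
    degrees suffice.\<close>
  proof (rule bilinear_map_eq_on_lspan[OF V.pre_hilbert W.pre_hilbert U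
        bilinear_map_comp[OF bilinear_pure linear_mapsD[OF f(1)]]
        bilinear_map_smult[OF U u] _ _ _
        V.homog_onb_lspan[OF E that(1,3)] W.homog_onb_lspan[OF F that(2,4)]])
    show "f (pure s s') = c x y \<odot>\<^bsub>U\<^esub> u s s'"
      if "s \<in> {b \<in> E. d b = x}" "s' \<in> {b \<in> F. d' b = y}" for s s'
    proof -
      have "pure s s' \<in> {pure e f |e f. e \<in> E \<and> f \<in> F}" using that by blast
      then have "f (pure s s') = g (pure s s')" using f(2) by blast
      then show ?thesis using that g[of s s'] by simp
    qed
  qed (use E' F' in auto)
  with f(1) show thesis by (rule that)
qed

text \<open>The space \<open>T\<close> and the threefold product \<open>p\<close> are left abstract,
  and the hypothesis \<open>basis\<close> holds for both ways of bracketing. One lemma thus yields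
  the associator and its inverse.\<close>

lemma graded_trilinear_extension:
  assumes "equivariant_bundle G K V" "equivariant_bundle G K W" "equivariant_bundle G K W'"
    and T: "pre_hilbert T" and U: "pre_hilbert U"
    and p: "trilinear_map V W W' T p" and u: "trilinear_map V W W' U u"
    and basis: "\<And>E F D. \<lbrakk>onb V E; onb W F; onb W' D\<rbrakk>
      \<Longrightarrow> onb T ((\<lambda>(e, f, d). p e f d) ` (E \<times> F \<times> D))
        \<and> inj_on (\<lambda>(e, f, d). p e f d) (E \<times> F \<times> D)"
  shows "\<exists>f\<in>linear_maps T U. \<forall>x\<in>carrier K. \<forall>y\<in>carrier K. \<forall>z\<in>carrier K.
    \<forall>h\<in>homog V x. \<forall>h'\<in>homog W y. \<forall>h''\<in>homog W' z.
      f (p h h' h'') = c x y z \<odot>\<^bsub>U\<^esub> u h h' h''"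
proof -
  interpret V: equivariant_bundle G K V by fact
  interpret W: equivariant_bundle G K W by fact
  interpret W': equivariant_bundle G K W' by fact
  interpret U: pre_hilbert U by fact
  obtain E d where E: "homog_onb K V E d" by (rule V.homog_onb_exists)
  obtain F d' where F: "homog_onb K W F d'" by (rule W.homog_onb_exists)
  obtain D d'' where D: "homog_onb K W' D d''" by (rule W'.homog_onb_exists)
  have E': "onb V E" "E \<subseteq> carrier V" and F': "onb W F" "F \<subseteq> carrier W"
    and D': "onb W' D" "D \<subseteq> carrier W'"
    using E F D by (auto simp: homog_onb_def onb_def orthonormal_def)
  note basis' = basis[OF E'(1) F'(1) D'(1)]
  define g where "g q = (case inv_into (E \<times> F \<times> D) (\<lambda>(e, f, d). p e f d) q of
    (e, f, b) \<Rightarrow> c (d e) (d' f) (d'' b) \<odot>\<^bsub>U\<^esub> u e f b)" for q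
  have g: "g (p e f b) = c (d e) (d' f) (d'' b) \<odot>\<^bsub>U\<^esub> u e f b"
    if "e \<in> E" "f \<in> F" "b \<in> D" for e f b
    using inv_into_f_f[OF conjunct2[OF basis'], of "(e, f, b)"] that by (simp add: g_def)
  have "g \<in> (\<lambda>(e, f, d). p e f d) ` (E \<times> F \<times> D) \<rightarrow> carrier U"
  proof
    fix q assume "q \<in> (\<lambda>(e, f, d). p e f d) ` (E \<times> F \<times> D)"
    then obtain e f b where "q = p e f b" "e \<in> E" "f \<in> F" "b \<in> D" by auto
    then show "g q \<in> carrier U"
      using trilinear_mapD(3)[OF u, of e f b] E' F' D' by (auto simp: g)
  qed
  from onb_extend_linear[OF T U conjunct1[OF basis'] this]
  obtain f where f: "f \<in> linear_maps T U"
    "\<forall>q\<in>(\<lambda>(e, f, d). p e f d) ` (E \<times> F \<times> D). f q = g q"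
    by blast
  have "f (p h h' h'') = c x y z \<odot>\<^bsub>U\<^esub> u h h' h''"
    if "x \<in> carrier K" "y \<in> carrier K" "z \<in> carrier K"
      "h \<in> homog V x" "h' \<in> homog W y" "h'' \<in> homog W' z" for x y z h h' h''
  proof (rule trilinear_map_eq_on_lspan[OF V.pre_hilbert W.pre_hilbert W'.pre_hilbert U
        trilinear_map_comp[OF p linear_mapsD[OF f(1)]] trilinear_map_smult[OF U u] _ _ _ _
        V.homog_onb_lspan[OF E that(1,4)] W.homog_onb_lspan[OF F that(2,5)]
        W'.homog_onb_lspan[OF D that(3,6)]])
    show "f (p s s' s'') = c x y z \<odot>\<^bsub>U\<^esub> u s s' s''"
      if "s \<in> {b \<in> E. d b = x}" "s' \<in> {b \<in> F. d' b = y}" "s'' \<in> {b \<in> D. d'' b = z}" for s s' s''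
      using that f(2) g[of s s' s''] by auto
  qed (use E' F' D' in auto)
  with f(1) show ?thesis by blast
qed

section \<open>Tensor products of bundles\<close>

text \<open>The freedom to take fewer vectors than whole components is used for iterated tensors,
  generated by pure tensors of pure tensors, and for the unit object, generated by the scalar
  1.\<close>

definition homog_gens ::
    "('g, 'k, 'c) twisted_monoid_scheme \<Rightarrow> ('g, 'k, 'v) bun \<Rightarrow> ('k \<Rightarrow> 'v set) \<Rightarrow> bool" where
  "homog_gens K A S \<longleftrightarrow> (\<forall>x\<in>carrier K. S x \<subseteq> carrier A \<and> lspan A (S x) = homog A x)"

definition pure_gens ::
    "('g, 'k, 'c) twisted_monoid_scheme \<Rightarrow> ('g, 'k, 'a tvec) bun \<Rightarrow> ('g, 'k, 'a tvec) bun
      \<Rightarrow> ('k \<Rightarrow> 'a tvec set) \<Rightarrow> ('k \<Rightarrow> 'a tvec set) \<Rightarrow> 'k \<Rightarrow> 'a tvec set" where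
  "pure_gens K A B S S' k = {pure_tensor A B s s' |s s' x y.
     x \<in> carrier K \<and> y \<in> carrier K \<and> x \<otimes>\<^bsub>K\<^esub> y = k \<and> s \<in> S x \<and> s' \<in> S' y}"

lemma pure_gensI:
  "\<lbrakk>x \<in> carrier K; y \<in> carrier K; x \<otimes>\<^bsub>K\<^esub> y = k; s \<in> S x; s' \<in> S' y\<rbrakk>
    \<Longrightarrow> pure_tensor A B s s' \<in> pure_gens K A B S S' k"
  by (auto simp: pure_gens_def)

lemma pure_gensE:
  assumes "p \<in> pure_gens K A B S S' k"
  obtains s s' x y where "p = pure_tensor A B s s'" "x \<in> carrier K" "y \<in> carrier K"
    "x \<otimes>\<^bsub>K\<^esub> y = k" "s \<in> S x" "s' \<in> S' y"
  using assms by (auto simp: pure_gens_def)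

lemma (in equivariant_bundle) homog_gens_homog: "homog_gens K H (homog H)"
  by (simp add: homog_gens_def homog_carrier lspan_homog)

lemma (in equivariant_bundle) homog_gens_carrier:
  assumes "homog_gens K H S"
  shows "lspan H (\<Union>x\<in>carrier K. S x) = carrier H"
proof
  have S: "(\<Union>x\<in>carrier K. S x) \<subseteq> carrier H" using assms by (auto simp: homog_gens_def)
  then show "lspan H (\<Union>x\<in>carrier K. S x) \<subseteq> carrier H" by (rule pre.lspan_carrier)
  have "homog H x \<subseteq> lspan H (\<Union>x\<in>carrier K. S x)" if "x \<in> carrier K" for x
    using assms that lspan_mono[of "S x" "\<Union>x\<in>carrier K. S x" H] by (auto simp: homog_gens_def)
  then show "carrier H \<subseteq> lspan H (\<Union>x\<in>carrier K. S x)"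
    unfolding carrier_lspan_homog[symmetric] by (intro pre.lspan_subset S) blast
qed

lemma bun_tensor_simps:
  "hilbert.truncate (bun_tensor K A B) = tensor_space A B"
  "homog (bun_tensor K A B) = tensor_homog K A B"
  "act (bun_tensor K A B) = tensor_act K A B"
  by (simp_all add: bun_tensor_def hilbert.defs bun.defs)

section \<open>Elementary facts about the action on \<open>K\<close> and the twists\<close>

context pseudomonoid
begin

lemma gact_closed [simp, intro]:
  "\<lbrakk>\<sigma> \<in> carrier G; x \<in> carrier K\<rbrakk> \<Longrightarrow> gact K \<sigma> x \<in> carrier K"
  using gact.element_image by blast

lemma gact_comp:
  "\<lbrakk>\<sigma> \<in> carrier G; \<tau> \<in> carrier G; x \<in> carrier K\<rbrakk> \<Longrightarrow> gact K (\<sigma> \<otimes> \<tau>) x = gact K \<sigma> (gact K \<tau> x)"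
  using gact.composition_rule by blast

lemma gact_one [simp]: "x \<in> carrier K \<Longrightarrow> gact K \<one> x = x"
  using gact.id_eq_one by (metis restrict_apply')

lemma gact_mult:
  "\<lbrakk>\<sigma> \<in> carrier G; x \<in> carrier K; y \<in> carrier K\<rbrakk>
    \<Longrightarrow> gact K \<sigma> (x \<otimes>\<^bsub>K\<^esub> y) = gact K \<sigma> x \<otimes>\<^bsub>K\<^esub> gact K \<sigma> y"
  using gact_aut by (simp add: iso_def hom_def)

lemma gact_image: "\<sigma> \<in> carrier G \<Longrightarrow> gact K \<sigma> ` carrier K = carrier K"
  using gact_aut by (simp add: iso_def bij_betw_def)

lemma twists_nonzero:
  "\<lbrakk>\<sigma> \<in> carrier G; \<tau> \<in> carrier G; x \<in> carrier K\<rbrakk> \<Longrightarrow> alpha K \<sigma> \<tau> x \<noteq> 0"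
  "\<lbrakk>\<sigma> \<in> carrier G; x \<in> carrier K; y \<in> carrier K\<rbrakk> \<Longrightarrow> beta K \<sigma> x y \<noteq> 0"
  "\<lbrakk>x \<in> carrier K; y \<in> carrier K; z \<in> carrier K\<rbrakk> \<Longrightarrow> theta K x y z \<noteq> 0"
  using alpha_circle beta_circle theta_circle by fastforce+

end

section \<open>Grading and action of a tensor product\<close>

locale bundle_pair = pseudomonoid G K + A: equivariant_bundle G K A + B: equivariant_bundle G K B
  for G :: "('g, 'b) monoid_scheme" (structure)
    and K :: "('g, 'k, 'c) twisted_monoid_scheme"
    and A :: "('g, 'k, 'a tvec) bun"
    and B :: "('g, 'k, 'a tvec) bun"
begin

abbreviation AB :: "('g, 'k, 'a tvec) bun" where
  "AB \<equiv> bun_tensor K A B"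

sublocale tensor_product A B "bun_tensor K A B"
  by unfold_locales (simp add: bun_tensor_simps)

lemma pure_gens_carrier:
  assumes "homog_gens K A S" "homog_gens K B S'"
  shows "pure_gens K A B S S' k \<subseteq> carrier AB"
  using assms by (fastforce simp: pure_gens_def homog_gens_def intro!: pure_closed)

text \<open>A list of homogeneous pairs carries no coefficients, yet the classes of such lists form
  a span: a coefficient is absorbed into the first factor, which stays in its degree.\<close>

lemma homog_tensor:
  "homog AB k = lspan AB (pure_gens K A B (homog A) (homog B) k)" (is "_ = lspan AB ?Q")
proof
  have Q: "?Q \<subseteq> carrier AB"
    by (intro pure_gens_carrier A.homog_gens_homog B.homog_gens_homog)
  define good where "good = (\<lambda>(h, h'). \<exists>x\<in>carrier K. \<exists>y\<in>carrier K.
    x \<otimes>\<^bsub>K\<^esub> y = k \<and> h \<in> homog A x \<and> h' \<in> homog B y)"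
  have good_valid: "p \<in> carrier A \<times> carrier B" if "good p" for p
    using that A.homog_carrier B.homog_carrier by (auto simp: good_def)
  have homog: "homog AB k = {cls s |s. \<forall>p\<in>set s. good p}"
    by (simp add: bun_tensor_simps tensor_homog_def good_def)
  show "homog AB k \<subseteq> lspan AB ?Q"
  proof
    fix p assume "p \<in> homog AB k"
    then obtain s where "\<forall>p\<in>set s. good p" "p = cls s" unfolding homog by blast
    then show "p \<in> lspan AB ?Q"
    proof (induction s arbitrary: p)
      case Nil
      then show ?case using lspan.zero[of AB ?Q] by (simp add: T_simps(2))
    next
      case (Cons a s)
      obtain h h' where a: "a = (h, h')" by fastforce
      have "h \<in> carrier A" "h' \<in> carrier B" "valid s"
        using Cons.prems good_valid unfolding a by auto
      then have "p = pure h h' \<oplus>\<^bsub>AB\<^esub> cls s" using Cons.prems a by (simp add: cls_Cons)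
      moreover have "pure h h' \<in> ?Q" using Cons.prems(1) unfolding a by (auto simp: good_def pure_gens_def)
      ultimately show ?case using Cons T.lspan_base[OF Q] by (auto intro!: T.lspan_add[OF Q])
    qed
  qed
  show "lspan AB ?Q \<subseteq> homog AB k"
  proof
    fix p assume "p \<in> lspan AB ?Q"
    then show "p \<in> homog AB k"
    proof (induction rule: lspan.induct)
      case zero
      show ?case unfolding homog T_simps(2) by (rule CollectI, rule exI[of _ "[]"]) simp
    next
      case (add_smult p q c)
      obtain s where s: "\<forall>p\<in>set s. good p" "p = cls s" using add_smult unfolding homog by blast
      obtain h h' x y where q: "q = pure h h'" "x \<in> carrier K" "y \<in> carrier K"
        "x \<otimes>\<^bsub>K\<^esub> y = k" "h \<in> homog A x" "h' \<in> homog B y"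
        using add_smult(2) by (rule pure_gensE)
      have g: "good (c \<odot>\<^bsub>A\<^esub> h, h')" using q(2-6) A.smult_homog[OF q(2,5)] unfolding good_def prod.case by blast
      have "h \<in> carrier A" "h' \<in> carrier B" using q A.homog_carrier B.homog_carrier by auto
      then have "c \<odot>\<^bsub>AB\<^esub> q = cls [(c \<odot>\<^bsub>A\<^esub> h, h')]"
        unfolding q by (simp add: pure_tensor_def smult_cls)
      moreover have "valid s" "valid [(c \<odot>\<^bsub>A\<^esub> h, h')]" using s g good_valid by auto
      ultimately have "p \<oplus>\<^bsub>AB\<^esub> c \<odot>\<^bsub>AB\<^esub> q = cls (s @ [(c \<odot>\<^bsub>A\<^esub> h, h')])"
        using s by (simp add: add_cls)
      moreover have "\<forall>p\<in>set (s @ [(c \<odot>\<^bsub>A\<^esub> h, h')]). good p" using s g by simp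
      ultimately show ?case unfolding homog by blast
    qed
  qed
qed

text \<open>Expanding both factors over their generators puts every homogeneous pure tensor into the
  span. Iterated, this provides generators of nested tensor products.\<close>

lemma homog_gens_pure_gens:
  assumes "homog_gens K A S" "homog_gens K B S'"
  shows "homog_gens K AB (pure_gens K A B S S')"
  unfolding homog_gens_def
proof (intro ballI conjI)
  fix k assume k: "k \<in> carrier K"
  let ?Q = "pure_gens K A B S S' k" and ?Q' = "pure_gens K A B (homog A) (homog B) k"
  show Q: "?Q \<subseteq> carrier AB" using assms by (rule pure_gens_carrier)
  have Q': "?Q' \<subseteq> carrier AB"
    by (intro pure_gens_carrier A.homog_gens_homog B.homog_gens_homog)
  show "lspan AB ?Q = homog AB k"
  proof
    have "S x \<subseteq> homog A x" "S' x \<subseteq> homog B x" if "x \<in> carrier K" for x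
      using assms that A.pre.lspan_base[of "S x"] B.pre.lspan_base[of "S' x"]
      by (auto simp: homog_gens_def)
    then have "?Q \<subseteq> ?Q'" unfolding pure_gens_def by blast
    then show "lspan AB ?Q \<subseteq> homog AB k" unfolding homog_tensor by (rule lspan_mono)
    have "?Q' \<subseteq> lspan AB ?Q"
    proof
      fix p assume "p \<in> ?Q'"
      then obtain h h' x y where p: "p = pure h h'" and xy: "x \<in> carrier K" "y \<in> carrier K"
        "x \<otimes>\<^bsub>K\<^esub> y = k" "h \<in> homog A x" "h' \<in> homog B y"
        by (rule pure_gensE)
      show "p \<in> lspan AB ?Q"
        unfolding p
      proof (rule pure_in_lspan[OF _ _ Q])
        show "pure s s' \<in> lspan AB ?Q" if "s \<in> S x" "s' \<in> S' y" for s s'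
          using that xy by (intro T.lspan_base[OF Q] pure_gensI)
      qed (use assms xy in \<open>auto simp: homog_gens_def\<close>)
    qed
    then show "homog AB k \<subseteq> lspan AB ?Q" unfolding homog_tensor by (rule T.lspan_subset[OF Q])
  qed
qed

lemma carrier_lspan_homog_pure:
  "lspan AB (\<Union>k\<in>carrier K. pure_gens K A B (homog A) (homog B) k) = carrier AB"
proof -
  have "{pure s s' |s s'. s \<in> (\<Union>x\<in>carrier K. homog A x) \<and> s' \<in> (\<Union>x\<in>carrier K. homog B x)}
      = (\<Union>k\<in>carrier K. pure_gens K A B (homog A) (homog B) k)"
    unfolding pure_gens_def using K.m_closed by blast
  then show ?thesis
    using tensor_gens[of "\<Union>x\<in>carrier K. homog A x" "\<Union>x\<in>carrier K. homog B x"]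
      A.homog_carrier B.homog_carrier A.carrier_lspan_homog B.carrier_lspan_homog
    by (auto simp: UN_subset_iff)
qed

text \<open>The action is described over \<open>tensor_space\<close>, because the bundle of which it
  is a field does not exist yet at that point. The fields that enter linearity agree.\<close>

lemma linear_maps_tensor_space:
  "linear_maps (tensor_space A B) (tensor_space A B) = linear_maps AB AB"
  "c \<odot>\<^bsub>tensor_space A B\<^esub> p = c \<odot>\<^bsub>AB\<^esub> p"
proof -
  have "carrier (tensor_space A B) = carrier AB" "ring.add (tensor_space A B) = ring.add AB"
    "module.smult (tensor_space A B) = module.smult AB"
    unfolding bun_tensor_simps(1)[of K, symmetric] by (simp_all add: hilbert.truncate_def)
  then show "linear_maps (tensor_space A B) (tensor_space A B) = linear_maps AB AB"
    "c \<odot>\<^bsub>tensor_space A B\<^esub> p = c \<odot>\<^bsub>AB\<^esub> p"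
    by (simp_all add: linear_maps_def linear_map_def)
qed

text \<open>Discharges the definite description: existence is the graded extension with scalar
  \<open>beta K \<sigma>\<close>, and uniqueness holds because homogeneous pure tensors
  span.\<close>

lemma tensor_act:
  assumes \<sigma>: "\<sigma> \<in> carrier G"
  shows "act AB \<sigma> \<in> linear_maps AB AB"
    and "\<lbrakk>x \<in> carrier K; y \<in> carrier K; h \<in> homog A x; h' \<in> homog B y\<rbrakk>
      \<Longrightarrow> act AB \<sigma> (pure h h') = beta K \<sigma> x y \<odot>\<^bsub>AB\<^esub> pure (act A \<sigma> h) (act B \<sigma> h')"
proof -
  define P where "P f \<longleftrightarrow> f \<in> linear_maps AB AB \<and>
    (\<forall>x \<in> carrier K. \<forall>y \<in> carrier K. \<forall>h \<in> homog A x. \<forall>h' \<in> homog B y.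
      f (pure h h') = beta K \<sigma> x y \<odot>\<^bsub>AB\<^esub> pure (act A \<sigma> h) (act B \<sigma> h'))" for f
  have bil: "bilinear_map A B AB (\<lambda>h h'. pure (act A \<sigma> h) (act B \<sigma> h'))"
    using A.act_unitary[OF \<sigma>] B.act_unitary[OF \<sigma>]
    by (intro bilinear_map_precomp[OF bilinear_pure]) (auto simp: unitary_op_def)
  obtain f where "P f"
    using graded_bilinear_extension[OF A.equivariant_bundle_axioms B.equivariant_bundle_axioms
        tensor_product_axioms T.pre_hilbert_axioms bil, of "beta K \<sigma>"]
    unfolding P_def by metis
  moreover have "f = g" if f: "P f" and g: "P g" for f g
  proof (rule linear_maps_eqI[OF T.pre_hilbert_axioms T.pre_hilbert_axioms])
    show "carrier AB \<subseteq> lspan AB (\<Union>k\<in>carrier K. pure_gens K A B (homog A) (homog B) k)"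
      by (simp add: carrier_lspan_homog_pure)
    show "(\<Union>k\<in>carrier K. pure_gens K A B (homog A) (homog B) k) \<subseteq> carrier AB"
      using pure_gens_carrier[OF A.homog_gens_homog B.homog_gens_homog] by blast
    show "f s = g s" if "s \<in> (\<Union>k\<in>carrier K. pure_gens K A B (homog A) (homog B) k)" for s
      using that f g by (auto simp: P_def pure_gens_def)
  qed (use f g in \<open>auto simp: P_def\<close>)
  ultimately have "P (THE f. P f)" by (intro theI[of P f])
  moreover have "act AB \<sigma> = (THE f. P f)"
    unfolding bun_tensor_simps tensor_act_def P_def linear_maps_tensor_space ..
  ultimately have "P (act AB \<sigma>)" by simp
  then show "act AB \<sigma> \<in> linear_maps AB AB"
    "\<lbrakk>x \<in> carrier K; y \<in> carrier K; h \<in> homog A x; h' \<in> homog B y\<rbrakk>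
      \<Longrightarrow> act AB \<sigma> (pure h h') = beta K \<sigma> x y \<odot>\<^bsub>AB\<^esub> pure (act A \<sigma> h) (act B \<sigma> h')"
    by (auto simp: P_def)
qed

end

context equivariant_bundle
begin

lemma act_linear: "\<And>\<sigma>. \<sigma> \<in> carrier G \<Longrightarrow> linear_map H H (act H \<sigma>)"
  using act_unitary by (simp add: unitary_op_def)

lemma act_inner:
  "\<And>\<sigma>. \<lbrakk>\<sigma> \<in> carrier G; x \<in> carrier H; y \<in> carrier H\<rbrakk>
    \<Longrightarrow> iprod H (act H \<sigma> x) (act H \<sigma> y) = iprod H x y"
  using act_unitary by (simp add: unitary_op_def)

lemma act_in_homog:
  "\<And>\<sigma>. \<lbrakk>\<sigma> \<in> carrier G; k \<in> carrier K; h \<in> homog H k\<rbrakk> \<Longrightarrow> act H \<sigma> h \<in> homog H (gact K \<sigma> k)"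
  using act_homog by blast

lemma in_homog_carrier: "\<lbrakk>k \<in> carrier K; h \<in> homog H k\<rbrakk> \<Longrightarrow> h \<in> carrier H"
  using homog_carrier by blast

end

section \<open>The bundle axioms for a tensor product\<close>

context bundle_pair
begin

abbreviation Q :: "'k \<Rightarrow> 'a tvec set" where
  "Q \<equiv> pure_gens K A B (homog A) (homog B)"

lemma Q_carrier: "Q k \<subseteq> carrier AB"
  by (intro pure_gens_carrier A.homog_gens_homog B.homog_gens_homog)

lemma act_AB_linear: "\<sigma> \<in> carrier G \<Longrightarrow> linear_map AB AB (act AB \<sigma>)"
  by (intro linear_mapsD tensor_act)

lemma act_AB_image:
  assumes \<sigma>: "\<sigma> \<in> carrier G" and k: "k \<in> carrier K"
  shows "act AB \<sigma> ` homog AB k = homog AB (gact K \<sigma> k)"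
proof -
  note f = act_AB_linear[OF \<sigma>]
  have fQ: "act AB \<sigma> ` Q k \<subseteq> carrier AB"
    using linear_mapD(1)[OF f] Q_carrier by blast
  have "act AB \<sigma> ` homog AB k = lspan AB (act AB \<sigma> ` Q k)"
    unfolding homog_tensor
    by (intro linear_map_image_lspan T.pre_hilbert_axioms f Q_carrier)
  also have "\<dots> = lspan AB (Q (gact K \<sigma> k))"
  proof
    have "act AB \<sigma> ` Q k \<subseteq> lspan AB (Q (gact K \<sigma> k))"
    proof clarify
      fix p assume "p \<in> Q k"
      then obtain h h' x y where p: "p = pure h h'" "x \<in> carrier K" "y \<in> carrier K"
        "x \<otimes>\<^bsub>K\<^esub> y = k" "h \<in> homog A x" "h' \<in> homog B y" by (rule pure_gensE)
      have "pure (act A \<sigma> h) (act B \<sigma> h') \<in> Q (gact K \<sigma> k)"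
        using p \<sigma> by (intro pure_gensI[of "gact K \<sigma> x" _ "gact K \<sigma> y"] A.act_in_homog B.act_in_homog)
          (auto simp: gact_mult)
      then show "act AB \<sigma> p \<in> lspan AB (Q (gact K \<sigma> k))"
        unfolding p(1) tensor_act(2)[OF \<sigma> p(2,3,5,6)]
        by (intro T.lspan_smult[OF Q_carrier] T.lspan_base[OF Q_carrier])
    qed
    then show "lspan AB (act AB \<sigma> ` Q k) \<subseteq> lspan AB (Q (gact K \<sigma> k))"
      by (rule T.lspan_subset[OF Q_carrier])
    have "Q (gact K \<sigma> k) \<subseteq> lspan AB (act AB \<sigma> ` Q k)"
    proof
      fix p assume "p \<in> Q (gact K \<sigma> k)"
      then obtain h h' x y where p: "p = pure h h'" "x \<in> carrier K" "y \<in> carrier K"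
        "x \<otimes>\<^bsub>K\<^esub> y = gact K \<sigma> k" "h \<in> homog A x" "h' \<in> homog B y" by (rule pure_gensE)
      \<comment> \<open>Degrees are pulled back along \<open>inv \<sigma>\<close>; since it acts
        multiplicatively, the product of the new degrees is \<open>k\<close>.\<close>
      define x' y' where "x' = gact K (inv \<sigma>) x" and "y' = gact K (inv \<sigma>) y"
      have inv: "gact K \<sigma> (gact K (inv \<sigma>) z) = z" "gact K (inv \<sigma>) (gact K \<sigma> z) = z"
        if "z \<in> carrier K" for z
        using that \<sigma> by (simp_all flip: gact_comp)
      have xy: "x' \<in> carrier K" "y' \<in> carrier K" "gact K \<sigma> x' = x" "gact K \<sigma> y' = y"
        using p \<sigma> by (simp_all add: x'_def y'_def inv)
      have "x' \<otimes>\<^bsub>K\<^esub> y' = gact K (inv \<sigma>) (x \<otimes>\<^bsub>K\<^esub> y)"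
        using p(2,3) \<sigma> by (simp add: x'_def y'_def gact_mult)
      then have k': "x' \<otimes>\<^bsub>K\<^esub> y' = k" using p(4) inv k by simp
      \<comment> \<open>Preimages under the action of \<open>\<sigma>\<close> itself, supplied by
        \<open>act_homog\<close>; acting with \<open>inv \<sigma>\<close> instead would bring in a
        factor \<open>alpha\<close>.\<close>
      have "h \<in> act A \<sigma> ` homog A x'" "h' \<in> act B \<sigma> ` homog B y'"
        using p A.act_homog[OF \<sigma>] B.act_homog[OF \<sigma>] xy by auto
      then obtain g g' where g: "g \<in> homog A x'" "h = act A \<sigma> g" "g' \<in> homog B y'" "h' = act B \<sigma> g'"
        by blast
      \<comment> \<open>The image of a pure tensor carries a nonzero factor \<open>beta\<close>,
        which can be divided out inside a span.\<close>
      have "p = inverse (beta K \<sigma> x' y') \<odot>\<^bsub>AB\<^esub> act AB \<sigma> (pure g g')"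
        unfolding p(1) tensor_act(2)[OF \<sigma> xy(1,2) g(1,3)]
        using p(2,3,5,6) twists_nonzero(2)[OF \<sigma> xy(1,2)] A.in_homog_carrier B.in_homog_carrier
        by (subst T.smult_smult) (auto simp: g(2,4)[symmetric])
      moreover have "pure g g' \<in> Q k"
        using xy k' g by (intro pure_gensI)
      ultimately show "p \<in> lspan AB (act AB \<sigma> ` Q k)"
        by (simp add: T.lspan_smult[OF fQ T.lspan_base[OF fQ imageI]])
    qed
    then show "lspan AB (Q (gact K \<sigma> k)) \<subseteq> lspan AB (act AB \<sigma> ` Q k)"
      by (rule T.lspan_subset[OF fQ])
  qed
  finally show ?thesis unfolding homog_tensor .
qed

lemma fd_hilbert_AB: "fd_hilbert AB"
proof -
  obtain E d where "homog_onb K A E d" by (rule A.homog_onb_exists)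
  moreover obtain F d' where "homog_onb K B F d'" by (rule B.homog_onb_exists)
  ultimately show ?thesis
    using T.onb_fd_hilbert onb_pure(1) by (auto simp: homog_onb_def)
qed

lemma homog_AB_submodule: "submodule (homog AB k) complex_ring AB"
  unfolding homog_tensor by (rule T.submodule_lspan[OF Q_carrier])

text \<open>Isometry is tested on homogeneous pure tensors and surjectivity on whole components;
  injectivity then follows from isometry by definiteness.\<close>

lemma act_AB_unitary:
  assumes \<sigma>: "\<sigma> \<in> carrier G"
  shows "unitary_op AB (act AB \<sigma>)"
proof -
  note f = act_AB_linear[OF \<sigma>]
  let ?S = "\<Union>k\<in>carrier K. Q k"
  have S: "?S \<subseteq> carrier AB" using Q_carrier by blast
  have isom: "iprod AB (act AB \<sigma> p) (act AB \<sigma> q) = iprod AB p q"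
    if "p \<in> carrier AB" "q \<in> carrier AB" for p q
  proof (rule isometry_on_lspan[OF T.pre_hilbert_axioms T.pre_hilbert_axioms f S])
    fix s s' assume "s \<in> ?S" "s' \<in> ?S"
    then obtain h h' x y g g' z w where *: "s = pure h h'" "s' = pure g g'"
      "x \<in> carrier K" "y \<in> carrier K" "h \<in> homog A x" "h' \<in> homog B y"
      "z \<in> carrier K" "w \<in> carrier K" "g \<in> homog A z" "g' \<in> homog B w"
      by (auto simp: pure_gens_def)
    then have c: "h \<in> carrier A" "h' \<in> carrier B" "g \<in> carrier A" "g' \<in> carrier B"
      using A.in_homog_carrier B.in_homog_carrier by auto
    have c': "act A \<sigma> h \<in> carrier A" "act B \<sigma> h' \<in> carrier B"
      "act A \<sigma> g \<in> carrier A" "act B \<sigma> g' \<in> carrier B"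
      using c linear_mapD(1)[OF A.act_linear[OF \<sigma>]] linear_mapD(1)[OF B.act_linear[OF \<sigma>]] by auto
    have "iprod AB (act AB \<sigma> s) (act AB \<sigma> s')
        = beta K \<sigma> x y * cnj (beta K \<sigma> z w) * (iprod A h g * iprod B h' g')"
      using * c c' \<sigma>
      by (simp add: tensor_act T.inner_smult_left T.inner_smult_right inner_pure A.act_inner B.act_inner)
    \<comment> \<open>For equal degrees the two factors are conjugates of norm 1 and cancel. For
      different degrees they need not cancel, but orthogonality in one tensor factor makes both
      sides zero.\<close>
    also have "\<dots> = iprod A h g * iprod B h' g'"
    proof (cases "x = z \<and> y = w")
      case True
      have "beta K \<sigma> x y * cnj (beta K \<sigma> x y) = 1"
        using beta_circle[OF \<sigma> *(3,4)] by (simp add: complex_norm_square[symmetric])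
      then show ?thesis using True by simp
    next
      case False
      then have "iprod A h g = 0 \<or> iprod B h' g' = 0"
        using A.homog_orthogonal B.homog_orthogonal * by metis
      then show ?thesis by auto
    qed
    finally show "iprod AB (act AB \<sigma> s) (act AB \<sigma> s') = iprod AB s s'"
      using * c by (simp add: inner_pure)
  qed (use that in \<open>simp_all add: carrier_lspan_homog_pure\<close>)
  have sub: "(\<Union>k\<in>carrier K. homog AB k) \<subseteq> carrier AB"
    using T.lspan_carrier[OF Q_carrier] by (auto simp: homog_tensor)
  have gens: "lspan AB (\<Union>k\<in>carrier K. homog AB k) = carrier AB"
  proof
    show "lspan AB (\<Union>k\<in>carrier K. homog AB k) \<subseteq> carrier AB"
      using sub by (rule T.lspan_carrier)
    have "?S \<subseteq> (\<Union>k\<in>carrier K. homog AB k)"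
      using T.lspan_base[OF Q_carrier] by (auto simp: homog_tensor)
    then show "carrier AB \<subseteq> lspan AB (\<Union>k\<in>carrier K. homog AB k)"
      unfolding carrier_lspan_homog_pure[symmetric] by (rule lspan_mono)
  qed
  \<comment> \<open>The action carries components onto components while \<open>\<sigma>\<close>
    permutes the degrees, so the images of the components are again all the components.\<close>
  have "act AB \<sigma> ` carrier AB = lspan AB (act AB \<sigma> ` (\<Union>k\<in>carrier K. homog AB k))"
    unfolding gens[symmetric]
    by (intro linear_map_image_lspan T.pre_hilbert_axioms f sub)
  also have "act AB \<sigma> ` (\<Union>k\<in>carrier K. homog AB k) = (\<Union>k\<in>carrier K. homog AB (gact K \<sigma> k))"
    using act_AB_image[OF \<sigma>] by (simp add: image_UN)
  also have "\<dots> = (\<Union>k\<in>gact K \<sigma> ` carrier K. homog AB k)" by blast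
  also have "lspan AB \<dots> = carrier AB" using gens by (simp add: gact_image[OF \<sigma>])
  finally have "act AB \<sigma> ` carrier AB = carrier AB" .
  moreover have "inj_on (act AB \<sigma>) (carrier AB)"
    using isom by (intro isometry_inj[OF fd_hilbert_AB T.pre_hilbert_axioms f])
  ultimately show ?thesis using f isom by (simp add: unitary_op_def bij_betw_def)
qed

lemma act_AB_twisted:
  assumes "\<sigma> \<in> carrier G" "\<tau> \<in> carrier G" "k \<in> carrier K" "p \<in> homog AB k"
  shows "act AB \<sigma> (act AB \<tau> p) = alpha K \<sigma> \<tau> k \<odot>\<^bsub>AB\<^esub> act AB (\<sigma> \<otimes> \<tau>) p"
proof (rule linear_map_eq_on_lspan[OF T.pre_hilbert_axioms T.pre_hilbert_axioms _ _ Q_carrier[of k],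
      where f = "\<lambda>p. act AB \<sigma> (act AB \<tau> p)"])
  show "linear_map AB AB (\<lambda>p. act AB \<sigma> (act AB \<tau> p))"
    using assms by (intro linear_map_comp[OF act_AB_linear act_AB_linear])
  show "linear_map AB AB (\<lambda>p. alpha K \<sigma> \<tau> k \<odot>\<^bsub>AB\<^esub> act AB (\<sigma> \<otimes> \<tau>) p)"
    using assms by (intro linear_map_smult T.pre_hilbert_axioms act_AB_linear G.m_closed)
  show "p \<in> lspan AB (Q k)" using assms(4) by (simp add: homog_tensor)
  fix s assume "s \<in> Q k"
  then obtain h h' x y where s: "s = pure h h'" and x: "x \<in> carrier K" and y: "y \<in> carrier K"
    and k: "x \<otimes>\<^bsub>K\<^esub> y = k" and h: "h \<in> homog A x" and h': "h' \<in> homog B y" by (rule pure_gensE)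
  note \<sigma> = assms(1) and \<tau> = assms(2)
  have \<sigma>\<tau>: "\<sigma> \<otimes> \<tau> \<in> carrier G" using \<sigma> \<tau> by simp
  have \<tau>h: "act A \<tau> h \<in> homog A (gact K \<tau> x)" "act B \<tau> h' \<in> homog B (gact K \<tau> y)"
    using \<tau> x y h h' by (auto intro: A.act_in_homog B.act_in_homog)
  have c: "act A (\<sigma> \<otimes> \<tau>) h \<in> carrier A" "act B (\<sigma> \<otimes> \<tau>) h' \<in> carrier B"
    using x y h h' A.in_homog_carrier B.in_homog_carrier
      linear_mapD(1)[OF A.act_linear[OF \<sigma>\<tau>]] linear_mapD(1)[OF B.act_linear[OF \<sigma>\<tau>]] by auto
  have c\<tau>: "pure (act A \<tau> h) (act B \<tau> h') \<in> carrier AB"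
    using \<tau> x y by (intro pure_closed A.in_homog_carrier[OF _ \<tau>h(1)] B.in_homog_carrier[OF _ \<tau>h(2)]) auto
  \<comment> \<open>Both sides turn out to be multiples of \<open>q\<close>, which reduces the
    twisted action law to an equation between scalars.\<close>
  define q where "q = pure (act A (\<sigma> \<otimes> \<tau>) h) (act B (\<sigma> \<otimes> \<tau>) h')"
  have q: "q \<in> carrier AB" using c by (simp add: q_def)
  have "act AB \<sigma> (act AB \<tau> s) = beta K \<tau> x y \<odot>\<^bsub>AB\<^esub> act AB \<sigma> (pure (act A \<tau> h) (act B \<tau> h'))"
    unfolding s tensor_act(2)[OF \<tau> x y h h'] using linear_mapD(3)[OF act_AB_linear[OF \<sigma>] c\<tau>] .
  also have "act AB \<sigma> (pure (act A \<tau> h) (act B \<tau> h'))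
      = beta K \<sigma> (gact K \<tau> x) (gact K \<tau> y) \<odot>\<^bsub>AB\<^esub> pure (act A \<sigma> (act A \<tau> h)) (act B \<sigma> (act B \<tau> h'))"
    using \<tau>h \<sigma> \<tau> x y by (intro tensor_act) auto
  also have "pure (act A \<sigma> (act A \<tau> h)) (act B \<sigma> (act B \<tau> h')) = (alpha K \<sigma> \<tau> x * alpha K \<sigma> \<tau> y) \<odot>\<^bsub>AB\<^esub> q"
    unfolding A.act_twisted[OF \<sigma> \<tau> x h] B.act_twisted[OF \<sigma> \<tau> y h']
    using c by (simp add: q_def pure_smult_left pure_smult_right T.smult_smult mult.commute)
  finally have lhs: "act AB \<sigma> (act AB \<tau> s)
      = (beta K \<tau> x y * beta K \<sigma> (gact K \<tau> x) (gact K \<tau> y) * alpha K \<sigma> \<tau> x * alpha K \<sigma> \<tau> y) \<odot>\<^bsub>AB\<^esub> q"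
    using q by (simp add: T.smult_smult mult.assoc)
  have rhs: "alpha K \<sigma> \<tau> k \<odot>\<^bsub>AB\<^esub> act AB (\<sigma> \<otimes> \<tau>) s = (alpha K \<sigma> \<tau> k * beta K (\<sigma> \<otimes> \<tau>) x y) \<odot>\<^bsub>AB\<^esub> q"
    unfolding s tensor_act(2)[OF \<sigma>\<tau> x y h h'] using q by (simp add: q_def T.smult_smult)
  \<comment> \<open>This is \<open>beta_alpha\<close> with denominators cleared; the twists are
    nonzero because they have norm 1.\<close>
  have "beta K \<tau> x y * beta K \<sigma> (gact K \<tau> x) (gact K \<tau> y) * alpha K \<sigma> \<tau> x * alpha K \<sigma> \<tau> y
      = alpha K \<sigma> \<tau> k * beta K (\<sigma> \<otimes> \<tau>) x y"
    using beta_alpha[OF \<sigma> \<tau> x y] twists_nonzero(1)[OF \<sigma> \<tau> x] twists_nonzero(1)[OF \<sigma> \<tau> y]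
      twists_nonzero(2)[OF \<sigma>\<tau> x y]
    unfolding k by (simp add: field_simps)
  then show "act AB \<sigma> (act AB \<tau> s) = alpha K \<sigma> \<tau> k \<odot>\<^bsub>AB\<^esub> act AB (\<sigma> \<otimes> \<tau>) s"
    unfolding lhs rhs by simp
qed

lemma act_AB_one:
  assumes "p \<in> carrier AB"
  shows "act AB \<one> p = p"
proof (rule linear_map_eq_on_lspan[OF T.pre_hilbert_axioms T.pre_hilbert_axioms act_AB_linear,
      where g = "\<lambda>p. p"])
  show "linear_map AB AB (\<lambda>p. p)" by (simp add: linear_map_def)
  show "p \<in> lspan AB (\<Union>k\<in>carrier K. Q k)" using assms by (simp add: carrier_lspan_homog_pure)
  show "(\<Union>k\<in>carrier K. Q k) \<subseteq> carrier AB" using Q_carrier by blast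
  fix s assume "s \<in> (\<Union>k\<in>carrier K. Q k)"
  then obtain h h' x y where s: "s = pure h h'" "x \<in> carrier K" "y \<in> carrier K"
    "h \<in> homog A x" "h' \<in> homog B y"
    by (auto simp: pure_gens_def)
  then show "act AB \<one> s = s"
    using A.in_homog_carrier B.in_homog_carrier
    by (simp add: tensor_act(2) beta_normalized A.act_one B.act_one)
qed simp

lemma bundle_AB: "equivariant_bundle G K AB"
proof (intro equivariant_bundle.intro equivariant_bundle_axioms.intro)
  show "fd_hilbert AB" by (rule fd_hilbert_AB)
  show "submodule (homog AB k) complex_ring AB" for k by (rule homog_AB_submodule)
  show "act AB \<sigma> ` homog AB k = homog AB (gact K \<sigma> k)"
    if "\<sigma> \<in> carrier G" "k \<in> carrier K" for \<sigma> k using that by (rule act_AB_image)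
  show "unitary_op AB (act AB \<sigma>)" if "\<sigma> \<in> carrier G" for \<sigma> using that by (rule act_AB_unitary)
  show "act AB \<one> p = p" if "p \<in> carrier AB" for p using that by (rule act_AB_one)
  show "act AB \<sigma> (act AB \<tau> p) = alpha K \<sigma> \<tau> k \<odot>\<^bsub>AB\<^esub> act AB (\<sigma> \<otimes> \<tau>) p"
    if "\<sigma> \<in> carrier G" "\<tau> \<in> carrier G" "k \<in> carrier K" "p \<in> homog AB k" for \<sigma> \<tau> k p
    using that by (rule act_AB_twisted)
  show "\<exists>F h. finite F \<and> F \<subseteq> carrier K \<and> (\<forall>k\<in>F. h k \<in> homog AB k) \<and> p = finsum AB h F"
    if p: "p \<in> carrier AB" for p
  \<comment> \<open>The components span because they contain the homogeneous pure tensors; the sum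
    over degrees is then assembled from the span.\<close>
  proof (rule T.lspan_UN_submodules[OF homog_AB_submodule])
    have "(\<Union>k\<in>carrier K. Q k) \<subseteq> (\<Union>k\<in>carrier K. homog AB k)"
      using T.lspan_base[OF Q_carrier] by (auto simp: homog_tensor)
    then show "p \<in> lspan AB (\<Union>k\<in>carrier K. homog AB k)"
      using p lspan_mono unfolding carrier_lspan_homog_pure[symmetric] by blast
  qed
  show "iprod AB p q = 0"
    if "k \<in> carrier K" "l \<in> carrier K" "k \<noteq> l" "p \<in> homog AB k" "q \<in> homog AB l" for k l p q
  proof (rule T.inner_lspan_zero[OF Q_carrier[of k] Q_carrier[of l]])
    show "p \<in> lspan AB (Q k)" "q \<in> lspan AB (Q l)" using that by (simp_all add: homog_tensor)
    fix s s' assume s: "s \<in> Q k" and s': "s' \<in> Q l"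
    obtain h h' x y where 1: "s = pure h h'" "x \<in> carrier K" "y \<in> carrier K"
      "x \<otimes>\<^bsub>K\<^esub> y = k" "h \<in> homog A x" "h' \<in> homog B y" using s by (rule pure_gensE)
    obtain g g' z w where 2: "s' = pure g g'" "z \<in> carrier K" "w \<in> carrier K"
      "z \<otimes>\<^bsub>K\<^esub> w = l" "g \<in> homog A z" "g' \<in> homog B w" using s' by (rule pure_gensE)
    \<comment> \<open>Different products require a mismatch in some factor, and a mismatch in one
      factor already kills the inner product.\<close>
    have "x \<noteq> z \<or> y \<noteq> w" using 1 2 \<open>k \<noteq> l\<close> by auto
    then have "iprod A h g = 0 \<or> iprod B h' g' = 0"
      using A.homog_orthogonal B.homog_orthogonal 1 2 by metis
    then show "iprod AB s s' = 0"
      using 1 2 A.in_homog_carrier B.in_homog_carrier by (auto simp: inner_pure)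
  qed
qed

end

section \<open>Arrows\<close>

lemma linear_maps_compose:
  "\<lbrakk>f \<in> linear_maps V W; g \<in> linear_maps W U; pre_hilbert V\<rbrakk>
    \<Longrightarrow> compose (carrier V) g f \<in> linear_maps V U"
  unfolding compose_def
  by (intro restrict_linear_maps linear_map_comp[of V W f U g] linear_mapsD)

lemma bun_homE:
  assumes "F \<in> bun_hom G K A B"
  obtains f where "F = (A, f, B)" "f \<in> linear_maps A B" "linear_map A B f"
    "\<And>k h. \<lbrakk>k \<in> carrier K; h \<in> homog A k\<rbrakk> \<Longrightarrow> f h \<in> homog B k"
    "\<And>\<sigma> h. \<lbrakk>\<sigma> \<in> carrier G; h \<in> carrier A\<rbrakk> \<Longrightarrow> f (act A \<sigma> h) = act B \<sigma> (f h)"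
  using assms unfolding bun_hom_def by (auto simp: linear_mapsD image_subset_iff)

lemma bun_hom_arrD:
  assumes "(A, f, B) \<in> bun_hom G K A' B'"
  shows "f \<in> linear_maps A B" "linear_map A B f"
    "\<And>k h. \<lbrakk>k \<in> carrier K; h \<in> homog A k\<rbrakk> \<Longrightarrow> f h \<in> homog B k"
    "\<And>\<sigma> h. \<lbrakk>\<sigma> \<in> carrier G; h \<in> carrier A\<rbrakk> \<Longrightarrow> f (act A \<sigma> h) = act B \<sigma> (f h)"
  using assms unfolding bun_hom_def by (auto simp: linear_mapsD image_subset_iff)

section \<open>Arrows tested on generators; tensor products of arrows\<close>

context pseudomonoid
begin

abbreviation is_bun :: "('g, 'k, 'v) bun \<Rightarrow> bool" where
  "is_bun \<equiv> equivariant_bundle G K"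

abbreviation tens ::
    "('g, 'k, 'a tvec) bun \<Rightarrow> ('g, 'k, 'a tvec) bun \<Rightarrow> ('g, 'k, 'a tvec) bun"  (infixr \<open>\<boxtimes>\<close> 70) where
  "A \<boxtimes> B \<equiv> bun_tensor K A B"

abbreviation hom_map :: "('g, 'k, 'a tvec) bun \<Rightarrow> ('g, 'k, 'a tvec) bun \<Rightarrow> ('a tvec \<Rightarrow> 'a tvec) \<Rightarrow> bool" where
  "hom_map A B f \<equiv> (A, f, B) \<in> bun_hom G K A B"

lemma bundle_pre_hilbert: "is_bun A \<Longrightarrow> pre_hilbert A"
  by (intro fd_hilbert.pre_hilbert equivariant_bundle.axioms(1))

lemma bundle_pairI: "\<lbrakk>is_bun A; is_bun B\<rbrakk> \<Longrightarrow> bundle_pair G K A B"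
  by (intro bundle_pair.intro pseudomonoid_axioms)

lemma bundle_tens: "\<lbrakk>is_bun A; is_bun B\<rbrakk> \<Longrightarrow> is_bun (A \<boxtimes> B)"
  using bundle_pair.bundle_AB[OF bundle_pairI] .

lemma tensor_productI: "\<lbrakk>is_bun A; is_bun B\<rbrakk> \<Longrightarrow> tensor_product A B (A \<boxtimes> B)"
  by (intro tensor_product.intro tensor_product_axioms.intro bundle_pre_hilbert bun_tensor_simps)

lemma bilinear_tens: "\<lbrakk>is_bun A; is_bun B\<rbrakk> \<Longrightarrow> bilinear_map A B (A \<boxtimes> B) (pure_tensor A B)"
  by (intro tensor_product.bilinear_pure tensor_productI)

lemma pure_tens_closed:
  "\<lbrakk>is_bun A; is_bun B; h \<in> carrier A; h' \<in> carrier B\<rbrakk> \<Longrightarrow> pure_tensor A B h h' \<in> carrier (A \<boxtimes> B)"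
  using bilinear_mapD(3)[OF bilinear_tens] .

lemma homog_gens_tens:
  "\<lbrakk>is_bun A; is_bun B; homog_gens K A S; homog_gens K B S'\<rbrakk>
    \<Longrightarrow> homog_gens K (A \<boxtimes> B) (pure_gens K A B S S')"
  using bundle_pair.homog_gens_pure_gens[OF bundle_pairI] .

lemma homog_gens_self: "is_bun A \<Longrightarrow> homog_gens K A (homog A)"
  by (rule equivariant_bundle.homog_gens_homog)

lemma homog_gens_mem:
  assumes "is_bun A" "homog_gens K A S" "x \<in> carrier K" "s \<in> S x"
  shows "s \<in> homog A x"
  using assms pre_hilbert.lspan_base[OF bundle_pre_hilbert[OF assms(1)], of "S x" s]
  by (auto simp: homog_gens_def)

lemma homog_in_carrier: "\<lbrakk>is_bun A; k \<in> carrier K; h \<in> homog A k\<rbrakk> \<Longrightarrow> h \<in> carrier A"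
  by (rule equivariant_bundle.in_homog_carrier)

lemma pure_tens_homog:
  assumes "is_bun A" "is_bun B" "x \<in> carrier K" "y \<in> carrier K" "h \<in> homog A x" "h' \<in> homog B y"
  shows "pure_tensor A B h h' \<in> homog (A \<boxtimes> B) (x \<otimes>\<^bsub>K\<^esub> y)"
  using assms
  by (intro homog_gens_mem[OF bundle_tens homog_gens_tens[OF _ _ homog_gens_self homog_gens_self]]
      pure_gensI) auto

lemma act_tens:
  "\<lbrakk>is_bun A; is_bun B; \<sigma> \<in> carrier G; x \<in> carrier K; y \<in> carrier K; h \<in> homog A x; h' \<in> homog B y\<rbrakk>
    \<Longrightarrow> act (A \<boxtimes> B) \<sigma> (pure_tensor A B h h')
      = beta K \<sigma> x y \<odot>\<^bsub>A \<boxtimes> B\<^esub> pure_tensor A B (act A \<sigma> h) (act B \<sigma> h')"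
  using bundle_pair.tensor_act(2)[OF bundle_pairI] .

lemma linear_maps_eq_gens:
  assumes "is_bun A" "is_bun B" "f \<in> linear_maps A B" "g \<in> linear_maps A B" "homog_gens K A S"
    and "\<And>x s. \<lbrakk>x \<in> carrier K; s \<in> S x\<rbrakk> \<Longrightarrow> f s = g s"
  shows "f = g"
proof (rule linear_maps_eqI[OF bundle_pre_hilbert[OF assms(1)] bundle_pre_hilbert[OF assms(2)] assms(3,4)])
  show "(\<Union>x\<in>carrier K. S x) \<subseteq> carrier A" using assms(5) by (auto simp: homog_gens_def)
  show "carrier A \<subseteq> lspan A (\<Union>x\<in>carrier K. S x)"
    using equivariant_bundle.homog_gens_carrier[OF assms(1,5)] by simp
qed (use assms(6) in auto)

text \<open>Preserving a degree and commuting with linear actions are linear conditions on the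
  vector, so any convenient generating family decides them.\<close>

lemma hom_mapI:
  assumes A: "is_bun A" and B: "is_bun B" and f: "f \<in> linear_maps A B" and S: "homog_gens K A S"
    and homog: "\<And>x s. \<lbrakk>x \<in> carrier K; s \<in> S x\<rbrakk> \<Longrightarrow> f s \<in> homog B x"
    and equiv: "\<And>\<sigma> x s. \<lbrakk>\<sigma> \<in> carrier G; x \<in> carrier K; s \<in> S x\<rbrakk> \<Longrightarrow> f (act A \<sigma> s) = act B \<sigma> (f s)"
  shows "hom_map A B f"
proof -
  note A' = bundle_pre_hilbert[OF A] and B' = bundle_pre_hilbert[OF B] and f' = linear_mapsD[OF f]
  have "f h \<in> homog B k" if k: "k \<in> carrier K" "h \<in> homog A k" for h k
  proof -
    have "f h \<in> lspan B (homog B k)"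
    proof (rule linear_map_lspan[OF A' B' f'])
      show "homog B k \<subseteq> carrier B" using homog_in_carrier[OF B] k by blast
      show "S k \<subseteq> carrier A" "h \<in> lspan A (S k)" using S k by (auto simp: homog_gens_def)
      show "f s \<in> lspan B (homog B k)" if "s \<in> S k" for s
        using homog[OF k(1) that] k equivariant_bundle.lspan_homog[OF B] by simp
    qed
    then show ?thesis using equivariant_bundle.lspan_homog[OF B] k by simp
  qed
  moreover have "f (act A \<sigma> h) = act B \<sigma> (f h)" if \<sigma>: "\<sigma> \<in> carrier G" and h: "h \<in> carrier A" for \<sigma> h
  proof (rule linear_map_eq_on_lspan[OF A' B', where S = "\<Union>x\<in>carrier K. S x"
        and f = "\<lambda>h. f (act A \<sigma> h)"])
    show "linear_map A B (\<lambda>h. f (act A \<sigma> h))" "linear_map A B (\<lambda>h. act B \<sigma> (f h))"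
      using linear_map_comp[OF equivariant_bundle.act_linear[OF A \<sigma>] f']
        linear_map_comp[OF f' equivariant_bundle.act_linear[OF B \<sigma>]] by auto
    show "(\<Union>x\<in>carrier K. S x) \<subseteq> carrier A" using S by (auto simp: homog_gens_def)
    show "h \<in> lspan A (\<Union>x\<in>carrier K. S x)"
      using equivariant_bundle.homog_gens_carrier[OF A S] h by simp
  qed (use equiv \<sigma> in auto)
  ultimately show ?thesis using f by (auto simp: bun_hom_def)
qed

text \<open>The graded extension with constant scalar 1 gives the right values on homogeneous
  vectors. As no scalar depends on the degrees any more, bilinearity spreads the formula to all
  vectors.\<close>

lemma universal_property:
  assumes A: "is_bun A" and B: "is_bun B" and U: "is_bun U" and u: "bilinear_map A B U u"
  shows "\<exists>!f. f \<in> linear_maps (A \<boxtimes> B) U \<and>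
    (\<forall>h\<in>carrier A. \<forall>h'\<in>carrier B. f (pure_tensor A B h h') = u h h')"
proof (rule ex_ex1I)
  note A' = bundle_pre_hilbert[OF A] and B' = bundle_pre_hilbert[OF B] and U' = bundle_pre_hilbert[OF U]
  obtain f where f: "f \<in> linear_maps (A \<boxtimes> B) U"
    "\<And>x y h h'. \<lbrakk>x \<in> carrier K; y \<in> carrier K; h \<in> homog A x; h' \<in> homog B y\<rbrakk>
      \<Longrightarrow> f (pure_tensor A B h h') = 1 \<odot>\<^bsub>U\<^esub> u h h'"
    using graded_bilinear_extension[OF A B tensor_productI[OF A B] U' u, of "\<lambda>x y. 1"] by blast
  have "f (pure_tensor A B h h') = u h h'" if "h \<in> carrier A" "h' \<in> carrier B" for h h'
  proof (rule bilinear_map_eq_on_lspan[OF A' B' U'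
        bilinear_map_comp[OF bilinear_tens[OF A B] linear_mapsD[OF f(1)]] u])
    show "h \<in> lspan A (\<Union>x\<in>carrier K. homog A x)" "h' \<in> lspan B (\<Union>x\<in>carrier K. homog B x)"
      using that equivariant_bundle.carrier_lspan_homog A B by auto
    show "(\<Union>x\<in>carrier K. homog A x) \<subseteq> carrier A" "(\<Union>x\<in>carrier K. homog B x) \<subseteq> carrier B"
      using homog_in_carrier A B by auto
    show "f (pure_tensor A B s s') = u s s'"
      if "s \<in> (\<Union>x\<in>carrier K. homog A x)" "s' \<in> (\<Union>x\<in>carrier K. homog B x)" for s s'
      using that f(2) bilinear_mapD(3)[OF u] homog_in_carrier[OF A] homog_in_carrier[OF B]
        module.smult_one[OF pre_hilbert.axioms(1)[OF U']] by auto
  qed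
  then show "\<exists>f. f \<in> linear_maps (A \<boxtimes> B) U \<and>
    (\<forall>h\<in>carrier A. \<forall>h'\<in>carrier B. f (pure_tensor A B h h') = u h h')"
    using f(1) by blast
next
  fix f g
  assume f: "f \<in> linear_maps (A \<boxtimes> B) U \<and>
      (\<forall>h\<in>carrier A. \<forall>h'\<in>carrier B. f (pure_tensor A B h h') = u h h')"
    and g: "g \<in> linear_maps (A \<boxtimes> B) U \<and>
      (\<forall>h\<in>carrier A. \<forall>h'\<in>carrier B. g (pure_tensor A B h h') = u h h')"
  show "f = g"
  proof (rule linear_maps_eq_gens[OF bundle_tens[OF A B] U _ _
        homog_gens_tens[OF A B homog_gens_self[OF A] homog_gens_self[OF B]]])
    show "f s = g s" if "s \<in> pure_gens K A B (homog A) (homog B) x" for x s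
      using that f g homog_in_carrier[OF A] homog_in_carrier[OF B] by (auto simp: pure_gens_def)
  qed (use f g in auto)
qed

text \<open>Turns the definite description inside \<open>bun_tensor_arr\<close> into an arrow with a
  usable formula. Equivariance holds because \<open>f\<close> and \<open>g\<close> preserve degrees,
  so that source and target contribute the same factor \<open>beta\<close>.\<close>

lemma tensor_arr:
  assumes A: "is_bun A" and A': "is_bun A'" and B: "is_bun B" and B': "is_bun B'"
    and f: "hom_map A A' f" and g: "hom_map B B' g"
  obtains t where "bun_tensor_arr K (A, f, A') (B, g, B') = (A \<boxtimes> B, t, A' \<boxtimes> B')"
    "hom_map (A \<boxtimes> B) (A' \<boxtimes> B') t"
    "\<And>h h'. \<lbrakk>h \<in> carrier A; h' \<in> carrier B\<rbrakk> \<Longrightarrow> t (pure_tensor A B h h') = pure_tensor A' B' (f h) (g h')"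
proof -
  note f' = bun_hom_arrD[OF f] and g' = bun_hom_arrD[OF g]
  have bil: "bilinear_map A B (A' \<boxtimes> B') (\<lambda>h h'. pure_tensor A' B' (f h) (g h'))"
    by (intro bilinear_map_precomp[OF bilinear_tens[OF A' B']] f' g')
  define t where "t = (THE t. t \<in> linear_maps (A \<boxtimes> B) (A' \<boxtimes> B') \<and>
    (\<forall>h\<in>carrier A. \<forall>h'\<in>carrier B. t (pure_tensor A B h h') = pure_tensor A' B' (f h) (g h')))"
  from theI'[OF universal_property[OF A B bundle_tens[OF A' B'] bil]]
  have t: "t \<in> linear_maps (A \<boxtimes> B) (A' \<boxtimes> B')"
    and tp: "\<And>h h'. \<lbrakk>h \<in> carrier A; h' \<in> carrier B\<rbrakk>
      \<Longrightarrow> t (pure_tensor A B h h') = pure_tensor A' B' (f h) (g h')"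
    unfolding t_def by auto
  have "hom_map (A \<boxtimes> B) (A' \<boxtimes> B') t"
  proof (rule hom_mapI[OF bundle_tens[OF A B] bundle_tens[OF A' B'] t
        homog_gens_tens[OF A B homog_gens_self[OF A] homog_gens_self[OF B]]])
    fix k s assume "s \<in> pure_gens K A B (homog A) (homog B) k"
    then obtain h h' x y where s: "s = pure_tensor A B h h'" "x \<in> carrier K" "y \<in> carrier K"
      "x \<otimes>\<^bsub>K\<^esub> y = k" "h \<in> homog A x" "h' \<in> homog B y" by (rule pure_gensE)
    have c: "h \<in> carrier A" "h' \<in> carrier B" using homog_in_carrier[OF A s(2,5)] homog_in_carrier[OF B s(3,6)] by auto
    have fg: "f h \<in> homog A' x" "g h' \<in> homog B' y" using s f' g' by auto
    show "t s \<in> homog (A' \<boxtimes> B') k"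
      using pure_tens_homog[OF A' B' s(2,3) fg] s c by (simp add: tp)
    fix \<sigma> assume \<sigma>: "\<sigma> \<in> carrier G"
    have c': "act A \<sigma> h \<in> carrier A" "act B \<sigma> h' \<in> carrier B"
      using c linear_mapD(1)[OF equivariant_bundle.act_linear[OF A \<sigma>]]
        linear_mapD(1)[OF equivariant_bundle.act_linear[OF B \<sigma>]] by auto
    have "t (act (A \<boxtimes> B) \<sigma> s) = beta K \<sigma> x y \<odot>\<^bsub>A' \<boxtimes> B'\<^esub> t (pure_tensor A B (act A \<sigma> h) (act B \<sigma> h'))"
      unfolding s(1) act_tens[OF A B \<sigma> s(2,3,5,6)]
      using linear_mapD(3)[OF linear_mapsD[OF t]] pure_tens_closed[OF A B c'] by simp
    also have "\<dots> = act (A' \<boxtimes> B') \<sigma> (t s)"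
      using c c' \<sigma> by (simp add: s(1) tp act_tens[OF A' B' \<sigma> s(2,3) fg] f'(4) g'(4))
    finally show "t (act (A \<boxtimes> B) \<sigma> s) = act (A' \<boxtimes> B') \<sigma> (t s)" .
  qed
  moreover have "bun_tensor_arr K (A, f, A') (B, g, B') = (A \<boxtimes> B, t, A' \<boxtimes> B')"
    by (simp add: t_def)
  ultimately show thesis using tp that by blast
qed

end

section \<open>The unit constraints\<close>

lemma bun_unit_simps [simp]:
  "carrier (bun_unit K) = range Scalar" "\<zero>\<^bsub>bun_unit K\<^esub> = Scalar 0"
  "Scalar a \<oplus>\<^bsub>bun_unit K\<^esub> Scalar b = Scalar (a + b)"
  "c \<odot>\<^bsub>bun_unit K\<^esub> Scalar a = Scalar (c * a)"
  "iprod (bun_unit K) (Scalar a) (Scalar b) = a * cnj b"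
  "homog (bun_unit K) k = (if k = \<one>\<^bsub>K\<^esub> then range Scalar else {Scalar 0})"
  "act (bun_unit K) \<sigma> v = v"
  by (simp_all add: bun_unit_def)

lemma pre_hilbert_unit: "pre_hilbert (bun_unit K)"
proof (intro pre_hilbert.intro pre_hilbert_axioms.intro moduleI)
  show "cring complex_ring" by (rule cring_from_type_algebra)
  show "abelian_group (bun_unit K)"
  proof (rule abelian_groupI)
    fix v assume "v \<in> carrier (bun_unit K)"
    then obtain a where "v = Scalar a" by auto
    then show "\<exists>w\<in>carrier (bun_unit K). w \<oplus>\<^bsub>bun_unit K\<^esub> v = \<zero>\<^bsub>bun_unit K\<^esub>"
      by (intro bexI[of _ "Scalar (- a)"]) auto
  qed (auto simp: algebra_simps)
qed (auto simp: algebra_simps)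

lemma lspan_unit: "lspan (bun_unit K) {Scalar 1} = range Scalar"
proof
  show "lspan (bun_unit K) {Scalar 1} \<subseteq> range Scalar"
    using pre_hilbert.lspan_carrier[OF pre_hilbert_unit, of "{Scalar 1}" K] by auto
  show "range Scalar \<subseteq> lspan (bun_unit K) {Scalar 1}"
    using lspan.add_smult[OF lspan.zero, of "Scalar 1" "{Scalar 1}" "bun_unit K"] by auto
qed

context pseudomonoid
begin

text \<open>The trivial action obeys the twisted law because \<open>alpha\<close> is normalised in
  the unit degree and all other components are zero.\<close>

lemma bundle_unit: "is_bun (bun_unit K :: ('g, 'k, 'a tvec) bun)"
proof -
  let ?I = "bun_unit K :: ('g, 'k, 'a tvec) bun"
  interpret I: pre_hilbert ?I by (rule pre_hilbert_unit)
  have gact1: "gact K \<sigma> \<one>\<^bsub>K\<^esub> = \<one>\<^bsub>K\<^esub>" if \<sigma>: "\<sigma> \<in> carrier G" for \<sigma>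
  proof -
    \<comment> \<open>Elements of \<open>iso\<close> are only known to be multiplicative and
      bijective. Writing the unit as the image of some \<open>x\<close> shows that it is
      preserved.\<close>
    obtain x where x: "x \<in> carrier K" "gact K \<sigma> x = \<one>\<^bsub>K\<^esub>"
      using gact_image[OF \<sigma>] by (metis K.one_closed imageE)
    have "gact K \<sigma> \<one>\<^bsub>K\<^esub> = gact K \<sigma> \<one>\<^bsub>K\<^esub> \<otimes>\<^bsub>K\<^esub> gact K \<sigma> x" using \<sigma> x by simp
    also have "\<dots> = gact K \<sigma> (\<one>\<^bsub>K\<^esub> \<otimes>\<^bsub>K\<^esub> x)" using \<sigma> x by (simp only: gact_mult K.one_closed)
    finally show ?thesis using x by simp
  qed
  \<comment> \<open>Needed for the grading: the identity map must carry each component of the unit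
    object onto the component of the translated degree.\<close>
  have gact_1: "gact K \<sigma> k = \<one>\<^bsub>K\<^esub> \<longleftrightarrow> k = \<one>\<^bsub>K\<^esub>" if \<sigma>: "\<sigma> \<in> carrier G" and "k \<in> carrier K" for \<sigma> k
  proof
    assume "gact K \<sigma> k = \<one>\<^bsub>K\<^esub>"
    then have "gact K (inv \<sigma>) (gact K \<sigma> k) = \<one>\<^bsub>K\<^esub>" using gact1 \<sigma> by simp
    then show "k = \<one>\<^bsub>K\<^esub>" using that by (simp flip: gact_comp)
  qed (use gact1 \<sigma> in simp)
  have "onb ?I {Scalar 1}"
    using lspan_unit by (auto simp: onb_def orthonormal_def)
  then have "fd_hilbert ?I" by (rule I.onb_fd_hilbert)
  then show ?thesis
  proof (intro equivariant_bundle.intro equivariant_bundle_axioms.intro)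
    show "submodule (homog ?I k) complex_ring ?I" for k
      by (rule I.submoduleI) (auto simp: I.a_inv_eq)
    show "\<exists>F h. finite F \<and> F \<subseteq> carrier K \<and> (\<forall>k\<in>F. h k \<in> homog ?I k) \<and> x = finsum ?I h F"
      if x: "x \<in> carrier ?I" for x
    proof (intro exI conjI)
      show "x = finsum ?I (\<lambda>_. x) {\<one>\<^bsub>K\<^esub>}" using x by (auto simp: I.finsum_insert)
    qed (use x in auto)
    show "unitary_op ?I (act ?I \<sigma>)" for \<sigma>
      by (auto simp: unitary_op_def linear_map_def bij_betw_def inj_on_def)
  qed (auto simp: gact_1 alpha_normalized split: if_splits)
qed

lemma lunit_bilinear:
  assumes "is_bun A"
  shows "bilinear_map (bun_unit K) A A (\<lambda>v h. case v of Scalar c \<Rightarrow> c \<odot>\<^bsub>A\<^esub> h)"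
proof -
  interpret A: pre_hilbert A using assms by (rule bundle_pre_hilbert)
  show ?thesis
    by (auto simp: bilinear_map_def linear_map_def A.smult_add_left A.smult_add_right A.smult_smult
        mult.commute)
qed

lemma runit_bilinear:
  assumes "is_bun A"
  shows "bilinear_map A (bun_unit K) A (\<lambda>h v. case v of Scalar c \<Rightarrow> c \<odot>\<^bsub>A\<^esub> h)"
proof -
  interpret A: pre_hilbert A using assms by (rule bundle_pre_hilbert)
  show ?thesis
    by (auto simp: bilinear_map_def linear_map_def A.smult_add_left A.smult_add_right A.smult_smult
        mult.commute)
qed

end

section \<open>Composition of morphisms; the unit constraints as arrows\<close>

context pseudomonoid
begin

lemma hom_map_comp:
  assumes "is_bun A" "hom_map A B f" "hom_map B C g"
  shows "hom_map A C (compose (carrier A) g f)"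
proof -
  note f = bun_hom_arrD[OF assms(2)] and g = bun_hom_arrD[OF assms(3)]
  interpret A: equivariant_bundle G K A by fact
  have "compose (carrier A) g f \<in> linear_maps A C"
    using f(1) g(1) A.pre_hilbert by (rule linear_maps_compose)
  moreover have "compose (carrier A) g f h \<in> homog C k" if "k \<in> carrier K" "h \<in> homog A k" for h k
    using that f(3) g(3) A.in_homog_carrier by (simp add: compose_eq)
  moreover have "compose (carrier A) g f (act A \<sigma> h) = act C \<sigma> (compose (carrier A) g f h)"
    if "\<sigma> \<in> carrier G" "h \<in> carrier A" for \<sigma> h
    using that f(4) g(4) linear_mapD(1)[OF A.act_linear] linear_mapD(1)[OF f(2)]
    by (simp add: compose_eq)
  ultimately show ?thesis by (auto simp: bun_hom_def)
qed

lemma hom_map_id: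
  assumes "is_bun A"
  shows "hom_map A A (\<lambda>h\<in>carrier A. h)"
proof -
  interpret A: equivariant_bundle G K A by fact
  have "(\<lambda>h\<in>carrier A. h) \<in> linear_maps A A"
    by (intro restrict_linear_maps A.pre_hilbert) (simp add: linear_map_def)
  then show ?thesis
    using A.in_homog_carrier linear_mapD(1)[OF A.act_linear] by (auto simp: bun_hom_def)
qed

lemma hom_map_eqI:
  assumes "is_bun A" "is_bun B" "hom_map A B f" "hom_map A B g" "homog_gens K A S"
    and "\<And>x s. \<lbrakk>x \<in> carrier K; s \<in> S x\<rbrakk> \<Longrightarrow> f s = g s"
  shows "f = g"
  using linear_maps_eq_gens[OF assms(1,2) bun_hom_arrD(1)[OF assms(3)] bun_hom_arrD(1)[OF assms(4)]
      assms(5,6)] .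

lemma bun_comp_eq_id:
  assumes "is_bun A" "hom_map A B f" "hom_map B A g" "homog_gens K A S"
    and "\<And>x s. \<lbrakk>x \<in> carrier K; s \<in> S x\<rbrakk> \<Longrightarrow> g (f s) = s"
  shows "bun_comp (B, g, A) (A, f, B) = bun_id A"
proof -
  have "compose (carrier A) g f = (\<lambda>h\<in>carrier A. h)"
  proof (rule hom_map_eqI[OF assms(1,1) hom_map_comp[OF assms(1-3)] hom_map_id[OF assms(1)] assms(4)])
    show "compose (carrier A) g f s = (\<lambda>h\<in>carrier A. h) s" if "x \<in> carrier K" "s \<in> S x" for x s
    proof -
      have "s \<in> carrier A" using assms(4) that by (auto simp: homog_gens_def)
      then show ?thesis using assms(5)[OF that] by (simp add: compose_eq)
    qed
  qed
  then show ?thesis by (simp add: bun_id_def)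
qed

text \<open>Off the unit degree the empty set is taken, whose span is zero. Tensors with the unit
  object are then generated by pairs of \<open>Scalar 1\<close> and a homogeneous vector, without
  coefficients and without change of degree.\<close>

definition unit_gens :: "'k \<Rightarrow> 'a tvec set" where
  "unit_gens y = (if y = \<one>\<^bsub>K\<^esub> then {Scalar 1} else {})"

lemma homog_gens_unit: "homog_gens K (bun_unit K) unit_gens"
  by (auto simp: homog_gens_def unit_gens_def lspan_unit lspan_empty)

lemma lunit_arr:
  assumes A: "is_bun A"
  obtains t where "bun_lunit K A = (bun_unit K \<boxtimes> A, t, A)" "hom_map (bun_unit K \<boxtimes> A) A t"
    "\<And>c h. h \<in> carrier A \<Longrightarrow> t (pure_tensor (bun_unit K) A (Scalar c) h) = c \<odot>\<^bsub>A\<^esub> h"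
proof -
  let ?I = "bun_unit K :: ('g, 'k, 'a tvec) bun"
  note I = bundle_unit[where 'a = 'a]
  interpret A: equivariant_bundle G K A by fact
  define t where "t = (THE f. f \<in> linear_maps (?I \<boxtimes> A) A \<and>
    (\<forall>c. \<forall>h\<in>carrier A. f (pure_tensor ?I A (Scalar c) h) = c \<odot>\<^bsub>A\<^esub> h))"
  \<comment> \<open>On the carrier of the unit object the case expression becomes scalar
    multiplication, which gives the description used in \<open>bun_lunit\<close>.\<close>
  from universal_property[OF I A A lunit_bilinear[OF A]]
  have "\<exists>!f. f \<in> linear_maps (?I \<boxtimes> A) A \<and>
    (\<forall>c. \<forall>h\<in>carrier A. f (pure_tensor ?I A (Scalar c) h) = c \<odot>\<^bsub>A\<^esub> h)"
    by simp
  from theI'[OF this, folded t_def]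
  have t: "t \<in> linear_maps (?I \<boxtimes> A) A"
    and tp: "\<And>c h. h \<in> carrier A \<Longrightarrow> t (pure_tensor ?I A (Scalar c) h) = c \<odot>\<^bsub>A\<^esub> h"
    by auto
  have "hom_map (?I \<boxtimes> A) A t"
  proof (rule hom_mapI[OF bundle_tens[OF I A] A t
        homog_gens_tens[OF I A homog_gens_unit homog_gens_self[OF A]]])
    fix k s assume "s \<in> pure_gens K ?I A unit_gens (homog A) k"
    then obtain h where s: "s = pure_tensor ?I A (Scalar 1) h" "k \<in> carrier K" "h \<in> homog A k"
      by (auto simp: pure_gens_def unit_gens_def split: if_splits)
    have h: "h \<in> carrier A" using s A.in_homog_carrier by blast
    show "t s \<in> homog A k" using s h by (simp add: tp)
    fix \<sigma> assume \<sigma>: "\<sigma> \<in> carrier G"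
    have \<sigma>h: "act A \<sigma> h \<in> carrier A" using h linear_mapD(1)[OF A.act_linear[OF \<sigma>]] by simp
    interpret IA: pre_hilbert "?I \<boxtimes> A" by (rule bundle_pre_hilbert[OF bundle_tens[OF I A]])
    \<comment> \<open>The factor \<open>beta\<close> has the unit of \<open>K\<close> among its
      degrees and is therefore 1.\<close>
    have "act (?I \<boxtimes> A) \<sigma> s = pure_tensor ?I A (Scalar 1) (act A \<sigma> h)"
      using act_tens[OF I A \<sigma> K.one_closed s(2), of "Scalar 1" h] s \<sigma>h \<sigma>
        pure_tens_closed[OF I A, of "Scalar 1"]
      by (simp add: beta_normalized)
    then show "t (act (?I \<boxtimes> A) \<sigma> s) = act A \<sigma> (t s)"
      using s h \<sigma>h by (simp add: tp)
  qed
  moreover have "bun_lunit K A = (?I \<boxtimes> A, t, A)" by (simp add: bun_lunit_def t_def)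
  ultimately show thesis using tp that by blast
qed

lemma runit_arr:
  assumes A: "is_bun A"
  obtains t where "bun_runit K A = (A \<boxtimes> bun_unit K, t, A)" "hom_map (A \<boxtimes> bun_unit K) A t"
    "\<And>c h. h \<in> carrier A \<Longrightarrow> t (pure_tensor A (bun_unit K) h (Scalar c)) = c \<odot>\<^bsub>A\<^esub> h"
proof -
  let ?I = "bun_unit K :: ('g, 'k, 'a tvec) bun"
  note I = bundle_unit[where 'a = 'a]
  interpret A: equivariant_bundle G K A by fact
  define t where "t = (THE f. f \<in> linear_maps (A \<boxtimes> ?I) A \<and>
    (\<forall>c. \<forall>h\<in>carrier A. f (pure_tensor A ?I h (Scalar c)) = c \<odot>\<^bsub>A\<^esub> h))"
  \<comment> \<open>The universal property quantifies over the vector first and then over the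
    carrier of the unit object; the description in \<open>bun_runit\<close> takes the scalar
    first.\<close>
  have "(\<forall>h\<in>carrier A. \<forall>v\<in>carrier ?I. f (pure_tensor A ?I h v) = (case v of Scalar c \<Rightarrow> c \<odot>\<^bsub>A\<^esub> h))
    \<longleftrightarrow> (\<forall>c. \<forall>h\<in>carrier A. f (pure_tensor A ?I h (Scalar c)) = c \<odot>\<^bsub>A\<^esub> h)" for f
    by auto
  with universal_property[OF A I A runit_bilinear[OF A]]
  have "\<exists>!f. f \<in> linear_maps (A \<boxtimes> ?I) A \<and>
    (\<forall>c. \<forall>h\<in>carrier A. f (pure_tensor A ?I h (Scalar c)) = c \<odot>\<^bsub>A\<^esub> h)"
    by simp
  from theI'[OF this, folded t_def]
  have t: "t \<in> linear_maps (A \<boxtimes> ?I) A"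
    and tp: "\<And>c h. h \<in> carrier A \<Longrightarrow> t (pure_tensor A ?I h (Scalar c)) = c \<odot>\<^bsub>A\<^esub> h"
    by auto
  have "hom_map (A \<boxtimes> ?I) A t"
  proof (rule hom_mapI[OF bundle_tens[OF A I] A t
        homog_gens_tens[OF A I homog_gens_self[OF A] homog_gens_unit]])
    fix k s assume "s \<in> pure_gens K A ?I (homog A) unit_gens k"
    then obtain h where s: "s = pure_tensor A ?I h (Scalar 1)" "k \<in> carrier K" "h \<in> homog A k"
      by (auto simp: pure_gens_def unit_gens_def split: if_splits)
    have h: "h \<in> carrier A" using s A.in_homog_carrier by blast
    show "t s \<in> homog A k" using s h by (simp add: tp)
    fix \<sigma> assume \<sigma>: "\<sigma> \<in> carrier G"
    have \<sigma>h: "act A \<sigma> h \<in> carrier A" using h linear_mapD(1)[OF A.act_linear[OF \<sigma>]] by simp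
    interpret AI: pre_hilbert "A \<boxtimes> ?I" by (rule bundle_pre_hilbert[OF bundle_tens[OF A I]])
    have "act (A \<boxtimes> ?I) \<sigma> s = pure_tensor A ?I (act A \<sigma> h) (Scalar 1)"
      using act_tens[OF A I \<sigma> s(2) K.one_closed, of h "Scalar 1"] s \<sigma>h \<sigma>
        pure_tens_closed[OF A I, of _ "Scalar 1"]
      by (simp add: beta_normalized)
    then show "t (act (A \<boxtimes> ?I) \<sigma> s) = act A \<sigma> (t s)"
      using s h \<sigma>h by (simp add: tp)
  qed
  moreover have "bun_runit K A = (A \<boxtimes> ?I, t, A)" by (simp add: bun_runit_def t_def)
  ultimately show thesis using tp that by blast
qed

text \<open>The inverse of the left unit constraint, built as a morphism in its own right;
  normalisation of \<open>beta\<close> makes it equivariant.\<close>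

lemma lunit_inverse:
  assumes A: "is_bun A"
  shows "hom_map A (bun_unit K \<boxtimes> A) (\<lambda>h\<in>carrier A. pure_tensor (bun_unit K) A (Scalar 1) h)"
    (is "hom_map A (?I \<boxtimes> A) ?t")
proof -
  note I = bundle_unit[where 'a = 'a]
  interpret A: equivariant_bundle G K A by fact
  interpret IA: pre_hilbert "?I \<boxtimes> A" by (rule bundle_pre_hilbert[OF bundle_tens[OF I A]])
  have t: "?t \<in> linear_maps A (?I \<boxtimes> A)"
    by (intro restrict_linear_maps A.pre_hilbert bilinear_mapD(2)[OF bilinear_tens[OF I A]]) simp
  show ?thesis
  proof (rule hom_mapI[OF A bundle_tens[OF I A] t homog_gens_self[OF A]])
    fix k h assume k: "k \<in> carrier K" and h: "h \<in> homog A k"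
    have hc: "h \<in> carrier A" using k h by (rule A.in_homog_carrier)
    show "?t h \<in> homog (?I \<boxtimes> A) k"
      using pure_tens_homog[OF I A K.one_closed k _ h, of "Scalar 1"] hc k by simp
    fix \<sigma> assume \<sigma>: "\<sigma> \<in> carrier G"
    have "act A \<sigma> h \<in> carrier A" using hc linear_mapD(1)[OF A.act_linear[OF \<sigma>]] by simp
    then show "?t (act A \<sigma> h) = act (?I \<boxtimes> A) \<sigma> (?t h)"
      using act_tens[OF I A \<sigma> K.one_closed k, of "Scalar 1" h] h hc \<sigma> k
        pure_tens_closed[OF I A, of "Scalar 1"]
      by (simp add: beta_normalized)
  qed
qed

lemma runit_inverse:
  assumes A: "is_bun A"
  shows "hom_map A (A \<boxtimes> bun_unit K) (\<lambda>h\<in>carrier A. pure_tensor A (bun_unit K) h (Scalar 1))"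
    (is "hom_map A (A \<boxtimes> ?I) ?t")
proof -
  note I = bundle_unit[where 'a = 'a]
  interpret A: equivariant_bundle G K A by fact
  interpret AI: pre_hilbert "A \<boxtimes> ?I" by (rule bundle_pre_hilbert[OF bundle_tens[OF A I]])
  have t: "?t \<in> linear_maps A (A \<boxtimes> ?I)"
    by (intro restrict_linear_maps A.pre_hilbert bilinear_mapD(1)[OF bilinear_tens[OF A I]]) simp
  show ?thesis
  proof (rule hom_mapI[OF A bundle_tens[OF A I] t homog_gens_self[OF A]])
    fix k h assume k: "k \<in> carrier K" and h: "h \<in> homog A k"
    have hc: "h \<in> carrier A" using k h by (rule A.in_homog_carrier)
    show "?t h \<in> homog (A \<boxtimes> ?I) k"
      using pure_tens_homog[OF A I k K.one_closed h, of "Scalar 1"] hc k by simp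
    fix \<sigma> assume \<sigma>: "\<sigma> \<in> carrier G"
    have "act A \<sigma> h \<in> carrier A" using hc linear_mapD(1)[OF A.act_linear[OF \<sigma>]] by simp
    then show "?t (act A \<sigma> h) = act (A \<boxtimes> ?I) \<sigma> (?t h)"
      using act_tens[OF A I \<sigma> k K.one_closed, of h "Scalar 1"] h hc \<sigma> k
        pure_tens_closed[OF A I, of _ "Scalar 1"]
      by (simp add: beta_normalized)
  qed
qed

end

section \<open>The associativity constraint\<close>

text \<open>Only two of the three vectors are arguments of the equation, so that it unfolds in the
  partially applied form in which \<open>bilinear_map\<close> takes its second variable.\<close>

definition left_triple ::
    "('g, 'k, 'c) twisted_monoid_scheme \<Rightarrow> ('g, 'k, 'a tvec) bun \<Rightarrow> ('g, 'k, 'a tvec) bun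
      \<Rightarrow> ('g, 'k, 'a tvec) bun \<Rightarrow> 'a tvec \<Rightarrow> 'a tvec \<Rightarrow> 'a tvec \<Rightarrow> 'a tvec" where
  "left_triple K A B C a b = pure_tensor (bun_tensor K A B) C (pure_tensor A B a b)"

definition right_triple ::
    "('g, 'k, 'c) twisted_monoid_scheme \<Rightarrow> ('g, 'k, 'a tvec) bun \<Rightarrow> ('g, 'k, 'a tvec) bun
      \<Rightarrow> ('g, 'k, 'a tvec) bun \<Rightarrow> 'a tvec \<Rightarrow> 'a tvec \<Rightarrow> 'a tvec \<Rightarrow> 'a tvec" where
  "right_triple K A B C a b = (\<lambda>c. pure_tensor A (bun_tensor K B C) a (pure_tensor B C b c))"

locale bundle_triple = pseudomonoid G K + A: equivariant_bundle G K A +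
    B: equivariant_bundle G K B + C: equivariant_bundle G K C
  for G :: "('g, 'b) monoid_scheme" (structure)
    and K :: "('g, 'k, 'c) twisted_monoid_scheme"
    and A :: "('g, 'k, 'a tvec) bun"
    and B :: "('g, 'k, 'a tvec) bun"
    and C :: "('g, 'k, 'a tvec) bun"
begin

abbreviation L :: "('g, 'k, 'a tvec) bun" where "L \<equiv> (A \<boxtimes> B) \<boxtimes> C"
abbreviation R :: "('g, 'k, 'a tvec) bun" where "R \<equiv> A \<boxtimes> (B \<boxtimes> C)"
abbreviation lt :: "'a tvec \<Rightarrow> 'a tvec \<Rightarrow> 'a tvec \<Rightarrow> 'a tvec" where "lt \<equiv> left_triple K A B C"
abbreviation rt :: "'a tvec \<Rightarrow> 'a tvec \<Rightarrow> 'a tvec \<Rightarrow> 'a tvec" where "rt \<equiv> right_triple K A B C"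

lemmas A = A.equivariant_bundle_axioms
  and B = B.equivariant_bundle_axioms
  and C = C.equivariant_bundle_axioms

lemmas AB = bundle_tens[OF A B] and BC = bundle_tens[OF B C]

lemmas L = bundle_tens[OF AB C] and R = bundle_tens[OF A BC]

sublocale L: pre_hilbert L
  by (rule bundle_pre_hilbert[OF L])

sublocale R: pre_hilbert R
  by (rule bundle_pre_hilbert[OF R])

lemma trilinear_lt: "trilinear_map A B C L lt"
  unfolding trilinear_map_def bilinear_map_def left_triple_def
proof (intro ballI conjI)
  fix b c assume "b \<in> carrier B" "c \<in> carrier C"
  then show "linear_map A L (\<lambda>a. pure_tensor (A \<boxtimes> B) C (pure_tensor A B a b) c)"
    by (rule linear_map_comp[OF bilinear_mapD(1)[OF bilinear_tens[OF A B]]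
          bilinear_mapD(1)[OF bilinear_tens[OF AB C]]])
next
  fix a c assume "a \<in> carrier A" "c \<in> carrier C"
  then show "linear_map B L (\<lambda>b. pure_tensor (A \<boxtimes> B) C (pure_tensor A B a b) c)"
    by (rule linear_map_comp[OF bilinear_mapD(2)[OF bilinear_tens[OF A B]]
          bilinear_mapD(1)[OF bilinear_tens[OF AB C]]])
next
  fix a b assume "a \<in> carrier A" "b \<in> carrier B"
  then show "linear_map C L (pure_tensor (A \<boxtimes> B) C (pure_tensor A B a b))"
    by (intro bilinear_mapD(2)[OF bilinear_tens[OF AB C]] pure_tens_closed[OF A B])
qed

lemma trilinear_rt: "trilinear_map A B C R rt"
  unfolding trilinear_map_def bilinear_map_def right_triple_def
proof (intro ballI conjI)
  fix b c assume "b \<in> carrier B" "c \<in> carrier C"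
  then show "linear_map A R (\<lambda>a. pure_tensor A (B \<boxtimes> C) a (pure_tensor B C b c))"
    by (intro bilinear_mapD(1)[OF bilinear_tens[OF A BC]] pure_tens_closed[OF B C])
next
  fix a c assume a: "a \<in> carrier A" and c: "c \<in> carrier C"
  show "linear_map B R (\<lambda>b. pure_tensor A (B \<boxtimes> C) a (pure_tensor B C b c))"
    by (rule linear_map_comp[OF bilinear_mapD(1)[OF bilinear_tens[OF B C] c]
          bilinear_mapD(2)[OF bilinear_tens[OF A BC] a]])
next
  fix a b assume a: "a \<in> carrier A" and b: "b \<in> carrier B"
  show "linear_map C R (\<lambda>c. pure_tensor A (B \<boxtimes> C) a (pure_tensor B C b c))"
    by (rule linear_map_comp[OF bilinear_mapD(2)[OF bilinear_tens[OF B C] b]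
          bilinear_mapD(2)[OF bilinear_tens[OF A BC] a]])
qed

text \<open>The product basis formed twice; injectivity at both levels recovers the three
  factors.\<close>

lemma onb_lt:
  assumes "onb A E" "onb B F" "onb C D"
  shows "onb L ((\<lambda>(e, f, d). lt e f d) ` (E \<times> F \<times> D))
    \<and> inj_on (\<lambda>(e, f, d). lt e f d) (E \<times> F \<times> D)"
proof
  note AB' = tensor_product.onb_pure[OF tensor_productI[OF A B] assms(1,2)]
  note L' = tensor_product.onb_pure[OF tensor_productI[OF AB C] AB'(1) assms(3)]
  have "(\<lambda>(e, f, d). lt e f d) ` (E \<times> F \<times> D) = {pure_tensor (A \<boxtimes> B) C p d |p d.
      p \<in> {pure_tensor A B e f |e f. e \<in> E \<and> f \<in> F} \<and> d \<in> D}"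
    by (force simp: left_triple_def)
  then show "onb L ((\<lambda>(e, f, d). lt e f d) ` (E \<times> F \<times> D))" using L'(1) by simp
  have "e = e' \<and> f = f' \<and> d = d'"
    if *: "e \<in> E" "f \<in> F" "d \<in> D" "e' \<in> E" "f' \<in> F" "d' \<in> D" "lt e f d = lt e' f' d'"
    for e f d e' f' d'
  proof -
    from * have "(pure_tensor A B e f, d) = (pure_tensor A B e' f', d')"
      by (intro inj_onD[OF L'(2)]) (auto simp: left_triple_def)
    then show ?thesis
      using inj_onD[OF AB'(2), of "(e, f)" "(e', f')"] * by simp
  qed
  then show "inj_on (\<lambda>(e, f, d). lt e f d) (E \<times> F \<times> D)"
    by (auto simp: inj_on_def)
qed

lemma onb_rt:
  assumes "onb A E" "onb B F" "onb C D"
  shows "onb R ((\<lambda>(e, f, d). rt e f d) ` (E \<times> F \<times> D))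
    \<and> inj_on (\<lambda>(e, f, d). rt e f d) (E \<times> F \<times> D)"
proof
  note BC' = tensor_product.onb_pure[OF tensor_productI[OF B C] assms(2,3)]
  note R' = tensor_product.onb_pure[OF tensor_productI[OF A BC] assms(1) BC'(1)]
  have "(\<lambda>(e, f, d). rt e f d) ` (E \<times> F \<times> D) = {pure_tensor A (B \<boxtimes> C) e p |e p.
      e \<in> E \<and> p \<in> {pure_tensor B C f d |f d. f \<in> F \<and> d \<in> D}}"
    by (force simp: right_triple_def)
  then show "onb R ((\<lambda>(e, f, d). rt e f d) ` (E \<times> F \<times> D))" using R'(1) by simp
  have "e = e' \<and> f = f' \<and> d = d'"
    if *: "e \<in> E" "f \<in> F" "d \<in> D" "e' \<in> E" "f' \<in> F" "d' \<in> D" "rt e f d = rt e' f' d'"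
    for e f d e' f' d'
  proof -
    from * have "(e, pure_tensor B C f d) = (e', pure_tensor B C f' d')"
      by (intro inj_onD[OF R'(2)]) (auto simp: right_triple_def)
    then show ?thesis
      using inj_onD[OF BC'(2), of "(f, d)" "(f', d')"] * by simp
  qed
  then show "inj_on (\<lambda>(e, f, d). rt e f d) (E \<times> F \<times> D)"
    by (auto simp: inj_on_def)
qed

definition lgens :: "'k \<Rightarrow> 'a tvec set" where
  "lgens = pure_gens K (A \<boxtimes> B) C (pure_gens K A B (homog A) (homog B)) (homog C)"

definition rgens :: "'k \<Rightarrow> 'a tvec set" where
  "rgens = pure_gens K A (B \<boxtimes> C) (homog A) (pure_gens K B C (homog B) (homog C))"

lemma homog_gens_lgens: "homog_gens K L lgens"
  unfolding lgens_def
  by (intro homog_gens_tens AB A B C homog_gens_self)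

lemma homog_gens_rgens: "homog_gens K R rgens"
  unfolding rgens_def
  by (intro homog_gens_tens BC A B C homog_gens_self)

lemma lgensE:
  assumes "s \<in> lgens k"
  obtains a b c x y z where "s = lt a b c" "x \<in> carrier K" "y \<in> carrier K" "z \<in> carrier K"
    "k = x \<otimes>\<^bsub>K\<^esub> y \<otimes>\<^bsub>K\<^esub> z" "a \<in> homog A x" "b \<in> homog B y" "c \<in> homog C z"
  using assms unfolding lgens_def left_triple_def pure_gens_def by blast

lemma rgensE:
  assumes "s \<in> rgens k"
  obtains a b c x y z where "s = rt a b c" "x \<in> carrier K" "y \<in> carrier K" "z \<in> carrier K"
    "k = x \<otimes>\<^bsub>K\<^esub> (y \<otimes>\<^bsub>K\<^esub> z)" "a \<in> homog A x" "b \<in> homog B y" "c \<in> homog C z"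
  using assms unfolding rgens_def right_triple_def pure_gens_def by blast

section \<open>Homogeneous threefold tensors and the action on them\<close>

context
  fixes x y z a b c
  assumes xyz: "x \<in> carrier K" "y \<in> carrier K" "z \<in> carrier K"
    and abc: "a \<in> homog A x" "b \<in> homog B y" "c \<in> homog C z"
begin

lemma abc_carrier: "a \<in> carrier A" "b \<in> carrier B" "c \<in> carrier C"
  using xyz abc A.in_homog_carrier B.in_homog_carrier C.in_homog_carrier by auto

lemma lt_homog: "lt a b c \<in> homog L (x \<otimes>\<^bsub>K\<^esub> y \<otimes>\<^bsub>K\<^esub> z)"
  unfolding left_triple_def
  by (intro pure_tens_homog AB A B C xyz abc K.m_closed)

lemma rt_homog: "rt a b c \<in> homog R (x \<otimes>\<^bsub>K\<^esub> (y \<otimes>\<^bsub>K\<^esub> z))"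
  unfolding right_triple_def
  by (intro pure_tens_homog BC A B C xyz abc K.m_closed)

lemma lt_closed: "lt a b c \<in> carrier L"
  using trilinear_mapD(3)[OF trilinear_lt abc_carrier] .

lemma rt_closed: "rt a b c \<in> carrier R"
  using trilinear_mapD(3)[OF trilinear_rt abc_carrier] .

context
  fixes \<sigma>
  assumes \<sigma>: "\<sigma> \<in> carrier G"
begin

lemma act_abc:
  "act A \<sigma> a \<in> homog A (gact K \<sigma> x)" "act B \<sigma> b \<in> homog B (gact K \<sigma> y)"
  "act C \<sigma> c \<in> homog C (gact K \<sigma> z)"
  using \<sigma> xyz abc A.act_in_homog B.act_in_homog C.act_in_homog by auto

lemma act_abc_carrier:
  "act A \<sigma> a \<in> carrier A" "act B \<sigma> b \<in> carrier B" "act C \<sigma> c \<in> carrier C"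
  using act_abc \<sigma> xyz A.in_homog_carrier[of "gact K \<sigma> x"] B.in_homog_carrier[of "gact K \<sigma> y"]
    C.in_homog_carrier[of "gact K \<sigma> z"] by auto

text \<open>Each tensor sign contributes one \<open>beta\<close>: the outer one sees the product of
  the first two degrees against \<open>z\<close>, the inner one sees \<open>x\<close> and
  \<open>y\<close>.\<close>

lemma act_lt:
  "act L \<sigma> (lt a b c) = (beta K \<sigma> (x \<otimes>\<^bsub>K\<^esub> y) z * beta K \<sigma> x y)
    \<odot>\<^bsub>L\<^esub> lt (act A \<sigma> a) (act B \<sigma> b) (act C \<sigma> c)"
proof -
  have "act L \<sigma> (lt a b c) = beta K \<sigma> (x \<otimes>\<^bsub>K\<^esub> y) z
      \<odot>\<^bsub>L\<^esub> pure_tensor (A \<boxtimes> B) C (act (A \<boxtimes> B) \<sigma> (pure_tensor A B a b)) (act C \<sigma> c)"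
    unfolding left_triple_def
    by (intro act_tens AB C \<sigma> K.m_closed xyz abc pure_tens_homog A B)
  also have "act (A \<boxtimes> B) \<sigma> (pure_tensor A B a b)
      = beta K \<sigma> x y \<odot>\<^bsub>A \<boxtimes> B\<^esub> pure_tensor A B (act A \<sigma> a) (act B \<sigma> b)"
    by (intro act_tens A B \<sigma> xyz abc)
  also have "pure_tensor (A \<boxtimes> B) C \<dots> (act C \<sigma> c)
      = beta K \<sigma> x y \<odot>\<^bsub>L\<^esub> lt (act A \<sigma> a) (act B \<sigma> b) (act C \<sigma> c)"
    unfolding left_triple_def
    by (intro linear_mapD(3)[OF bilinear_mapD(1)[OF bilinear_tens[OF AB C]]]
        pure_tens_closed A B act_abc_carrier)
  finally show ?thesis
    using trilinear_mapD(3)[OF trilinear_lt act_abc_carrier] by (simp add: L.smult_smult)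
qed

lemma act_rt:
  "act R \<sigma> (rt a b c) = (beta K \<sigma> x (y \<otimes>\<^bsub>K\<^esub> z) * beta K \<sigma> y z)
    \<odot>\<^bsub>R\<^esub> rt (act A \<sigma> a) (act B \<sigma> b) (act C \<sigma> c)"
proof -
  have "act R \<sigma> (rt a b c) = beta K \<sigma> x (y \<otimes>\<^bsub>K\<^esub> z)
      \<odot>\<^bsub>R\<^esub> pure_tensor A (B \<boxtimes> C) (act A \<sigma> a) (act (B \<boxtimes> C) \<sigma> (pure_tensor B C b c))"
    unfolding right_triple_def
    by (intro act_tens BC A \<sigma> K.m_closed xyz abc pure_tens_homog B C)
  also have "act (B \<boxtimes> C) \<sigma> (pure_tensor B C b c)
      = beta K \<sigma> y z \<odot>\<^bsub>B \<boxtimes> C\<^esub> pure_tensor B C (act B \<sigma> b) (act C \<sigma> c)"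
    by (intro act_tens B C \<sigma> xyz abc)
  also have "pure_tensor A (B \<boxtimes> C) (act A \<sigma> a) \<dots>
      = beta K \<sigma> y z \<odot>\<^bsub>R\<^esub> rt (act A \<sigma> a) (act B \<sigma> b) (act C \<sigma> c)"
    unfolding right_triple_def
    by (intro linear_mapD(3)[OF bilinear_mapD(2)[OF bilinear_tens[OF A BC]]]
        pure_tens_closed B C act_abc_carrier)
  finally show ?thesis
    using trilinear_mapD(3)[OF trilinear_rt act_abc_carrier] by (simp add: R.smult_smult)
qed

text \<open>\<open>theta_beta\<close> with denominators cleared. It compares the scalars of the two
  bracketings and serves the associator as well as its inverse.\<close>

lemma theta_beta':
  "theta K x y z * (beta K \<sigma> (x \<otimes>\<^bsub>K\<^esub> y) z * beta K \<sigma> x y)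
    = theta K (gact K \<sigma> x) (gact K \<sigma> y) (gact K \<sigma> z)
      * (beta K \<sigma> x (y \<otimes>\<^bsub>K\<^esub> z) * beta K \<sigma> y z)"
  using theta_beta[OF \<sigma> xyz] xyz \<sigma>
    twists_nonzero(3)[of "gact K \<sigma> x" "gact K \<sigma> y" "gact K \<sigma> z"]
    twists_nonzero(2)[of \<sigma> "x \<otimes>\<^bsub>K\<^esub> y" z] twists_nonzero(2)[of \<sigma> x y]
  by (simp add: field_simps)

end

end

text \<open>All that later arguments use about the associator; its definite description is evaluated
  once, in \<open>assoc_arr\<close>.\<close>

definition assoc_spec :: "('a tvec \<Rightarrow> 'a tvec) \<Rightarrow> bool" where
  "assoc_spec t \<longleftrightarrow> hom_map L R t \<and>
    (\<forall>x \<in> carrier K. \<forall>y \<in> carrier K. \<forall>z \<in> carrier K.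
     \<forall>a \<in> homog A x. \<forall>b \<in> homog B y. \<forall>c \<in> homog C z.
       t (lt a b c) = inverse (theta K x y z) \<odot>\<^bsub>R\<^esub> rt a b c)"

lemma assoc_specD:
  assumes "assoc_spec t"
  shows "hom_map L R t"
    and "\<lbrakk>x \<in> carrier K; y \<in> carrier K; z \<in> carrier K;
        a \<in> homog A x; b \<in> homog B y; c \<in> homog C z\<rbrakk>
      \<Longrightarrow> t (lt a b c) = inverse (theta K x y z) \<odot>\<^bsub>R\<^esub> rt a b c"
  using assms by (auto simp: assoc_spec_def)

text \<open>Existence is the graded trilinear extension with scalar the inverse of
  \<open>theta\<close>; uniqueness and the morphism conditions are tested on the generators
  \<open>lgens\<close>.\<close>

lemma assoc_arr:
  obtains t where "bun_assoc K A B C = (L, t, R)" "assoc_spec t"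
proof -
  define P where "P f \<longleftrightarrow> f \<in> linear_maps L R \<and>
    (\<forall>x \<in> carrier K. \<forall>y \<in> carrier K. \<forall>z \<in> carrier K.
     \<forall>a \<in> homog A x. \<forall>b \<in> homog B y. \<forall>c \<in> homog C z.
       f (lt a b c) = inverse (theta K x y z) \<odot>\<^bsub>R\<^esub> rt a b c)" for f
  obtain t where "P t"
    using graded_trilinear_extension[OF A B C L.pre_hilbert_axioms R.pre_hilbert_axioms
        trilinear_lt trilinear_rt onb_lt, where c = "\<lambda>x y z. inverse (theta K x y z)"]
    unfolding P_def by auto
  moreover have "f = t" if "P f" for f
  proof (rule linear_maps_eq_gens[OF L R _ _ homog_gens_lgens])
    fix k s assume "s \<in> lgens k"
    then show "f s = t s"
      by (rule lgensE) (use \<open>P f\<close> \<open>P t\<close> in \<open>simp add: P_def\<close>)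
  qed (use \<open>P f\<close> \<open>P t\<close> in \<open>auto simp: P_def\<close>)
  ultimately have "(THE f. P f) = t" by (intro the_equality)
  then have eq: "bun_assoc K A B C = (L, t, R)"
    unfolding bun_assoc_def Let_def P_def left_triple_def right_triple_def by simp
  have t: "t \<in> linear_maps L R"
    and tp: "\<And>x y z a b c. \<lbrakk>x \<in> carrier K; y \<in> carrier K; z \<in> carrier K;
        a \<in> homog A x; b \<in> homog B y; c \<in> homog C z\<rbrakk>
      \<Longrightarrow> t (lt a b c) = inverse (theta K x y z) \<odot>\<^bsub>R\<^esub> rt a b c"
    using \<open>P t\<close> by (auto simp: P_def)
  have "hom_map L R t"
  proof (rule hom_mapI[OF L R t homog_gens_lgens])
    fix k s assume "s \<in> lgens k"
    then obtain a b c x y z where s: "s = lt a b c"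
      and xyz: "x \<in> carrier K" "y \<in> carrier K" "z \<in> carrier K"
      and k: "k = x \<otimes>\<^bsub>K\<^esub> y \<otimes>\<^bsub>K\<^esub> z" and abc: "a \<in> homog A x" "b \<in> homog B y" "c \<in> homog C z"
      by (rule lgensE)
    \<comment> \<open>Associativity in \<open>K\<close> gives both bracketings of three homogeneous
      vectors the same degree.\<close>
    have k': "k = x \<otimes>\<^bsub>K\<^esub> (y \<otimes>\<^bsub>K\<^esub> z)" "k \<in> carrier K" using k xyz by (simp_all add: K.m_assoc)
    show "t s \<in> homog R k"
      using rt_homog[OF xyz abc] k' equivariant_bundle.smult_homog[OF R]
      unfolding s tp[OF xyz abc] by simp
    fix \<sigma> assume \<sigma>: "\<sigma> \<in> carrier G"
    let ?r = "rt (act A \<sigma> a) (act B \<sigma> b) (act C \<sigma> c)"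
    have \<sigma>xyz: "gact K \<sigma> x \<in> carrier K" "gact K \<sigma> y \<in> carrier K" "gact K \<sigma> z \<in> carrier K"
      using \<sigma> xyz by auto
    note act = act_abc[OF xyz abc \<sigma>]
    note cl = lt_closed[OF \<sigma>xyz act] rt_closed[OF \<sigma>xyz act] rt_closed[OF xyz abc]
    have "t (act L \<sigma> s) = (beta K \<sigma> (x \<otimes>\<^bsub>K\<^esub> y) z * beta K \<sigma> x y)
        \<odot>\<^bsub>R\<^esub> (inverse (theta K (gact K \<sigma> x) (gact K \<sigma> y) (gact K \<sigma> z)) \<odot>\<^bsub>R\<^esub> ?r)"
      unfolding s act_lt[OF xyz abc \<sigma>] linear_mapD(3)[OF linear_mapsD[OF t] cl(1)] tp[OF \<sigma>xyz act] ..
    also have "\<dots> = (inverse (theta K x y z) * (beta K \<sigma> x (y \<otimes>\<^bsub>K\<^esub> z) * beta K \<sigma> y z)) \<odot>\<^bsub>R\<^esub> ?r"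
    proof -
      have "(beta K \<sigma> (x \<otimes>\<^bsub>K\<^esub> y) z * beta K \<sigma> x y)
            * inverse (theta K (gact K \<sigma> x) (gact K \<sigma> y) (gact K \<sigma> z))
          = inverse (theta K x y z) * (beta K \<sigma> x (y \<otimes>\<^bsub>K\<^esub> z) * beta K \<sigma> y z)"
        using theta_beta'[OF xyz abc \<sigma>] twists_nonzero(3)[OF xyz] twists_nonzero(3)[OF \<sigma>xyz]
        by (simp add: field_simps)
      then show ?thesis using cl by (simp add: R.smult_smult)
    qed
    also have "\<dots> = act R \<sigma> (t s)"
      unfolding s tp[OF xyz abc]
        linear_mapD(3)[OF equivariant_bundle.act_linear[OF R \<sigma>] cl(3)] act_rt[OF xyz abc \<sigma>]
      using cl by (simp add: R.smult_smult)
    finally show "t (act L \<sigma> s) = act R \<sigma> (t s)" .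
  qed
  with tp have "assoc_spec t" by (simp add: assoc_spec_def)
  with eq show thesis by (intro that)
qed

text \<open>The same extension with the bracketings exchanged and \<open>theta\<close> in place of
  its inverse. Invertibility of the associator then amounts to cancelling scalars on
  generators.\<close>

lemma assoc_inverse:
  obtains t where "hom_map R L t"
    "\<And>x y z a b c. \<lbrakk>x \<in> carrier K; y \<in> carrier K; z \<in> carrier K;
        a \<in> homog A x; b \<in> homog B y; c \<in> homog C z\<rbrakk>
      \<Longrightarrow> t (rt a b c) = theta K x y z \<odot>\<^bsub>L\<^esub> lt a b c"
proof -
  obtain t where t: "t \<in> linear_maps R L"
    and tp: "\<And>x y z a b c. \<lbrakk>x \<in> carrier K; y \<in> carrier K; z \<in> carrier K;
        a \<in> homog A x; b \<in> homog B y; c \<in> homog C z\<rbrakk>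
      \<Longrightarrow> t (rt a b c) = theta K x y z \<odot>\<^bsub>L\<^esub> lt a b c"
    using graded_trilinear_extension[OF A B C R.pre_hilbert_axioms L.pre_hilbert_axioms
        trilinear_rt trilinear_lt onb_rt, where c = "theta K"] by auto
  have "hom_map R L t"
  proof (rule hom_mapI[OF R L t homog_gens_rgens])
    fix k s assume "s \<in> rgens k"
    then obtain a b c x y z where s: "s = rt a b c"
      and xyz: "x \<in> carrier K" "y \<in> carrier K" "z \<in> carrier K"
      and k: "k = x \<otimes>\<^bsub>K\<^esub> (y \<otimes>\<^bsub>K\<^esub> z)" and abc: "a \<in> homog A x" "b \<in> homog B y" "c \<in> homog C z"
      by (rule rgensE)
    have k': "k = x \<otimes>\<^bsub>K\<^esub> y \<otimes>\<^bsub>K\<^esub> z" "k \<in> carrier K" using k xyz by (simp_all add: K.m_assoc)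
    show "t s \<in> homog L k"
      using lt_homog[OF xyz abc] k' equivariant_bundle.smult_homog[OF L]
      unfolding s tp[OF xyz abc] by simp
    fix \<sigma> assume \<sigma>: "\<sigma> \<in> carrier G"
    let ?l = "lt (act A \<sigma> a) (act B \<sigma> b) (act C \<sigma> c)"
    have \<sigma>xyz: "gact K \<sigma> x \<in> carrier K" "gact K \<sigma> y \<in> carrier K" "gact K \<sigma> z \<in> carrier K"
      using \<sigma> xyz by auto
    note act = act_abc[OF xyz abc \<sigma>]
    note cl = rt_closed[OF \<sigma>xyz act] lt_closed[OF \<sigma>xyz act] lt_closed[OF xyz abc]
    have "t (act R \<sigma> s) = (beta K \<sigma> x (y \<otimes>\<^bsub>K\<^esub> z) * beta K \<sigma> y z)
        \<odot>\<^bsub>L\<^esub> (theta K (gact K \<sigma> x) (gact K \<sigma> y) (gact K \<sigma> z) \<odot>\<^bsub>L\<^esub> ?l)"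
      unfolding s act_rt[OF xyz abc \<sigma>] linear_mapD(3)[OF linear_mapsD[OF t] cl(1)] tp[OF \<sigma>xyz act] ..
    also have "\<dots> = (theta K x y z * (beta K \<sigma> (x \<otimes>\<^bsub>K\<^esub> y) z * beta K \<sigma> x y)) \<odot>\<^bsub>L\<^esub> ?l"
      using cl theta_beta'[OF xyz abc \<sigma>] by (simp add: L.smult_smult mult_ac)
    also have "\<dots> = act L \<sigma> (t s)"
      unfolding s tp[OF xyz abc]
        linear_mapD(3)[OF equivariant_bundle.act_linear[OF L \<sigma>] cl(3)] act_lt[OF xyz abc \<sigma>]
      using cl by (simp add: L.smult_smult)
    finally show "t (act R \<sigma> s) = act L \<sigma> (t s)" .
  qed
  with tp show thesis by (intro that)
qed

end

section \<open>The monoidal category\<close>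

context pseudomonoid
begin

section \<open>Category axioms, functoriality, naturality and coherence\<close>

lemma bundle_tripleI: "\<lbrakk>is_bun A; is_bun B; is_bun C\<rbrakk> \<Longrightarrow> bundle_triple G K A B C"
  by (intro bundle_triple.intro pseudomonoid_axioms)

lemma tensor_arr_closed:
  assumes "is_bun A" "is_bun A'" "is_bun B" "is_bun B'"
    "F \<in> bun_hom G K A A'" "H \<in> bun_hom G K B B'"
  shows "bun_tensor_arr K F H \<in> bun_hom G K (A \<boxtimes> B) (A' \<boxtimes> B')"
proof -
  obtain f g where F: "F = (A, f, A')" "H = (B, g, B')"
    using assms(5,6) by (auto elim!: bun_homE)
  show ?thesis using tensor_arr[of A A' B B' f g] assms unfolding F by metis
qed

text \<open>Hom-sets are disjoint because an arrow stores its source and target, and the identity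
  laws hold on the nose because the underlying maps are extensional.\<close>

lemma category_bun:
  "category (bun_ob G K :: ('g, 'k, 'a tvec) bun set) (bun_hom G K) bun_id bun_comp"
proof
  fix A B C D :: "('g, 'k, 'a tvec) bun" and F H J
  show "A = C \<and> B = D" if "F \<in> bun_hom G K A B" "F \<in> bun_hom G K C D"
    using that by (auto simp: bun_hom_def)
  assume A: "A \<in> bun_ob G K"
  then have A': "is_bun A" by (simp add: bun_ob_def)
  show "bun_id A \<in> bun_hom G K A A"
    using hom_map_id[OF A'] by (simp add: bun_id_def)
  assume F: "F \<in> bun_hom G K A B"
  then obtain f where f: "F = (A, f, B)" "f \<in> linear_maps A B" "linear_map A B f"
    by (rule bun_homE)
  have fc: "f x \<in> carrier B" if "x \<in> carrier A" for x
    using linear_mapD(1)[OF f(3) that] .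
  have ext: "f \<in> extensional (carrier A)" using f(2) by (simp add: linear_maps_def)
  show "bun_comp F (bun_id A) = F" "bun_comp (bun_id B) F = F"
    using ext fc by (auto simp: f bun_id_def compose_def fun_eq_iff extensional_def)
  assume H: "H \<in> bun_hom G K B C"
  then obtain g where g: "H = (B, g, C)" by (rule bun_homE)
  show "bun_comp H F \<in> bun_hom G K A C"
    using hom_map_comp[OF A' F[unfolded f] H[unfolded g]] by (simp add: f g)
  assume "J \<in> bun_hom G K C D"
  then obtain j where j: "J = (C, j, D)" by (rule bun_homE)
  show "bun_comp (bun_comp J H) F = bun_comp J (bun_comp H F)"
    using fc by (auto simp: f g j compose_def)
qed

lemma bun_tensor_arr_id:
  assumes A: "is_bun A" and B: "is_bun B"
  shows "bun_tensor_arr K (bun_id A) (bun_id B) = bun_id (A \<boxtimes> B)"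
proof -
  obtain t where t: "bun_tensor_arr K (bun_id A) (bun_id B) = (A \<boxtimes> B, t, A \<boxtimes> B)"
    "hom_map (A \<boxtimes> B) (A \<boxtimes> B) t"
    "\<And>h h'. \<lbrakk>h \<in> carrier A; h' \<in> carrier B\<rbrakk> \<Longrightarrow>
      t (pure_tensor A B h h') = pure_tensor A B ((\<lambda>h\<in>carrier A. h) h) ((\<lambda>h\<in>carrier B. h) h')"
    using tensor_arr[OF A A B B hom_map_id[OF A] hom_map_id[OF B]] unfolding bun_id_def by blast
  have "t = (\<lambda>p\<in>carrier (A \<boxtimes> B). p)"
  proof (rule hom_map_eqI[OF bundle_tens[OF A B] bundle_tens[OF A B] t(2)
        hom_map_id[OF bundle_tens[OF A B]]
        homog_gens_tens[OF A B homog_gens_self[OF A] homog_gens_self[OF B]]])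
    fix k s assume "s \<in> pure_gens K A B (homog A) (homog B) k"
    then obtain h h' where "s = pure_tensor A B h h'" "h \<in> carrier A" "h' \<in> carrier B"
      using homog_in_carrier[OF A] homog_in_carrier[OF B] by (auto simp: pure_gens_def)
    then show "t s = (\<lambda>p\<in>carrier (A \<boxtimes> B). p) s"
      using pure_tens_closed[OF A B] by (simp add: t(3))
  qed
  then show ?thesis unfolding t(1) by (simp add: bun_id_def)
qed

text \<open>Both sides send a pure tensor to the pure tensor of the composed images, and morphisms
  are determined by homogeneous pure tensors.\<close>

lemma bun_tensor_arr_comp:
  assumes A: "is_bun A" and A': "is_bun A'" and A'': "is_bun A''"
    and B: "is_bun B" and B': "is_bun B'" and B'': "is_bun B''"
    and f: "hom_map A A' f" and f': "hom_map A' A'' f'" and g: "hom_map B B' g" and g': "hom_map B' B'' g'"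
  shows "bun_tensor_arr K (bun_comp (A', f', A'') (A, f, A')) (bun_comp (B', g', B'') (B, g, B'))
    = bun_comp (bun_tensor_arr K (A', f', A'') (B', g', B'')) (bun_tensor_arr K (A, f, A') (B, g, B'))"
proof -
  obtain t where t: "bun_tensor_arr K (A, f, A') (B, g, B') = (A \<boxtimes> B, t, A' \<boxtimes> B')"
    "hom_map (A \<boxtimes> B) (A' \<boxtimes> B') t"
    "\<And>h h'. \<lbrakk>h \<in> carrier A; h' \<in> carrier B\<rbrakk> \<Longrightarrow> t (pure_tensor A B h h') = pure_tensor A' B' (f h) (g h')"
    using tensor_arr[OF A A' B B' f g] by blast
  obtain t' where t': "bun_tensor_arr K (A', f', A'') (B', g', B'') = (A' \<boxtimes> B', t', A'' \<boxtimes> B'')"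
    "hom_map (A' \<boxtimes> B') (A'' \<boxtimes> B'') t'"
    "\<And>h h'. \<lbrakk>h \<in> carrier A'; h' \<in> carrier B'\<rbrakk>
      \<Longrightarrow> t' (pure_tensor A' B' h h') = pure_tensor A'' B'' (f' h) (g' h')"
    using tensor_arr[OF A' A'' B' B'' f' g'] by blast
  obtain u where u: "bun_tensor_arr K (A, compose (carrier A) f' f, A'') (B, compose (carrier B) g' g, B'')
      = (A \<boxtimes> B, u, A'' \<boxtimes> B'')"
    "hom_map (A \<boxtimes> B) (A'' \<boxtimes> B'') u"
    "\<And>h h'. \<lbrakk>h \<in> carrier A; h' \<in> carrier B\<rbrakk> \<Longrightarrow> u (pure_tensor A B h h')
      = pure_tensor A'' B'' (compose (carrier A) f' f h) (compose (carrier B) g' g h')"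
    using tensor_arr[OF A A'' B B'' hom_map_comp[OF A f f'] hom_map_comp[OF B g g']] by blast
  have "u = compose (carrier (A \<boxtimes> B)) t' t"
  proof (rule hom_map_eqI[OF bundle_tens[OF A B] bundle_tens[OF A'' B''] u(2)
        hom_map_comp[OF bundle_tens[OF A B] t(2) t'(2)]
        homog_gens_tens[OF A B homog_gens_self[OF A] homog_gens_self[OF B]]])
    fix k s assume "s \<in> pure_gens K A B (homog A) (homog B) k"
    then obtain h h' where s: "s = pure_tensor A B h h'" "h \<in> carrier A" "h' \<in> carrier B"
      using homog_in_carrier[OF A] homog_in_carrier[OF B] by (auto simp: pure_gens_def)
    then have "f h \<in> carrier A'" "g h' \<in> carrier B'"
      using linear_mapD(1)[OF bun_hom_arrD(2)[OF f]] linear_mapD(1)[OF bun_hom_arrD(2)[OF g]] by auto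
    with s show "u s = compose (carrier (A \<boxtimes> B)) t' t s"
      using pure_tens_closed[OF A B] by (simp add: u(3) t(3) t'(3) compose_eq)
  qed
  then show ?thesis by (simp only: bun_comp.simps t(1) t'(1) u(1))
qed

text \<open>Morphisms preserve degrees, so both routes acquire the same factor, the inverse of
  \<open>theta\<close> at the degrees of the three arguments.\<close>

lemma bun_assoc_natural:
  assumes A: "is_bun A" and A': "is_bun A'" and B: "is_bun B" and B': "is_bun B'"
    and C: "is_bun C" and C': "is_bun C'"
    and f: "hom_map A A' f" and g: "hom_map B B' g" and h: "hom_map C C' h"
  shows "bun_comp (bun_assoc K A' B' C')
      (bun_tensor_arr K (bun_tensor_arr K (A, f, A') (B, g, B')) (C, h, C'))
    = bun_comp (bun_tensor_arr K (A, f, A') (bun_tensor_arr K (B, g, B') (C, h, C')))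
      (bun_assoc K A B C)"
proof -
  interpret S: bundle_triple G K A B C by (rule bundle_tripleI[OF A B C])
  interpret T: bundle_triple G K A' B' C' by (rule bundle_tripleI[OF A' B' C'])
  obtain a where a: "bun_assoc K A B C = (S.L, a, S.R)" "S.assoc_spec a" by (rule S.assoc_arr)
  note a = a(1) S.assoc_specD[OF a(2)]
  obtain a' where a': "bun_assoc K A' B' C' = (T.L, a', T.R)" "T.assoc_spec a'" by (rule T.assoc_arr)
  note a' = a'(1) T.assoc_specD[OF a'(2)]
  obtain fg where fg: "bun_tensor_arr K (A, f, A') (B, g, B') = (A \<boxtimes> B, fg, A' \<boxtimes> B')"
    "hom_map (A \<boxtimes> B) (A' \<boxtimes> B') fg"
    "\<And>u v. \<lbrakk>u \<in> carrier A; v \<in> carrier B\<rbrakk> \<Longrightarrow> fg (pure_tensor A B u v) = pure_tensor A' B' (f u) (g v)"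
    using tensor_arr[OF A A' B B' f g] by blast
  obtain gh where gh: "bun_tensor_arr K (B, g, B') (C, h, C') = (B \<boxtimes> C, gh, B' \<boxtimes> C')"
    "hom_map (B \<boxtimes> C) (B' \<boxtimes> C') gh"
    "\<And>u v. \<lbrakk>u \<in> carrier B; v \<in> carrier C\<rbrakk> \<Longrightarrow> gh (pure_tensor B C u v) = pure_tensor B' C' (g u) (h v)"
    using tensor_arr[OF B B' C C' g h] by blast
  obtain l where l: "bun_tensor_arr K (A \<boxtimes> B, fg, A' \<boxtimes> B') (C, h, C') = (S.L, l, T.L)"
    "hom_map S.L T.L l"
    "\<And>u v. \<lbrakk>u \<in> carrier (A \<boxtimes> B); v \<in> carrier C\<rbrakk>
      \<Longrightarrow> l (pure_tensor (A \<boxtimes> B) C u v) = pure_tensor (A' \<boxtimes> B') C' (fg u) (h v)"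
    using tensor_arr[OF S.AB T.AB C C' fg(2) h] by blast
  obtain r where r: "bun_tensor_arr K (A, f, A') (B \<boxtimes> C, gh, B' \<boxtimes> C') = (S.R, r, T.R)"
    "hom_map S.R T.R r"
    "\<And>u v. \<lbrakk>u \<in> carrier A; v \<in> carrier (B \<boxtimes> C)\<rbrakk>
      \<Longrightarrow> r (pure_tensor A (B \<boxtimes> C) u v) = pure_tensor A' (B' \<boxtimes> C') (f u) (gh v)"
    using tensor_arr[OF A A' S.BC T.BC f gh(2)] by blast
  note f' = bun_hom_arrD[OF f] and g' = bun_hom_arrD[OF g] and h' = bun_hom_arrD[OF h]
  have "compose (carrier S.L) a' l = compose (carrier S.L) r a"
  proof (rule hom_map_eqI[OF S.L T.R hom_map_comp[OF S.L l(2) a'(2)] hom_map_comp[OF S.L a(2) r(2)]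
        S.homog_gens_lgens])
    fix k s assume "s \<in> S.lgens k"
    then obtain u v w x y z where s: "s = S.lt u v w"
      and xyz: "x \<in> carrier K" "y \<in> carrier K" "z \<in> carrier K"
      and uvw: "u \<in> homog A x" "v \<in> homog B y" "w \<in> homog C z"
      by (rule S.lgensE)
    note c = S.abc_carrier[OF xyz uvw]
    have i: "f u \<in> homog A' x" "g v \<in> homog B' y" "h w \<in> homog C' z"
      using f'(3) g'(3) h'(3) xyz uvw by auto
    have ls: "l s = T.lt (f u) (g v) (h w)"
      using c pure_tens_closed[OF A B c(1,2)] by (simp add: s left_triple_def l(3) fg(3))
    have rs: "r (S.rt u v w) = T.rt (f u) (g v) (h w)"
      using c pure_tens_closed[OF B C c(2,3)] by (simp add: right_triple_def r(3) gh(3))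
    have "a' (l s) = r (a s)"
      unfolding ls a'(3)[OF xyz i] unfolding s a(3)[OF xyz uvw]
        linear_mapD(3)[OF bun_hom_arrD(2)[OF r(2)] S.rt_closed[OF xyz uvw]] rs ..
    then show "compose (carrier S.L) a' l s = compose (carrier S.L) r a s"
      using S.lt_closed[OF xyz uvw] by (simp add: s compose_eq)
  qed
  then show ?thesis by (simp only: bun_comp.simps a(1) a'(1) fg(1) gh(1) l(1) r(1))
qed

text \<open>On the tensor of \<open>Scalar c\<close> and \<open>h\<close> both sides give
  \<open>c\<close> times \<open>f h\<close>, by linearity of \<open>f\<close>.\<close>

lemma bun_lunit_natural:
  assumes A: "is_bun A" and A': "is_bun A'" and f: "hom_map A A' f"
  shows "bun_comp (bun_lunit K A') (bun_tensor_arr K (bun_id (bun_unit K)) (A, f, A'))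
    = bun_comp (A, f, A') (bun_lunit K A)"
proof -
  let ?I = "bun_unit K :: ('g, 'k, 'a tvec) bun"
  note I = bundle_unit[where 'a = 'a]
  note f' = bun_hom_arrD[OF f]
  obtain l where l: "bun_lunit K A = (?I \<boxtimes> A, l, A)" "hom_map (?I \<boxtimes> A) A l"
    "\<And>c h. h \<in> carrier A \<Longrightarrow> l (pure_tensor ?I A (Scalar c) h) = c \<odot>\<^bsub>A\<^esub> h"
    using lunit_arr[OF A] by blast
  obtain l' where l': "bun_lunit K A' = (?I \<boxtimes> A', l', A')" "hom_map (?I \<boxtimes> A') A' l'"
    "\<And>c h. h \<in> carrier A' \<Longrightarrow> l' (pure_tensor ?I A' (Scalar c) h) = c \<odot>\<^bsub>A'\<^esub> h"
    using lunit_arr[OF A'] by blast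
  obtain t where t: "bun_tensor_arr K (bun_id ?I) (A, f, A') = (?I \<boxtimes> A, t, ?I \<boxtimes> A')"
    "hom_map (?I \<boxtimes> A) (?I \<boxtimes> A') t"
    "\<And>u v. \<lbrakk>u \<in> carrier ?I; v \<in> carrier A\<rbrakk>
      \<Longrightarrow> t (pure_tensor ?I A u v) = pure_tensor ?I A' ((\<lambda>h\<in>carrier ?I. h) u) (f v)"
    using tensor_arr[OF I I A A' hom_map_id[OF I] f] unfolding bun_id_def by blast
  have "compose (carrier (?I \<boxtimes> A)) l' t = compose (carrier (?I \<boxtimes> A)) f l"
  proof (rule hom_map_eqI[OF bundle_tens[OF I A] A' hom_map_comp[OF bundle_tens[OF I A] t(2) l'(2)]
        hom_map_comp[OF bundle_tens[OF I A] l(2) f]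
        homog_gens_tens[OF I A homog_gens_self[OF I] homog_gens_self[OF A]]])
    fix k s assume "s \<in> pure_gens K ?I A (homog ?I) (homog A) k"
    then obtain v h where "s = pure_tensor ?I A v h" "v \<in> carrier ?I" "h \<in> carrier A"
      using homog_in_carrier[OF A] homog_in_carrier[OF I] unfolding pure_gens_def by blast
    then obtain c where s: "s = pure_tensor ?I A (Scalar c) h" "h \<in> carrier A"
      by auto
    then show "compose (carrier (?I \<boxtimes> A)) l' t s = compose (carrier (?I \<boxtimes> A)) f l s"
      using pure_tens_closed[OF I A, of "Scalar c" h] linear_mapD[OF f'(2)]
      by (simp add: compose_eq l(3) l'(3) t(3))
  qed
  then show ?thesis by (simp only: bun_comp.simps l(1) l'(1) t(1))
qed

lemma bun_runit_natural:
  assumes A: "is_bun A" and A': "is_bun A'" and f: "hom_map A A' f"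
  shows "bun_comp (bun_runit K A') (bun_tensor_arr K (A, f, A') (bun_id (bun_unit K)))
    = bun_comp (A, f, A') (bun_runit K A)"
proof -
  let ?I = "bun_unit K :: ('g, 'k, 'a tvec) bun"
  note I = bundle_unit[where 'a = 'a]
  note f' = bun_hom_arrD[OF f]
  obtain l where l: "bun_runit K A = (A \<boxtimes> ?I, l, A)" "hom_map (A \<boxtimes> ?I) A l"
    "\<And>c h. h \<in> carrier A \<Longrightarrow> l (pure_tensor A ?I h (Scalar c)) = c \<odot>\<^bsub>A\<^esub> h"
    using runit_arr[OF A] by blast
  obtain l' where l': "bun_runit K A' = (A' \<boxtimes> ?I, l', A')" "hom_map (A' \<boxtimes> ?I) A' l'"
    "\<And>c h. h \<in> carrier A' \<Longrightarrow> l' (pure_tensor A' ?I h (Scalar c)) = c \<odot>\<^bsub>A'\<^esub> h"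
    using runit_arr[OF A'] by blast
  obtain t where t: "bun_tensor_arr K (A, f, A') (bun_id ?I) = (A \<boxtimes> ?I, t, A' \<boxtimes> ?I)"
    "hom_map (A \<boxtimes> ?I) (A' \<boxtimes> ?I) t"
    "\<And>u v. \<lbrakk>u \<in> carrier A; v \<in> carrier ?I\<rbrakk>
      \<Longrightarrow> t (pure_tensor A ?I u v) = pure_tensor A' ?I (f u) ((\<lambda>h\<in>carrier ?I. h) v)"
    using tensor_arr[OF A A' I I f hom_map_id[OF I]] unfolding bun_id_def by blast
  have "compose (carrier (A \<boxtimes> ?I)) l' t = compose (carrier (A \<boxtimes> ?I)) f l"
  proof (rule hom_map_eqI[OF bundle_tens[OF A I] A' hom_map_comp[OF bundle_tens[OF A I] t(2) l'(2)]
        hom_map_comp[OF bundle_tens[OF A I] l(2) f]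
        homog_gens_tens[OF A I homog_gens_self[OF A] homog_gens_self[OF I]]])
    fix k s assume "s \<in> pure_gens K A ?I (homog A) (homog ?I) k"
    then obtain v h where "s = pure_tensor A ?I h v" "v \<in> carrier ?I" "h \<in> carrier A"
      using homog_in_carrier[OF A] homog_in_carrier[OF I] unfolding pure_gens_def by blast
    then obtain c where s: "s = pure_tensor A ?I h (Scalar c)" "h \<in> carrier A"
      by auto
    then show "compose (carrier (A \<boxtimes> ?I)) l' t s = compose (carrier (A \<boxtimes> ?I)) f l s"
      using pure_tens_closed[OF A I, of h "Scalar c"] linear_mapD[OF f'(2)]
      by (simp add: compose_eq l(3) l'(3) t(3))
  qed
  then show ?thesis by (simp only: bun_comp.simps l(1) l'(1) t(1))
qed

text \<open>On a fourfold homogeneous pure tensor each arrow moves brackets and multiplies by an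
  inverse value of \<open>theta\<close> or by 1. Both routes end in multiples of the same vector,
  which leaves an equation between scalars.\<close>

lemma bun_pentagon:
  assumes A: "is_bun A" and B: "is_bun B" and C: "is_bun C" and D: "is_bun D"
  shows "bun_comp (bun_assoc K A B (C \<boxtimes> D)) (bun_assoc K (A \<boxtimes> B) C D)
    = bun_comp (bun_tensor_arr K (bun_id A) (bun_assoc K B C D))
      (bun_comp (bun_assoc K A (B \<boxtimes> C) D) (bun_tensor_arr K (bun_assoc K A B C) (bun_id D)))"
proof -
  note AB = bundle_tens[OF A B] and BC = bundle_tens[OF B C] and CD = bundle_tens[OF C D]
  interpret ABC: bundle_triple G K A B C by (rule bundle_tripleI[OF A B C])
  interpret BCD: bundle_triple G K B C D by (rule bundle_tripleI[OF B C D])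
  interpret X1: bundle_triple G K "A \<boxtimes> B" C D by (rule bundle_tripleI[OF AB C D])
  interpret X2: bundle_triple G K A B "C \<boxtimes> D" by (rule bundle_tripleI[OF A B CD])
  interpret X3: bundle_triple G K A "B \<boxtimes> C" D by (rule bundle_tripleI[OF A BC D])
  obtain p where p: "bun_assoc K A B C = (ABC.L, p, ABC.R)" "ABC.assoc_spec p" by (rule ABC.assoc_arr)
  note p = p(1) ABC.assoc_specD[OF p(2)]
  obtain q where q: "bun_assoc K B C D = (BCD.L, q, BCD.R)" "BCD.assoc_spec q" by (rule BCD.assoc_arr)
  note q = q(1) BCD.assoc_specD[OF q(2)]
  obtain a1 where a1: "bun_assoc K (A \<boxtimes> B) C D = (X1.L, a1, X1.R)" "X1.assoc_spec a1" by (rule X1.assoc_arr)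
  note a1 = a1(1) X1.assoc_specD[OF a1(2)]
  obtain a2 where a2: "bun_assoc K A B (C \<boxtimes> D) = (X2.L, a2, X2.R)" "X2.assoc_spec a2" by (rule X2.assoc_arr)
  note a2 = a2(1) X2.assoc_specD[OF a2(2)]
  obtain a3 where a3: "bun_assoc K A (B \<boxtimes> C) D = (X3.L, a3, X3.R)" "X3.assoc_spec a3" by (rule X3.assoc_arr)
  note a3 = a3(1) X3.assoc_specD[OF a3(2)]
  obtain t1 where t1: "bun_tensor_arr K (ABC.L, p, ABC.R) (bun_id D) = (X1.L, t1, X3.L)"
    "hom_map X1.L X3.L t1"
    "\<And>u v. \<lbrakk>u \<in> carrier ABC.L; v \<in> carrier D\<rbrakk>
      \<Longrightarrow> t1 (pure_tensor ABC.L D u v) = pure_tensor ABC.R D (p u) ((\<lambda>h\<in>carrier D. h) v)"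
    using tensor_arr[OF ABC.L ABC.R D D p(2) hom_map_id[OF D]] unfolding bun_id_def by blast
  obtain t2 where t2: "bun_tensor_arr K (bun_id A) (BCD.L, q, BCD.R) = (X3.R, t2, X2.R)"
    "hom_map X3.R X2.R t2"
    "\<And>u v. \<lbrakk>u \<in> carrier A; v \<in> carrier BCD.L\<rbrakk>
      \<Longrightarrow> t2 (pure_tensor A BCD.L u v) = pure_tensor A BCD.R ((\<lambda>h\<in>carrier A. h) u) (q v)"
    using tensor_arr[OF A A BCD.L BCD.R hom_map_id[OF A] q(2)] unfolding bun_id_def by blast
  have c13: "hom_map X1.L X3.R (compose (carrier X1.L) a3 t1)"
    by (rule hom_map_comp[OF X1.L t1(2) a3(2)])
  have "compose (carrier X1.L) a2 a1 = compose (carrier X1.L) t2 (compose (carrier X1.L) a3 t1)"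
  proof (rule hom_map_eqI[OF X1.L X2.R hom_map_comp[OF X1.L a1(2) a2(2)] hom_map_comp[OF X1.L c13 t2(2)]
        homog_gens_tens[OF ABC.L D ABC.homog_gens_lgens homog_gens_self[OF D]]])
    fix k s assume "s \<in> pure_gens K ABC.L D ABC.lgens (homog D) k"
    then obtain l d m z' where l: "s = pure_tensor ABC.L D l d" "z' \<in> carrier K"
      "l \<in> ABC.lgens m" "d \<in> homog D z'" by (auto simp: pure_gens_def)
    then obtain a b c x y z where abc: "l = ABC.lt a b c" and xyz: "x \<in> carrier K" "y \<in> carrier K" "z \<in> carrier K"
      and h: "a \<in> homog A x" "b \<in> homog B y" "c \<in> homog C z" by (auto elim: ABC.lgensE)
    note t = l(2) and d = l(4)
    have xy: "x \<otimes>\<^bsub>K\<^esub> y \<in> carrier K" and yz: "y \<otimes>\<^bsub>K\<^esub> z \<in> carrier K" and zt: "z \<otimes>\<^bsub>K\<^esub> z' \<in> carrier K"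
      using xyz t by auto
    have ab: "pure_tensor A B a b \<in> homog (A \<boxtimes> B) (x \<otimes>\<^bsub>K\<^esub> y)"
      using pure_tens_homog[OF A B xyz(1,2) h(1,2)] .
    have bc: "pure_tensor B C b c \<in> homog (B \<boxtimes> C) (y \<otimes>\<^bsub>K\<^esub> z)"
      using pure_tens_homog[OF B C xyz(2,3) h(2,3)] .
    have cd: "pure_tensor C D c d \<in> homog (C \<boxtimes> D) (z \<otimes>\<^bsub>K\<^esub> z')"
      using pure_tens_homog[OF C D xyz(3) t h(3) d] .
    have cA: "a \<in> carrier A" and cD: "d \<in> carrier D"
      using homog_in_carrier[OF A xyz(1) h(1)] homog_in_carrier[OF D t d] .
    \<comment> \<open>The tensor of \<open>a\<close>, \<open>b\<close>, \<open>c\<close>,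
      \<open>d\<close> with all brackets to the right, the common target of both routes.\<close>
    define e where "e = X2.rt a b (pure_tensor C D c d)"
    have e: "e \<in> carrier X2.R"
      unfolding e_def by (rule X2.rt_closed[OF xyz(1,2) zt h(1,2) cd])
    \<comment> \<open>The same vector read as a triple whose first entry is itself a tensor. Such
      rereadings, by unfolding \<open>left_triple\<close> and \<open>right_triple\<close>, are what
      links the five associators.\<close>
    have s1: "s = X1.lt (pure_tensor A B a b) c d"
      by (simp add: l(1) abc left_triple_def)
    have sc: "s \<in> carrier X1.L" unfolding s1 by (rule X1.lt_closed[OF xy xyz(3) t ab h(3) d])
    have "a1 s = inverse (theta K (x \<otimes>\<^bsub>K\<^esub> y) z z') \<odot>\<^bsub>X1.R\<^esub> X2.lt a b (pure_tensor C D c d)"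
      unfolding s1 a1(3)[OF xy xyz(3) t ab h(3) d] by (simp add: left_triple_def right_triple_def)
    then have "a2 (a1 s) = (inverse (theta K (x \<otimes>\<^bsub>K\<^esub> y) z z') * inverse (theta K x y (z \<otimes>\<^bsub>K\<^esub> z'))) \<odot>\<^bsub>X2.R\<^esub> e"
      using linear_mapD(3)[OF bun_hom_arrD(2)[OF a2(2)] X2.lt_closed[OF xyz(1,2) zt h(1,2) cd]]
        a2(3)[OF xyz(1,2) zt h(1,2) cd] e
      by (simp add: e_def X2.R.smult_smult)
    \<comment> \<open>The associator acts inside the first tensor factor, so its scalar arises there
      and is pulled out by linearity in that factor.\<close>
    moreover have "t1 s = inverse (theta K x y z) \<odot>\<^bsub>X3.L\<^esub> X3.lt a (pure_tensor B C b c) d"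
    proof -
      have "t1 s = pure_tensor ABC.R D (inverse (theta K x y z) \<odot>\<^bsub>ABC.R\<^esub> ABC.rt a b c) d"
        unfolding l(1) using ABC.lt_closed[OF xyz h] cD p(3)[OF xyz h] by (simp add: t1(3) abc)
      also have "\<dots> = inverse (theta K x y z) \<odot>\<^bsub>X3.L\<^esub> pure_tensor ABC.R D (ABC.rt a b c) d"
        by (rule linear_mapD(3)[OF bilinear_mapD(1)[OF bilinear_tens[OF ABC.R D] cD] ABC.rt_closed[OF xyz h]])
      finally show ?thesis by (simp add: left_triple_def right_triple_def)
    qed
    then have "a3 (t1 s) = (inverse (theta K x y z) * inverse (theta K x (y \<otimes>\<^bsub>K\<^esub> z) z'))
        \<odot>\<^bsub>X3.R\<^esub> X3.rt a (pure_tensor B C b c) d"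
      using linear_mapD(3)[OF bun_hom_arrD(2)[OF a3(2)] X3.lt_closed[OF xyz(1) yz t h(1) bc d]]
        a3(3)[OF xyz(1) yz t h(1) bc d] X3.rt_closed[OF xyz(1) yz t h(1) bc d]
      by (simp add: X3.R.smult_smult)
    moreover have "t2 (X3.rt a (pure_tensor B C b c) d) = inverse (theta K y z z') \<odot>\<^bsub>X2.R\<^esub> e"
    proof -
      have "t2 (X3.rt a (pure_tensor B C b c) d) = t2 (pure_tensor A BCD.L a (BCD.lt b c d))"
        by (simp add: left_triple_def right_triple_def)
      also have "\<dots> = pure_tensor A BCD.R a (inverse (theta K y z z') \<odot>\<^bsub>BCD.R\<^esub> BCD.rt b c d)"
        using BCD.lt_closed[OF xyz(2,3) t h(2,3) d] cA q(3)[OF xyz(2,3) t h(2,3) d] by (simp add: t2(3))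
      also have "\<dots> = inverse (theta K y z z') \<odot>\<^bsub>X2.R\<^esub> pure_tensor A BCD.R a (BCD.rt b c d)"
        by (rule linear_mapD(3)[OF bilinear_mapD(2)[OF bilinear_tens[OF A BCD.R] cA]
              BCD.rt_closed[OF xyz(2,3) t h(2,3) d]])
      finally show ?thesis by (simp add: e_def right_triple_def)
    qed
    ultimately have r: "t2 (a3 (t1 s)) = (inverse (theta K x y z) * inverse (theta K x (y \<otimes>\<^bsub>K\<^esub> z) z')
        * inverse (theta K y z z')) \<odot>\<^bsub>X2.R\<^esub> e"
      and l': "a2 (a1 s) = (inverse (theta K (x \<otimes>\<^bsub>K\<^esub> y) z z') * inverse (theta K x y (z \<otimes>\<^bsub>K\<^esub> z'))) \<odot>\<^bsub>X2.R\<^esub> e"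
      using linear_mapD(3)[OF bun_hom_arrD(2)[OF t2(2)] X3.rt_closed[OF xyz(1) yz t h(1) bc d]] e
      by (simp_all add: X2.R.smult_smult)
    \<comment> \<open>\<open>theta_cocycle\<close> with both sides inverted.\<close>
    have "inverse (theta K (x \<otimes>\<^bsub>K\<^esub> y) z z') * inverse (theta K x y (z \<otimes>\<^bsub>K\<^esub> z'))
        = inverse (theta K x y z) * inverse (theta K x (y \<otimes>\<^bsub>K\<^esub> z) z') * inverse (theta K y z z')"
      using theta_cocycle[OF xyz t] by (simp flip: inverse_mult_distrib)
    then have "a2 (a1 s) = t2 (a3 (t1 s))" unfolding r l' by simp
    then show "compose (carrier X1.L) a2 a1 s = compose (carrier X1.L) t2 (compose (carrier X1.L) a3 t1) s"
      using sc by (simp add: compose_eq)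
  qed
  then show ?thesis
    by (simp only: bun_comp.simps p(1) q(1) a1(1) a2(1) a3(1) t1(1) t2(1))
qed

text \<open>Generators with \<open>Scalar 1\<close> in the middle put the unit of \<open>K\<close>
  between the outer degrees, where \<open>theta\<close> is 1. Both sides then yield the pure tensor
  of the outer factors.\<close>

lemma bun_triangle:
  assumes A: "is_bun A" and B: "is_bun B"
  shows "bun_comp (bun_tensor_arr K (bun_id A) (bun_lunit K B)) (bun_assoc K A (bun_unit K) B)
    = bun_tensor_arr K (bun_runit K A) (bun_id B)"
proof -
  let ?I = "bun_unit K :: ('g, 'k, 'a tvec) bun"
  note I = bundle_unit[where 'a = 'a]
  note AI = bundle_tens[OF A I] and IB = bundle_tens[OF I B] and AB = bundle_tens[OF A B]
  interpret A: pre_hilbert A by (rule bundle_pre_hilbert[OF A])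
  interpret B: pre_hilbert B by (rule bundle_pre_hilbert[OF B])
  interpret T: bundle_triple G K A ?I B by (rule bundle_tripleI[OF A I B])
  obtain a where a: "bun_assoc K A ?I B = (T.L, a, T.R)" "T.assoc_spec a" by (rule T.assoc_arr)
  note a = a(1) T.assoc_specD[OF a(2)]
  obtain l where l: "bun_lunit K B = (?I \<boxtimes> B, l, B)" "hom_map (?I \<boxtimes> B) B l"
    "\<And>c h. h \<in> carrier B \<Longrightarrow> l (pure_tensor ?I B (Scalar c) h) = c \<odot>\<^bsub>B\<^esub> h"
    using lunit_arr[OF B] by blast
  obtain r where r: "bun_runit K A = (A \<boxtimes> ?I, r, A)" "hom_map (A \<boxtimes> ?I) A r"
    "\<And>c h. h \<in> carrier A \<Longrightarrow> r (pure_tensor A ?I h (Scalar c)) = c \<odot>\<^bsub>A\<^esub> h"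
    using runit_arr[OF A] by blast
  obtain t where t: "bun_tensor_arr K (bun_id A) (?I \<boxtimes> B, l, B) = (T.R, t, A \<boxtimes> B)"
    "hom_map T.R (A \<boxtimes> B) t"
    "\<And>u v. \<lbrakk>u \<in> carrier A; v \<in> carrier (?I \<boxtimes> B)\<rbrakk>
      \<Longrightarrow> t (pure_tensor A (?I \<boxtimes> B) u v) = pure_tensor A B ((\<lambda>h\<in>carrier A. h) u) (l v)"
    using tensor_arr[OF A A IB B hom_map_id[OF A] l(2)] unfolding bun_id_def by blast
  obtain t' where t': "bun_tensor_arr K (A \<boxtimes> ?I, r, A) (bun_id B) = (T.L, t', A \<boxtimes> B)"
    "hom_map T.L (A \<boxtimes> B) t'"
    "\<And>u v. \<lbrakk>u \<in> carrier (A \<boxtimes> ?I); v \<in> carrier B\<rbrakk>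
      \<Longrightarrow> t' (pure_tensor (A \<boxtimes> ?I) B u v) = pure_tensor A B (r u) ((\<lambda>h\<in>carrier B. h) v)"
    using tensor_arr[OF AI A B B r(2) hom_map_id[OF B]] unfolding bun_id_def by blast
  have "compose (carrier T.L) t a = t'"
  proof (rule hom_map_eqI[OF T.L AB hom_map_comp[OF T.L a(2) t(2)] t'(2)
        homog_gens_tens[OF AI B homog_gens_tens[OF A I homog_gens_self[OF A] homog_gens_unit]
          homog_gens_self[OF B]]])
    fix k s assume "s \<in> pure_gens K (A \<boxtimes> ?I) B (pure_gens K A ?I (homog A) unit_gens) (homog B) k"
    then obtain u w x z where s: "s = T.lt u (Scalar 1) w"
      and xz: "x \<in> carrier K" "z \<in> carrier K" "u \<in> homog A x" "w \<in> homog B z"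
      by (auto simp: pure_gens_def unit_gens_def left_triple_def split: if_splits)
    have v: "Scalar 1 \<in> homog ?I \<one>\<^bsub>K\<^esub>" "Scalar 1 \<in> carrier ?I" by simp_all
    have c: "u \<in> carrier A" "w \<in> carrier B"
      using homog_in_carrier[OF A xz(1,3)] homog_in_carrier[OF B xz(2,4)] by auto
    have "a s = T.rt u (Scalar 1) w"
      unfolding s a(3)[OF xz(1) K.one_closed xz(2,3) v(1) xz(4)]
      using T.rt_closed[OF xz(1) K.one_closed xz(2,3) v(1) xz(4)] xz by (simp add: theta_normalized)
    then have "t (a s) = pure_tensor A B u w"
      using c pure_tens_closed[OF I B v(2) c(2)] by (simp add: right_triple_def t(3) l(3))
    moreover have "t' s = pure_tensor A B u w"
      using c pure_tens_closed[OF A I c(1) v(2)] by (simp add: s left_triple_def t'(3) r(3))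
    ultimately show "compose (carrier T.L) t a s = t' s"
      using T.lt_closed[OF xz(1) K.one_closed xz(2,3) v(1) xz(4)] by (simp add: s compose_eq)
  qed
  then show ?thesis by (simp only: bun_comp.simps a(1) l(1) r(1) t(1) t'(1))
qed

text \<open>Stated through both composites, the form to which \<open>Iso\<close> unfolds. On
  generators \<open>theta\<close> and its inverse cancel.\<close>

lemma bun_assoc_iso:
  assumes A: "is_bun A" and B: "is_bun B" and C: "is_bun C"
  shows "\<exists>g\<in>bun_hom G K (A \<boxtimes> (B \<boxtimes> C)) ((A \<boxtimes> B) \<boxtimes> C).
    bun_comp g (bun_assoc K A B C) = bun_id ((A \<boxtimes> B) \<boxtimes> C) \<and>
    bun_comp (bun_assoc K A B C) g = bun_id (A \<boxtimes> (B \<boxtimes> C))"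
    and "bun_assoc K A B C \<in> bun_hom G K ((A \<boxtimes> B) \<boxtimes> C) (A \<boxtimes> (B \<boxtimes> C))"
proof -
  interpret T: bundle_triple G K A B C by (rule bundle_tripleI[OF A B C])
  obtain a where a: "bun_assoc K A B C = (T.L, a, T.R)" "T.assoc_spec a" by (rule T.assoc_arr)
  note a = a(1) T.assoc_specD[OF a(2)]
  obtain b where b: "hom_map T.R T.L b"
    "\<And>x y z u v w. \<lbrakk>x \<in> carrier K; y \<in> carrier K; z \<in> carrier K;
        u \<in> homog A x; v \<in> homog B y; w \<in> homog C z\<rbrakk>
      \<Longrightarrow> b (T.rt u v w) = theta K x y z \<odot>\<^bsub>T.L\<^esub> T.lt u v w"
    using T.assoc_inverse by blast
  have "bun_comp (T.R, b, T.L) (T.L, a, T.R) = bun_id T.L"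
  proof (rule bun_comp_eq_id[OF T.L a(2) b(1) T.homog_gens_lgens])
    fix k s assume "s \<in> T.lgens k"
    then obtain u v w x y z where s: "s = T.lt u v w"
      and xyz: "x \<in> carrier K" "y \<in> carrier K" "z \<in> carrier K"
      and uvw: "u \<in> homog A x" "v \<in> homog B y" "w \<in> homog C z"
      by (rule T.lgensE)
    show "b (a s) = s"
      using twists_nonzero(3)[OF xyz] T.lt_closed[OF xyz uvw]
      unfolding s a(3)[OF xyz uvw]
        linear_mapD(3)[OF bun_hom_arrD(2)[OF b(1)] T.rt_closed[OF xyz uvw]] b(2)[OF xyz uvw]
      by (simp add: T.L.smult_smult)
  qed
  moreover have "bun_comp (T.L, a, T.R) (T.R, b, T.L) = bun_id T.R"
  proof (rule bun_comp_eq_id[OF T.R b(1) a(2) T.homog_gens_rgens])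
    fix k s assume "s \<in> T.rgens k"
    then obtain u v w x y z where s: "s = T.rt u v w"
      and xyz: "x \<in> carrier K" "y \<in> carrier K" "z \<in> carrier K"
      and uvw: "u \<in> homog A x" "v \<in> homog B y" "w \<in> homog C z"
      by (rule T.rgensE)
    show "a (b s) = s"
      using twists_nonzero(3)[OF xyz] T.rt_closed[OF xyz uvw]
      unfolding s b(2)[OF xyz uvw]
        linear_mapD(3)[OF bun_hom_arrD(2)[OF a(2)] T.lt_closed[OF xyz uvw]] a(3)[OF xyz uvw]
      by (simp add: T.R.smult_smult)
  qed
  ultimately show "\<exists>g\<in>bun_hom G K T.R T.L. bun_comp g (bun_assoc K A B C) = bun_id T.L \<and>
      bun_comp (bun_assoc K A B C) g = bun_id T.R"
    using b(1) unfolding a(1) by blast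
  show "bun_assoc K A B C \<in> bun_hom G K T.L T.R" using a by simp
qed

text \<open>The composites are checked on different generators: tensors of \<open>Scalar 1\<close>
  with a homogeneous vector for one, homogeneous vectors of \<open>A\<close> for the other.\<close>

lemma bun_lunit_iso:
  assumes A: "is_bun A"
  shows "\<exists>g\<in>bun_hom G K A (bun_unit K \<boxtimes> A).
    bun_comp g (bun_lunit K A) = bun_id (bun_unit K \<boxtimes> A) \<and> bun_comp (bun_lunit K A) g = bun_id A"
    and "bun_lunit K A \<in> bun_hom G K (bun_unit K \<boxtimes> A) A"
proof -
  let ?I = "bun_unit K :: ('g, 'k, 'a tvec) bun"
  note I = bundle_unit[where 'a = 'a]
  interpret A: pre_hilbert A by (rule bundle_pre_hilbert[OF A])
  obtain l where l: "bun_lunit K A = (?I \<boxtimes> A, l, A)" "hom_map (?I \<boxtimes> A) A l"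
    "\<And>c h. h \<in> carrier A \<Longrightarrow> l (pure_tensor ?I A (Scalar c) h) = c \<odot>\<^bsub>A\<^esub> h"
    using lunit_arr[OF A] by blast
  let ?g = "\<lambda>h\<in>carrier A. pure_tensor ?I A (Scalar 1) h"
  note g = lunit_inverse[OF A]
  have "bun_comp (A, ?g, ?I \<boxtimes> A) (?I \<boxtimes> A, l, A) = bun_id (?I \<boxtimes> A)"
  proof (rule bun_comp_eq_id[OF bundle_tens[OF I A] l(2) g
        homog_gens_tens[OF I A homog_gens_unit homog_gens_self[OF A]]])
    fix k s assume "s \<in> pure_gens K ?I A unit_gens (homog A) k"
    then obtain h where "s = pure_tensor ?I A (Scalar 1) h" "h \<in> carrier A"
      using homog_in_carrier[OF A] by (auto simp: pure_gens_def unit_gens_def split: if_splits)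
    then show "?g (l s) = s" by (simp add: l(3))
  qed
  moreover have "bun_comp (?I \<boxtimes> A, l, A) (A, ?g, ?I \<boxtimes> A) = bun_id A"
  proof (rule bun_comp_eq_id[OF A g l(2) homog_gens_self[OF A]])
    show "l (?g h) = h" if "x \<in> carrier K" "h \<in> homog A x" for x h
      using homog_in_carrier[OF A that] by (simp add: l(3))
  qed
  ultimately show "\<exists>g\<in>bun_hom G K A (?I \<boxtimes> A).
    bun_comp g (bun_lunit K A) = bun_id (?I \<boxtimes> A) \<and> bun_comp (bun_lunit K A) g = bun_id A"
    using g unfolding l(1) by blast
  show "bun_lunit K A \<in> bun_hom G K (?I \<boxtimes> A) A" using l by simp
qed

lemma bun_runit_iso:
  assumes A: "is_bun A"
  shows "\<exists>g\<in>bun_hom G K A (A \<boxtimes> bun_unit K).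
    bun_comp g (bun_runit K A) = bun_id (A \<boxtimes> bun_unit K) \<and> bun_comp (bun_runit K A) g = bun_id A"
    and "bun_runit K A \<in> bun_hom G K (A \<boxtimes> bun_unit K) A"
proof -
  let ?I = "bun_unit K :: ('g, 'k, 'a tvec) bun"
  note I = bundle_unit[where 'a = 'a]
  interpret A: pre_hilbert A by (rule bundle_pre_hilbert[OF A])
  obtain l where l: "bun_runit K A = (A \<boxtimes> ?I, l, A)" "hom_map (A \<boxtimes> ?I) A l"
    "\<And>c h. h \<in> carrier A \<Longrightarrow> l (pure_tensor A ?I h (Scalar c)) = c \<odot>\<^bsub>A\<^esub> h"
    using runit_arr[OF A] by blast
  let ?g = "\<lambda>h\<in>carrier A. pure_tensor A ?I h (Scalar 1)"
  note g = runit_inverse[OF A]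
  have "bun_comp (A, ?g, A \<boxtimes> ?I) (A \<boxtimes> ?I, l, A) = bun_id (A \<boxtimes> ?I)"
  proof (rule bun_comp_eq_id[OF bundle_tens[OF A I] l(2) g
        homog_gens_tens[OF A I homog_gens_self[OF A] homog_gens_unit]])
    fix k s assume "s \<in> pure_gens K A ?I (homog A) unit_gens k"
    then obtain h where "s = pure_tensor A ?I h (Scalar 1)" "h \<in> carrier A"
      using homog_in_carrier[OF A] by (auto simp: pure_gens_def unit_gens_def split: if_splits)
    then show "?g (l s) = s" by (simp add: l(3))
  qed
  moreover have "bun_comp (A \<boxtimes> ?I, l, A) (A, ?g, A \<boxtimes> ?I) = bun_id A"
  proof (rule bun_comp_eq_id[OF A g l(2) homog_gens_self[OF A]])
    show "l (?g h) = h" if "x \<in> carrier K" "h \<in> homog A x" for x h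
      using homog_in_carrier[OF A that] by (simp add: l(3))
  qed
  ultimately show "\<exists>g\<in>bun_hom G K A (A \<boxtimes> ?I).
    bun_comp g (bun_runit K A) = bun_id (A \<boxtimes> ?I) \<and> bun_comp (bun_runit K A) g = bun_id A"
    using g unfolding l(1) by blast
  show "bun_runit K A \<in> bun_hom G K (A \<boxtimes> ?I) A" using l by simp
qed

end

theorem proposition4p1:
  fixes G :: "('g, 'b) monoid_scheme"
    and K :: "('g, 'k, 'c) twisted_monoid_scheme"
  assumes "pseudomonoid G K"
  shows "monoidal_category
    (bun_ob G K :: ('g, 'k, 'a tvec) bun set) (bun_hom G K) bun_id bun_comp
    (bun_tensor K) (bun_tensor_arr K) (bun_unit K)
    (bun_assoc K) (bun_lunit K) (bun_runit K)"
proof -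
  interpret pseudomonoid G K by fact
  \<comment> \<open>With the category part interpreted, \<open>unfold_locales\<close> leaves only
    the monoidal axioms.\<close>
  interpret cat: category "bun_ob G K :: ('g, 'k, 'a tvec) bun set" "bun_hom G K" bun_id bun_comp
    by (rule category_bun)
  have ob: "A \<in> bun_ob G K \<longleftrightarrow> is_bun A" for A :: "('g, 'k, 'a tvec) bun"
    by (simp add: bun_ob_def)
  show ?thesis
  proof (unfold_locales, unfold ob cat.Iso_def mem_Collect_eq)
    fix A A' A'' B B' B'' C C' D :: "('g, 'k, 'a tvec) bun" and F F' H H' J
    show "is_bun (bun_unit K :: ('g, 'k, 'a tvec) bun)" by (rule bundle_unit)
    assume A: "is_bun A"
    show "bun_lunit K A \<in> bun_hom G K (bun_unit K \<boxtimes> A) A \<and> (\<exists>g\<in>bun_hom G K A (bun_unit K \<boxtimes> A).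
      bun_comp g (bun_lunit K A) = bun_id (bun_unit K \<boxtimes> A) \<and> bun_comp (bun_lunit K A) g = bun_id A)"
      using bun_lunit_iso[OF A] by blast
    show "bun_runit K A \<in> bun_hom G K (A \<boxtimes> bun_unit K) A \<and> (\<exists>g\<in>bun_hom G K A (A \<boxtimes> bun_unit K).
      bun_comp g (bun_runit K A) = bun_id (A \<boxtimes> bun_unit K) \<and> bun_comp (bun_runit K A) g = bun_id A)"
      using bun_runit_iso[OF A] by blast
    \<comment> \<open>The block confines the hypotheses about arrows to functoriality and
      naturality, away from the goals that concern objects alone.\<close>
    {
      assume A': "is_bun A'" and F: "F \<in> bun_hom G K A A'"
      obtain f where f: "F = (A, f, A')" using F by (rule bun_homE)
      show "bun_comp (bun_lunit K A') (bun_tensor_arr K (bun_id (bun_unit K)) F) = bun_comp F (bun_lunit K A)"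
        using bun_lunit_natural[OF A A'] F unfolding f by blast
      show "bun_comp (bun_runit K A') (bun_tensor_arr K F (bun_id (bun_unit K))) = bun_comp F (bun_runit K A)"
        using bun_runit_natural[OF A A'] F unfolding f by blast
      assume B: "is_bun B" and B': "is_bun B'" and H: "H \<in> bun_hom G K B B'"
      obtain h where h: "H = (B, h, B')" using H by (rule bun_homE)
      show "bun_tensor_arr K F H \<in> bun_hom G K (A \<boxtimes> B) (A' \<boxtimes> B')"
        using A A' B B' F H by (rule tensor_arr_closed)
      {
        assume C: "is_bun C" and C': "is_bun C'" and J: "J \<in> bun_hom G K C C'"
        obtain j where j: "J = (C, j, C')" using J by (rule bun_homE)
        show "bun_comp (bun_assoc K A' B' C') (bun_tensor_arr K (bun_tensor_arr K F H) J)
          = bun_comp (bun_tensor_arr K F (bun_tensor_arr K H J)) (bun_assoc K A B C)"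
          using bun_assoc_natural[OF A A' B B' C C'] F H J unfolding f h j by blast
      }
      assume A'': "is_bun A''" and B'': "is_bun B''"
        and F': "F' \<in> bun_hom G K A' A''" and H': "H' \<in> bun_hom G K B' B''"
      obtain f' where f': "F' = (A', f', A'')" using F' by (rule bun_homE)
      obtain h' where h': "H' = (B', h', B'')" using H' by (rule bun_homE)
      show "bun_tensor_arr K (bun_comp F' F) (bun_comp H' H)
        = bun_comp (bun_tensor_arr K F' H') (bun_tensor_arr K F H)"
        using bun_tensor_arr_comp[OF A A' A'' B B' B''] F F' H H' unfolding f f' h h' by blast
    }
    assume B: "is_bun B"
    show "is_bun (A \<boxtimes> B)" using A B by (rule bundle_tens)
    show "bun_tensor_arr K (bun_id A) (bun_id B) = bun_id (A \<boxtimes> B)" using A B by (rule bun_tensor_arr_id)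
    show "bun_comp (bun_tensor_arr K (bun_id A) (bun_lunit K B)) (bun_assoc K A (bun_unit K) B)
      = bun_tensor_arr K (bun_runit K A) (bun_id B)"
      using A B by (rule bun_triangle)
    assume C: "is_bun C"
    show "bun_assoc K A B C \<in> bun_hom G K ((A \<boxtimes> B) \<boxtimes> C) (A \<boxtimes> B \<boxtimes> C) \<and>
      (\<exists>g\<in>bun_hom G K (A \<boxtimes> B \<boxtimes> C) ((A \<boxtimes> B) \<boxtimes> C).
        bun_comp g (bun_assoc K A B C) = bun_id ((A \<boxtimes> B) \<boxtimes> C) \<and>
        bun_comp (bun_assoc K A B C) g = bun_id (A \<boxtimes> B \<boxtimes> C))"
      using bun_assoc_iso[OF A B C] by blast
    assume D: "is_bun D"
    show "bun_comp (bun_assoc K A B (C \<boxtimes> D)) (bun_assoc K (A \<boxtimes> B) C D)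
      = bun_comp (bun_tensor_arr K (bun_id A) (bun_assoc K B C D))
        (bun_comp (bun_assoc K A (B \<boxtimes> C) D) (bun_tensor_arr K (bun_assoc K A B C) (bun_id D)))"
      using A B C D by (rule bun_pentagon)
  qed
qed

end
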